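(* Let $k\ge 3$ be an integer and let $x\in\mathsf S_{2^k}$ be a $2$-element. Then $\mathbf{Sub}_{\mathsf S_{2^k}}(x)<\mathsf S_{2^k}$ (proper subgroup) if and only if one of the following holds: (i) $x$ is a $2^k$-cycle; (ii) $o(x)=2^{k-1}$ and $\mathrm{fix}(x)>0$. Moreover, in case (ii), $\mathbf{Sub}_{\mathsf S_{2^k}}(x)=\mathbf{Sub}_{\mathsf S_{2^{k-1}}}(y)\wr\mathsf S_2$, where $y$ is the product of all cycles of length smaller than $2^{k-1}$ in the expression of $x$ as a product of disjoint cycles.
   Context: $\mathsf S_n$ is the symmetric group on $\{1,\dots,n\}$; $o(x)$ is the order of $x$ and $\mathrm{fix}(x)$ the number of points of $\{1,\dots,n\}$ fixed by $x$. A $2$-element is an element of $2$-power order. The subnormalizer of $x$ in a finite group $G$ is $\mathbf{Sub}_G(x)=\langle g\in G\mid\langle x\rangle\text{ is subnormal in }\langle x,g\rangle\rangle$. In case (ii), $x=zy$ with $z$ a single $2^{k-1}$-cycle and the support of $y$ contained in $\Omega$, the complement of the support of $z$, with $|\Omega|=2^{k-1}$; $y$ is viewed as an element of $\mathrm{Sym}(\Omega)\cong\mathsf S_{2^{k-1}}$ and $\mathbf{Sub}_{\mathsf S_{2^{k-1}}}(y)$ denotes the subnormalizer of $y$ in $\mathrm{Sym}(\Omega)$. The wreath product $\mathbf{Sub}_{\mathsf S_{2^{k-1}}}(y)\wr\mathsf S_2$ is embedded in $\mathsf S_{2^k}$ as an imprimitive subgroup preserving the partition of $\{1,\dots,2^k\}$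 into $\Omega$ and its complement (its base group being the product of a copy of $\mathbf{Sub}_{\mathsf S_{2^{k-1}}}(y)$ on each of the two blocks, with $\mathsf S_2$ swapping the blocks). *)

theory Defs
  imports "HOL-Algebra.Sym_Groups" "HOL-Algebra.Multiplicative_Group" "HOL-Combinatorics.Orbits"
begin

text \<open>\<open>sym_group_on {1..n}\<close> is the library's \<^term>\<open>sym_group n\<close>. Permutations of
  \<open>A\<close> are functions on the whole type that are the identity outside \<open>A\<close>, so \<open>Sym(A)\<close> is
  literally a subset of \<open>Sym(B)\<close> whenever \<open>A \<subseteq> B\<close>.\<close>

definition sym_group_on :: "'a set \<Rightarrow> ('a \<Rightarrow> 'a) monoid"
  where "sym_group_on A = \<lparr>carrier = {p. p permutes A}, mult = (\<circ>), one = id\<rparr>"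

lemma sym_group_on_atLeastAtMost: "sym_group_on {1..n} = sym_group n"
  by (simp add: sym_group_on_def sym_group_def)

definition subnormal :: "'a set \<Rightarrow> ('a, 'b) monoid_scheme \<Rightarrow> bool"
  where "subnormal H G \<longleftrightarrow>
    (\<exists>(n::nat) N. N 0 = H \<and> N n = carrier G \<and> (\<forall>i\<le>n. subgroup (N i) G) \<and>
       (\<forall>i<n. N i \<lhd> G\<lparr>carrier := N (Suc i)\<rparr>))"

definition subnormalizer :: "('a, 'b) monoid_scheme \<Rightarrow> 'a \<Rightarrow> 'a set"
  where "subnormalizer G x = generate G
    {g \<in> carrier G. subnormal (generate G {x}) (G\<lparr>carrier := generate G {x, g}\<rparr>)}"

definition two_element :: "('a, 'b) monoid_scheme \<Rightarrow> 'a \<Rightarrow> bool"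
  where "two_element G x \<longleftrightarrow> x \<in> carrier G \<and> (\<exists>m::nat. group.ord G x = 2 ^ m)"

text \<open>Intended for \<open>m \<ge> 2\<close>.\<close>

definition is_m_cycle :: "nat \<Rightarrow> ('a \<Rightarrow> 'a) \<Rightarrow> bool"
  where "is_m_cycle m x \<longleftrightarrow> (\<exists>cs. cycle cs \<and> length cs = m \<and> x = cycle_of_list cs)"

definition fix_count :: "nat \<Rightarrow> (nat \<Rightarrow> nat) \<Rightarrow> nat"
  where "fix_count n x = card {i \<in> {1..n}. x i = i}"

text \<open>The cycle of \<open>x\<close> through \<open>i\<close> has length \<^term>\<open>card (orbit x i)\<close>; fixed points count as
  cycles of length 1. The product of the cycles of length less than \<open>m\<close> agrees with \<open>x\<close> on the
  points of these cycles and is the identity elsewhere.\<close>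

definition short_cycle_points :: "nat \<Rightarrow> nat \<Rightarrow> (nat \<Rightarrow> nat) \<Rightarrow> nat set"
  where "short_cycle_points n m x = {i \<in> {1..n}. card (orbit x i) < m}"

definition short_cycle_part :: "nat \<Rightarrow> nat \<Rightarrow> (nat \<Rightarrow> nat) \<Rightarrow> (nat \<Rightarrow> nat)"
  where "short_cycle_part n m x = perm_restrict x (short_cycle_points n m x)"

text \<open>\<open>block_swap X A t\<close>: \<open>t\<close> is an involution of \<open>X\<close> exchanging \<open>A\<close> and \<open>X - A\<close> (so both have
  the same size); it amounts to a choice of bijection between the two blocks. For a group \<open>H\<close> of
  permutations of \<open>A\<close>, \<open>wreath_S2 H t\<close> is then \<open>H \<wr> S\<^sub>2\<close> in its imprimitive action on \<open>X\<close>: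
  the base group consists of the products \<open>a \<circ> b\<^sup>t\<close> with \<open>a\<close> acting on \<open>A\<close> and the copy
  \<open>b\<^sup>t = t \<circ> b \<circ> t\<close> of \<open>b\<close> acting on \<open>X - A\<close>, and \<open>{id, t}\<close> is the top group.\<close>

definition block_swap :: "'a set \<Rightarrow> 'a set \<Rightarrow> ('a \<Rightarrow> 'a) \<Rightarrow> bool"
  where "block_swap X A t \<longleftrightarrow> t permutes X \<and> t \<circ> t = id \<and> t ` A = X - A"

definition wreath_S2 :: "('a \<Rightarrow> 'a) set \<Rightarrow> ('a \<Rightarrow> 'a) \<Rightarrow> ('a \<Rightarrow> 'a) set"
  where "wreath_S2 H t = {a \<circ> (t \<circ> b \<circ> t) \<circ> s | a b s. a \<in> H \<and> b \<in> H \<and> s \<in> {id, t}}"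

end

theory Submission
  imports Defs "HOL-Algebra.Sylow" "HOL-Algebra.Exponent"
begin

text \<open>A subgroup generated by a \<open>p\<close>-element \<open>x\<close> is subnormal in \<open>\<langle>x, g\<rangle>\<close> iff \<open>g\<close> normalizes some
  \<open>p\<close>-subgroup \<open>Q\<close> containing \<open>x\<close>. A 2-group \<open>Q\<close> on \<open>2\<^sup>k\<close> points preserves a partition into two halves,
  because the number of such partitions is odd. If \<open>x\<close> is a full cycle, or has a cycle of half length
  and a fixed point, then this partition is determined by \<open>x\<close> alone, so it is also preserved by
  everything that normalizes \<open>Q\<close>, and the subnormalizer is imprimitive. In the second case a Frattini
  argument with a Sylow 2-subgroup containing \<open>y\<close> identifies it with the wreath product. For every
  other \<open>x\<close> there is a fixed-point-free involution \<open>u\<close> commuting with \<open>x\<close> such that \<open>x\<close> acts on the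
  orbits of \<open>u\<close> again in a non-exceptional way (unless there are only two orbits); by induction the
  subnormalizer induces all permutations of these orbits, and it contains a transposition
  that does not preserve them.\<close>

section \<open>Finite \<open>p\<close>-groups\<close>

text \<open>The equivalence with normalized p-subgroups rests on two facts: the largest normal
  p-subgroup of a term of a subnormal chain is normalized by the next term, and inside a p-group
  normalizers grow. The partition is forced for two different reasons: a full cycle must swap the
  halves, which are then the orbits of its square; a fixed point forces both halves to be invariant,
  so a cycle of half length fills one of them. The first argument can be iterated inside each half,
  so an element normalizing a 2-group that contains a full cycle lies in one fixed Sylow 2-subgroup.
  In the wreath product this bounds the action on the block of the long cycle; the block involution
  has to be chosen so that the long cycle, transported to the other block, falls into the same Sylow
  subgroup as \<open>y\<close>. In the non-exceptional case the obstacle is that halving a cycle of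
  length 2 creates a fixed point on the orbits of \<open>u\<close>. Hence \<open>u\<close> depends
  on whether \<open>x\<close> has fixed points: if it has, all other cycles are halved, so none can
  be too long; if it has none, \<open>u\<close> is chosen to differ from \<open>x\<close>
  everywhere, so that no fixed point appears.\<close>

definition p_subgroup :: "nat \<Rightarrow> 'a set \<Rightarrow> ('a, 'b) monoid_scheme \<Rightarrow> bool"
  where "p_subgroup p Q G \<longleftrightarrow> subgroup Q G \<and> (\<forall>q\<in>Q. \<exists>m. q [^]\<^bsub>G\<^esub> (p ^ m) = \<one>\<^bsub>G\<^esub>)"

text \<open>Only one inclusion is demanded; in a finite group it gives equality, and
  \<open>normalizes_inv\<close> passes to the inverse.\<close>

definition normalizes :: "('a, 'b) monoid_scheme \<Rightarrow> 'a \<Rightarrow> 'a set \<Rightarrow> bool"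
  where "normalizes G g Q \<longleftrightarrow> (\<forall>q\<in>Q. g \<otimes>\<^bsub>G\<^esub> q \<otimes>\<^bsub>G\<^esub> inv\<^bsub>G\<^esub> g \<in> Q)"

lemma prime_power_dvd_nat_ne_1:
  assumes "prime (p::nat)" "c dvd p ^ n" "c \<noteq> 1"
  shows "p dvd c"
proof -
  obtain i where i: "c = p ^ i" using assms(1,2) by (auto simp: divides_primepow_nat)
  then have "i \<noteq> 0" using assms(3) by (metis power_0)
  then show ?thesis using i by simp
qed

context group
begin

text \<open>Finiteness supplies the inverses: \<open>inv a\<close> is the power of \<open>a\<close>
  with exponent \<open>ord a - 1\<close>.\<close>

lemma finite_subgroupI:
  assumes fin: "finite (carrier G)" and S: "S \<subseteq> carrier G" "\<one> \<in> S"
    and cl: "\<And>a b. a \<in> S \<Longrightarrow> b \<in> S \<Longrightarrow> a \<otimes> b \<in> S"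
  shows "subgroup S G"
proof
  show "inv a \<in> S" if a: "a \<in> S" for a
  proof -
    have ac: "a \<in> carrier G" using a S by blast
    have pw: "a [^] (n::nat) \<in> S" for n
      by (induction n) (auto simp: S cl a)
    have "a [^] ord a = \<one>" by (simp add: ac)
    moreover have "ord a > 0" using ord_ge_1[OF fin ac] by simp
    then obtain n where n: "ord a = Suc n" using gr0_conv_Suc by blast
    ultimately have "a [^] n \<otimes> a = \<one>" by simp
    then have "inv a = a [^] n"
      using ac by (meson inv_equality nat_pow_closed)
    then show ?thesis using pw by simp
  qed
qed (use S cl in auto)

lemma normal_in_iff:
  assumes "subgroup A G" "subgroup B G" "A \<subseteq> B"
  shows "A \<lhd> G\<lparr>carrier := B\<rparr> \<longleftrightarrow> (\<forall>b\<in>B. normalizes G b A)"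
proof -
  interpret B: group "G\<lparr>carrier := B\<rparr>" using assms subgroup_imp_group by blast
  show ?thesis
    using assms subgroup_incl[OF assms] by (simp add: B.normal_inv_iff normalizes_def)
qed

lemma subgroup_normalizer_set:
  assumes fin: "finite (carrier G)" and Q: "Q \<subseteq> carrier G"
  shows "subgroup {g \<in> carrier G. normalizes G g Q} G"
proof (rule finite_subgroupI[OF fin])
  show "\<one> \<in> {g \<in> carrier G. normalizes G g Q}"
    using Q by (auto simp: normalizes_def)
next
  fix a b assume "a \<in> {g \<in> carrier G. normalizes G g Q}" "b \<in> {g \<in> carrier G. normalizes G g Q}"
  then have a: "a \<in> carrier G" "normalizes G a Q" and b: "b \<in> carrier G" "normalizes G b Q" by auto
  have "a \<otimes> b \<otimes> q \<otimes> inv (a \<otimes> b) \<in> Q" if q: "q \<in> Q" for q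
  proof -
    have "a \<otimes> (b \<otimes> q \<otimes> inv b) \<otimes> inv a \<in> Q" using a b q by (auto simp: normalizes_def)
    moreover have "q \<in> carrier G" using q Q by blast
    ultimately show ?thesis using a b by (simp add: inv_mult_group m_assoc)
  qed
  then show "a \<otimes> b \<in> {g \<in> carrier G. normalizes G g Q}"
    using a b by (auto simp: normalizes_def)
qed auto

lemma normalizes_inv:
  assumes "finite (carrier G)" "Q \<subseteq> carrier G" "g \<in> carrier G" "normalizes G g Q"
  shows "normalizes G (inv g) Q"
  using subgroup.m_inv_closed[OF subgroup_normalizer_set[OF assms(1,2)], of g] assms by auto

text \<open>If another prime \<open>r\<close> divided the order, there would be a subgroup of order
  \<open>r\<close>, and the order of a nontrivial element of it would divide both \<open>r\<close>
  and a power of \<open>p\<close>.\<close>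

lemma card_p_subgroup:
  assumes p: "prime p" and fin: "finite (carrier G)" and Q: "p_subgroup p Q G"
  shows "\<exists>n. card Q = p ^ n"
proof -
  have sQ: "subgroup Q G" using Q by (simp add: p_subgroup_def)
  interpret Q: group "G\<lparr>carrier := Q\<rparr>" using sQ subgroup_imp_group by blast
  have finQ: "finite Q" using fin sQ finite_subset subgroup.subset by blast
  have only_p: "r = p" if r: "prime r" "r dvd card Q" for r
  proof (rule ccontr)
    assume ne: "r \<noteq> p"
    obtain m where m: "card Q = r ^ 1 * m" using r by auto
    obtain K where K: "subgroup K (G\<lparr>carrier := Q\<rparr>)" "card K = r"
      using sylow_thm[OF r(1) Q.group_axioms, of 1 m] m finQ by (auto simp: order_def)
    have sK: "subgroup K G" by (rule incl_subgroup[OF sQ K(1)])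
    have KQ: "K \<subseteq> Q" using K subgroup.subset by fastforce
    have "K \<noteq> {\<one>}" using K r by (auto simp: prime_gt_Suc_0_nat)
    then obtain h where h: "h \<in> K" "h \<noteq> \<one>" using subgroup.one_closed[OF sK] by blast
    have hc: "h \<in> carrier G" by (rule subgroup.mem_carrier[OF sK h(1)])
    obtain j where "h [^] (p ^ j) = \<one>" using Q h KQ by (auto simp: p_subgroup_def)
    then have 1: "ord h dvd p ^ j" using hc by (simp add: pow_eq_id)
    interpret K: group "G\<lparr>carrier := K\<rparr>" using sK subgroup_imp_group by blast
    have "h [^]\<^bsub>G\<lparr>carrier := K\<rparr>\<^esub> order (G\<lparr>carrier := K\<rparr>) = \<one>"
      using K.pow_order_eq_1[of h] h by simp
    then have "h [^] r = \<one>" using K by (simp add: order_def nat_pow_consistent[symmetric])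
    then have 2: "ord h dvd r" using hc by (simp add: pow_eq_id)
    have "coprime r (p ^ j)" using ne r p by (simp add: primes_coprime)
    then have "ord h = 1" using coprime_common_divisor[of r "p ^ j" "ord h"] 1 2 by simp
    then show False using h hc ord_eq_1[of h] by simp
  qed
  have "card Q > 0" using finQ sQ subgroup.one_closed by (metis card_gt_0_iff empty_iff)
  then obtain n m where nm: "card Q = p ^ n * m" "\<not> p dvd m"
    using multiplicity_decompose'[of "card Q" p] p by (metis not_prime_unit less_numeral_extra(3))
  have "m = 1"
  proof (rule ccontr)
    assume "m \<noteq> 1"
    then obtain r where r: "prime r" "r dvd m" using prime_factor_nat by blast
    then have "r = p" using only_p nm by simp
    then show False using r nm by simp
  qed
  then show ?thesis using nm by auto
qed

text \<open>Orbit-stabilizer theorem: the fibres \<open>F v\<close> of the orbit map are translates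
  of the stabilizer \<open>F w\<close>, hence all of the same size.\<close>

lemma card_orbit_dvd:
  assumes sQ: "subgroup Q G" and fin: "finite Q"
    and act_one: "act \<one> w = w"
    and act_mult: "\<And>g h. g \<in> Q \<Longrightarrow> h \<in> Q \<Longrightarrow> act (g \<otimes> h) w = act g (act h w)"
  shows "card ((\<lambda>g. act g w) ` Q) dvd card Q"
proof -
  define F where "F v = {g \<in> Q. act g w = v}" for v
  let ?O = "(\<lambda>g. act g w) ` Q"
  have Qc: "Q \<subseteq> carrier G" using sQ subgroup.subset by blast
  have cF: "card (F v) = card (F w)" if v: "v \<in> ?O" for v
  proof -
    obtain g where g: "g \<in> Q" "v = act g w" using v by auto
    have "bij_betw (\<lambda>s. g \<otimes> s) (F w) (F v)"
    proof (rule bij_betwI[where g = "\<lambda>s. inv g \<otimes> s"])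
      show "(\<lambda>s. g \<otimes> s) \<in> F w \<rightarrow> F v"
        using g sQ by (auto simp: F_def act_mult subgroup.m_closed)
      show "(\<lambda>s. inv g \<otimes> s) \<in> F v \<rightarrow> F w"
      proof
        fix s assume s: "s \<in> F v"
        then have "act (inv g \<otimes> s) w = act (inv g) (act g w)"
          using g sQ by (auto simp: F_def act_mult subgroup.m_inv_closed)
        also have "\<dots> = act (inv g \<otimes> g) w"
          using g sQ by (auto simp: act_mult subgroup.m_inv_closed)
        also have "\<dots> = w" using g Qc act_one by (auto simp: l_inv subsetD)
        finally show "inv g \<otimes> s \<in> F w"
          using s g sQ by (auto simp: F_def subgroup.m_closed subgroup.m_inv_closed)
      qed
    qed (use g Qc in \<open>auto simp: F_def m_assoc[symmetric] subsetD\<close>)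
    then show ?thesis by (simp add: bij_betw_same_card)
  qed
  have "card (F w) * card (F ` ?O) = card (\<Union>(F ` ?O))"
  proof (rule card_partition)
    show "finite (F ` ?O)" using fin by simp
    show "finite (\<Union>(F ` ?O))" using fin by (auto simp: F_def)
    show "card c = card (F w)" if "c \<in> F ` ?O" for c using that cF by auto
    show "c1 \<inter> c2 = {}" if "c1 \<in> F ` ?O" "c2 \<in> F ` ?O" "c1 \<noteq> c2" for c1 c2
      using that by (auto simp: F_def)
  qed
  moreover have "card (F ` ?O) = card ?O"
  proof (rule card_image, rule inj_onI)
    fix u v assume "u \<in> ?O" "v \<in> ?O" "F u = F v"
    then show "u = v" unfolding F_def by blast
  qed
  moreover have "\<Union>(F ` ?O) = Q" by (auto simp: F_def)
  ultimately show ?thesis by (metis dvd_triv_right)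
qed

text \<open>The orbits that are not fixed points have size divisible by \<open>p\<close>.\<close>

lemma card_fixed_points_cong:
  assumes p: "prime p" and fin: "finite (carrier G)" and Q: "p_subgroup p Q G"
    and finW: "finite W"
    and act_in: "\<And>g w. g \<in> Q \<Longrightarrow> w \<in> W \<Longrightarrow> act g w \<in> W"
    and act_one: "\<And>w. w \<in> W \<Longrightarrow> act \<one> w = w"
    and act_mult: "\<And>g h w. g \<in> Q \<Longrightarrow> h \<in> Q \<Longrightarrow> w \<in> W \<Longrightarrow> act (g \<otimes> h) w = act g (act h w)"
  shows "p dvd card W \<longleftrightarrow> p dvd card {w \<in> W. \<forall>g\<in>Q. act g w = w}"
proof -
  have sQ: "subgroup Q G" using Q by (simp add: p_subgroup_def)
  have finQ: "finite Q" using fin sQ finite_subset subgroup.subset by blast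
  let ?O = "\<lambda>w. (\<lambda>g. act g w) ` Q"
  let ?F = "{w \<in> W. \<forall>g\<in>Q. act g w = w}"
  obtain n where n: "card Q = p ^ n" using card_p_subgroup[OF p fin Q] by blast
  have self: "w \<in> ?O w" if "w \<in> W" for w
    using that act_one subgroup.one_closed[OF sQ] by force
  have orb_eq: "?O v = ?O w" if w: "w \<in> W" and v: "v \<in> ?O w" for v w
  proof -
    obtain h where h: "h \<in> Q" "v = act h w" using v by auto
    have hc: "h \<in> carrier G" by (rule subgroup.mem_carrier[OF sQ h(1)])
    have "act g w \<in> ?O v" if g: "g \<in> Q" for g
    proof -
      have gc: "g \<in> carrier G" by (rule subgroup.mem_carrier[OF sQ g])
      have "act g w = act (g \<otimes> inv h \<otimes> h) w" using gc hc by (simp add: m_assoc)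
      also have "\<dots> = act (g \<otimes> inv h) v"
        using g h w sQ by (simp add: act_mult subgroup.m_closed subgroup.m_inv_closed)
      finally show ?thesis using g h sQ by (auto simp: subgroup.m_closed subgroup.m_inv_closed)
    qed
    moreover have "act g v \<in> ?O w" if g: "g \<in> Q" for g
      using g h w sQ by (auto simp: act_mult[symmetric] subgroup.m_closed)
    ultimately show ?thesis by blast
  qed
  have dvd_nf: "p dvd card (?O w)" if w: "w \<in> W - ?F" for w
  proof -
    have "card (?O w) dvd p ^ n"
      using card_orbit_dvd[OF sQ finQ, of act w] w n act_one act_mult by auto
    moreover have "card (?O w) \<noteq> 1"
    proof
      assume "card (?O w) = 1"
      then obtain v where v: "?O w = {v}" by (auto simp: card_1_singleton_iff)
      then have "v = w" using self[of w] w by auto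
      then have "\<forall>g\<in>Q. act g w = w" using v by blast
      then show False using w by auto
    qed
    ultimately show ?thesis
      using prime_power_dvd_nat_ne_1[OF p] by blast
  qed
  have "p dvd card (\<Union>(?O ` (W - ?F)))"
  proof (rule dvd_partition)
    show "finite (\<Union>(?O ` (W - ?F)))" using finW finQ by auto
    show "\<forall>c\<in>?O ` (W - ?F). p dvd card c" using dvd_nf by blast
    show "\<forall>c1\<in>?O ` (W - ?F). \<forall>c2\<in>?O ` (W - ?F). c1 \<noteq> c2 \<longrightarrow> c1 \<inter> c2 = {}"
    proof (intro ballI impI, rule ccontr)
      fix c1 c2 assume c: "c1 \<in> ?O ` (W - ?F)" "c2 \<in> ?O ` (W - ?F)" "c1 \<noteq> c2" "c1 \<inter> c2 \<noteq> {}"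
      then obtain w1 w2 v where "w1 \<in> W" "w2 \<in> W" "c1 = ?O w1" "c2 = ?O w2" "v \<in> c1" "v \<in> c2" by auto
      then have "c1 = c2" using orb_eq by metis
      then show False using c by simp
    qed
  qed
  moreover have "\<Union>(?O ` (W - ?F)) = W - ?F"
  proof
    show "W - ?F \<subseteq> \<Union>(?O ` (W - ?F))" using self by blast
    show "\<Union>(?O ` (W - ?F)) \<subseteq> W - ?F"
    proof
      fix v assume "v \<in> \<Union>(?O ` (W - ?F))"
      then obtain w where w: "w \<in> W - ?F" "v \<in> ?O w" by auto
      then have vW: "v \<in> W" using act_in by auto
      have "v \<notin> ?F"
      proof
        assume "v \<in> ?F"
        then have "?O v = {v}" using self[of v] vW by auto
        then have "?O w = {v}" using orb_eq[of w v] w by auto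
        then have "w = v" using self[of w] w by auto
        then show False using w \<open>v \<in> ?F\<close> by auto
      qed
      then show "v \<in> W - ?F" using vW by auto
    qed
  qed
  ultimately have "p dvd card (W - ?F)" by simp
  moreover have "card W = card (W - ?F) + card ?F"
  proof -
    have "card W = card ((W - ?F) \<union> ?F)" by (rule arg_cong[where f=card]) auto
    also have "\<dots> = card (W - ?F) + card ?F" by (rule card_Un_disjoint) (use finW in auto)
    finally show ?thesis .
  qed
  ultimately show ?thesis by (simp add: dvd_add_right_iff)
qed

text \<open>Right multiplication permutes the right cosets; the inverse turns it into a left action,
  as \<open>card_fixed_points_cong\<close> requires.\<close>

lemma card_fixed_cosets:
  assumes p: "prime p" and fin: "finite (carrier G)" and K: "p_subgroup p K G" and A: "subgroup A G"
  shows "p dvd card (rcosets A) \<longleftrightarrow> p dvd card {S \<in> rcosets A. \<forall>k\<in>K. S #> inv k = S}"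
proof (rule card_fixed_points_cong[OF p fin K])
  have Kc: "K \<subseteq> carrier G" using K subgroup.subset by (auto simp: p_subgroup_def)
  have Ac: "A \<subseteq> carrier G" using A subgroup.subset by blast
  show "finite (rcosets A)" using fin by (simp add: RCOSETS_def)
  show "S #> inv k \<in> rcosets A" if "k \<in> K" "S \<in> rcosets A" for k S
    using that Kc Ac by (auto simp: RCOSETS_def coset_mult_assoc subsetD)
  show "S #> inv \<one> = S" if "S \<in> rcosets A" for S
    using that Ac by (auto simp: RCOSETS_def coset_mult_assoc)
  show "S #> inv (g \<otimes> h) = S #> inv h #> inv g" if "g \<in> K" "h \<in> K" "S \<in> rcosets A" for g h S
    using that Kc Ac
    by (auto simp: RCOSETS_def coset_mult_assoc inv_mult_group m_assoc subsetD)
qed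

text \<open>Fixing the coset of \<open>a\<close> puts
  \<open>a \<otimes> inv k \<otimes> inv a\<close> into \<open>A\<close>; then invert. In this way
  fixed cosets become conjugations.\<close>

lemma fixed_coset_conj:
  assumes A: "subgroup A G" and a: "a \<in> carrier G" and k: "k \<in> carrier G"
    and fixed: "A #> a #> inv k = A #> a"
  shows "a \<otimes> k \<otimes> inv a \<in> A"
proof -
  have Ac: "A \<subseteq> carrier G" using A subgroup.subset by blast
  have "A #> (a \<otimes> inv k) = A #> a" using fixed Ac a k by (simp add: coset_mult_assoc)
  then have "A #> (a \<otimes> inv k \<otimes> inv a) = A"
    using Ac a k by (metis coset_mult_assoc coset_mult_one inv_closed m_closed r_inv)
  then have "a \<otimes> inv k \<otimes> inv a \<in> A"
    using A a k by (meson coset_join1 inv_closed m_closed)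
  then have "inv (a \<otimes> inv k \<otimes> inv a) \<in> A" by (rule subgroup.m_inv_closed[OF A])
  then show ?thesis using a k by (simp add: inv_mult_group m_assoc)
qed

text \<open>The Sylow argument: \<open>p\<close> does not divide the number of cosets fixed by
  \<open>K\<close>, so there is one, and its representative conjugates \<open>K\<close> into
  \<open>A\<close>.\<close>

lemma p_subgroup_conj_into:
  assumes p: "prime p" and fin: "finite (carrier G)" and K: "p_subgroup p K G" and A: "subgroup A G"
    and odd: "\<not> p dvd card (rcosets A)"
  shows "\<exists>a\<in>carrier G. \<forall>k\<in>K. a \<otimes> k \<otimes> inv a \<in> A"
proof -
  have "\<not> p dvd card {S \<in> rcosets A. \<forall>k\<in>K. S #> inv k = S}"
    using card_fixed_cosets[OF p fin K A] odd by simp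
  then have "{S \<in> rcosets A. \<forall>k\<in>K. S #> inv k = S} \<noteq> {}" by (metis card.empty dvd_0_right)
  then obtain S where S: "S \<in> rcosets A" "\<forall>k\<in>K. S #> inv k = S" by blast
  then obtain a where a: "a \<in> carrier G" "S = A #> a" by (auto simp: RCOSETS_def)
  then show ?thesis
    using S fixed_coset_conj[OF A a(1)] K subgroup.mem_carrier by (metis p_subgroup_def)
qed

text \<open>\<open>A\<close> acts on its own cosets, whose number is divisible by \<open>p\<close>.
  Since \<open>A\<close> itself is fixed, at least \<open>p\<close> cosets are; the representative
  of another one normalizes \<open>A\<close>.\<close>

lemma normalizer_grows:
  assumes p: "prime p" and fin: "finite (carrier G)" and G: "p_subgroup p (carrier G) G"
    and A: "subgroup A G" "A \<noteq> carrier G"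
  shows "\<exists>g\<in>carrier G. g \<notin> A \<and> normalizes G g A"
proof -
  obtain n where n: "card (carrier G) = p ^ n" using card_p_subgroup[OF p fin G] by blast
  have Ac: "A \<subseteq> carrier G" using A subgroup.subset by blast
  have pA: "p_subgroup p A G" using A(1) G Ac by (auto simp: p_subgroup_def)
  have l: "card (rcosets A) * card A = p ^ n" using lagrange[OF A(1)] n by (simp add: order_def)
  have "card (rcosets A) \<noteq> 1"
  proof
    assume "card (rcosets A) = 1"
    then have "card A = card (carrier G)" using l n by simp
    then show False using A Ac fin card_subset_eq by blast
  qed
  moreover have "card (rcosets A) dvd p ^ n" using l by (metis dvd_triv_left)
  ultimately have "p dvd card (rcosets A)"
    using prime_power_dvd_nat_ne_1[OF p] by blast
  then have d: "p dvd card {S \<in> rcosets A. \<forall>k\<in>A. S #> inv k = S}" (is "_ dvd card ?F")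
    using card_fixed_cosets[OF p fin pA A(1)] by simp
  have AF: "A \<in> ?F"
  proof -
    have "A = A #> \<one>" using Ac by simp
    then have "A \<in> rcosets A" by (force simp: RCOSETS_def)
    moreover have "A #> inv k = A" if "k \<in> A" for k
      using that A Ac by (meson coset_join2 inv_closed subgroup.m_inv_closed subsetD)
    ultimately show ?thesis by simp
  qed
  have "finite ?F" using fin by (simp add: RCOSETS_def)
  then have "card ?F > 0" using AF by (subst card_gt_0_iff) blast
  then have "card ?F \<ge> p" using d dvd_imp_le by blast
  then have "card ?F \<noteq> 1" using prime_gt_1_nat[OF p] by linarith
  then have "?F \<noteq> {A}" by auto
  then obtain S where S: "S \<in> ?F" "S \<noteq> A" using AF by blast
  then obtain a where a: "a \<in> carrier G" "S = A #> a" by (auto simp: RCOSETS_def)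
  have "a \<notin> A" using S a A by (metis coset_join2)
  moreover have "normalizes G a A"
    using S a fixed_coset_conj[OF A(1) a(1)] Ac by (auto simp: normalizes_def)
  ultimately show ?thesis using a by blast
qed

end

section \<open>Subnormality of cyclic \<open>p\<close>-subgroups\<close>

definition subnormal_set :: "nat \<Rightarrow> ('a, 'b) monoid_scheme \<Rightarrow> 'a \<Rightarrow> 'a set"
  where "subnormal_set p G x =
    {g \<in> carrier G. \<exists>Q. p_subgroup p Q G \<and> x \<in> Q \<and> normalizes G g Q}"

text \<open>All terms are subgroups of the ambient \<open>G\<close>, so chains can be prolonged at
  either end without changing the carrier of the group.\<close>

definition subnormal_chain :: "('a, 'b) monoid_scheme \<Rightarrow> 'a set \<Rightarrow> 'a set \<Rightarrow> nat \<Rightarrow> (nat \<Rightarrow> 'a set) \<Rightarrow> bool"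
  where "subnormal_chain G A B n N \<longleftrightarrow> N 0 = A \<and> N n = B \<and> (\<forall>i\<le>n. subgroup (N i) G) \<and>
    (\<forall>i<n. N i \<subseteq> N (Suc i) \<and> (\<forall>g\<in>N (Suc i). normalizes G g (N i)))"

lemma subnormal_chain_mono:
  assumes "subnormal_chain G A B n N" "i \<le> j" "j \<le> n"
  shows "N i \<subseteq> N j"
  using assms(2,3)
proof (induction j)
  case (Suc j)
  then have "N j \<subseteq> N (Suc j)" using assms(1) by (simp add: subnormal_chain_def)
  then show ?case using Suc by (cases "i = Suc j") auto
qed simp

lemma subnormal_chain_Suc:
  assumes "subnormal_chain G A B n N" "subgroup C G" "B \<subseteq> C" "\<And>g. g \<in> C \<Longrightarrow> normalizes G g B"
  shows "\<exists>n N. subnormal_chain G A C n N"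
proof -
  have "subnormal_chain G A C (Suc n) (N(Suc n := C))"
    using assms by (auto simp: subnormal_chain_def less_Suc_eq le_Suc_eq)
  then show ?thesis by blast
qed

context group
begin

lemma inv_mult_cancel: "a \<in> carrier G \<Longrightarrow> b \<in> carrier G \<Longrightarrow> inv a \<otimes> (a \<otimes> b) = b"
  and mult_inv_cancel: "a \<in> carrier G \<Longrightarrow> b \<in> carrier G \<Longrightarrow> a \<otimes> (inv a \<otimes> b) = b"
  by (simp_all add: m_assoc[symmetric])

lemma subgroup_carrier_update: "subgroup A (G\<lparr>carrier := H\<rparr>) \<longleftrightarrow> subgroup A G \<and> A \<subseteq> H"
  if "subgroup H G"
  using that incl_subgroup subgroup_incl by (metis partial_object.select_convs(1)
      partial_object.surjective partial_object.update_convs(1) subgroup.subset)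

lemma subnormal_iff_chain:
  assumes H: "subgroup H G"
  shows "subnormal A (G\<lparr>carrier := H\<rparr>) \<longleftrightarrow> (\<exists>n N. subnormal_chain G A H n N)"
proof
  assume "subnormal A (G\<lparr>carrier := H\<rparr>)"
  then obtain n N where N: "N 0 = A" "N n = H" "\<And>i. i \<le> n \<Longrightarrow> subgroup (N i) G"
    "\<And>i. i < n \<Longrightarrow> N i \<lhd> G\<lparr>carrier := N (Suc i)\<rparr>"
    using subgroup_carrier_update[OF H] by (auto simp: subnormal_def)
  have sub: "N i \<subseteq> N (Suc i)" if "i < n" for i
    using normal_imp_subgroup[OF N(4)[OF that]] subgroup.subset by fastforce
  have "\<forall>g\<in>N (Suc i). normalizes G g (N i)" if "i < n" for i
    using normal_in_iff[of "N i" "N (Suc i)"] N(3)[of i] N(3)[of "Suc i"] N(4)[of i] sub that by simp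
  then show "\<exists>n N. subnormal_chain G A H n N"
    using N sub unfolding subnormal_chain_def by blast
next
  assume "\<exists>n N. subnormal_chain G A H n N"
  then obtain n N where N: "subnormal_chain G A H n N" by blast
  have "subgroup (N i) (G\<lparr>carrier := H\<rparr>)" if "i \<le> n" for i
    using N subnormal_chain_mono[OF N that order.refl] that
    by (auto simp: subgroup_carrier_update[OF H] subnormal_chain_def)
  moreover have "N i \<lhd> G\<lparr>carrier := H\<rparr>\<lparr>carrier := N (Suc i)\<rparr>" if "i < n" for i
    using N that normal_in_iff[of "N i" "N (Suc i)"] by (auto simp: subnormal_chain_def)
  ultimately show "subnormal A (G\<lparr>carrier := H\<rparr>)"
    using N unfolding subnormal_def subnormal_chain_def by auto
qed

text \<open>Modulo \<open>R\<close> the powers of \<open>q \<otimes> r\<close> are those of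
  \<open>q\<close>; a suitable \<open>p\<close>-power therefore lies in \<open>R\<close>, and a
  further one is trivial.\<close>

lemma p_subgroup_mult:
  assumes fin: "finite (carrier G)" and Q: "p_subgroup p Q G" and R: "p_subgroup p R G"
    and norm: "\<And>q. q \<in> Q \<Longrightarrow> normalizes G q R"
  shows "p_subgroup p (Q <#> R) G"
proof -
  have sQ: "subgroup Q G" and sR: "subgroup R G" using Q R by (auto simp: p_subgroup_def)
  have Qc: "Q \<subseteq> carrier G" and Rc: "R \<subseteq> carrier G" using sQ sR subgroup.subset by blast+
  have conj: "inv q \<otimes> r \<otimes> q \<in> R" if q: "q \<in> Q" and r: "r \<in> R" for q r
    using norm[OF subgroup.m_inv_closed[OF sQ q]] r q Qc by (auto simp: normalizes_def subset_iff)
  have swap: "r \<otimes> q = q \<otimes> (inv q \<otimes> r \<otimes> q)" if q: "q \<in> Q" and r: "r \<in> R" for q r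
    using q r Qc Rc by (simp add: m_assoc mult_inv_cancel subset_iff)
  have "subgroup (Q <#> R) G"
  proof (rule finite_subgroupI[OF fin])
    show "Q <#> R \<subseteq> carrier G" using Qc Rc by (auto simp: set_mult_def)
    show "\<one> \<in> Q <#> R"
      unfolding set_mult_def using subgroup.one_closed[OF sQ] subgroup.one_closed[OF sR] by force
    fix a b assume "a \<in> Q <#> R" "b \<in> Q <#> R"
    then obtain q r q' r' where ab: "q \<in> Q" "r \<in> R" "a = q \<otimes> r" "q' \<in> Q" "r' \<in> R" "b = q' \<otimes> r'"
      by (auto simp: set_mult_def)
    have "a \<otimes> b = q \<otimes> (r \<otimes> q') \<otimes> r'" using ab Qc Rc by (simp add: m_assoc subset_iff)
    also have "\<dots> = q \<otimes> (q' \<otimes> (inv q' \<otimes> r \<otimes> q')) \<otimes> r'"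
      using swap[of q' r] ab by simp
    also have "\<dots> = (q \<otimes> q') \<otimes> ((inv q' \<otimes> r \<otimes> q') \<otimes> r')"
      using ab Qc Rc by (simp add: m_assoc subset_iff)
    finally show "a \<otimes> b \<in> Q <#> R"
      using subgroup.m_closed[OF sQ ab(1,4)] subgroup.m_closed[OF sR conj[OF ab(4,2)] ab(5)]
      unfolding set_mult_def by blast
  qed
  moreover have "\<exists>m. a [^] (p ^ m) = \<one>" if a: "a \<in> Q <#> R" for a
  proof -
    obtain q r where qr: "q \<in> Q" "r \<in> R" "a = q \<otimes> r" using a by (auto simp: set_mult_def)
    have qc: "q \<in> carrier G" and rc: "r \<in> carrier G" using qr Qc Rc by auto
    have pw: "q [^] n \<in> Q" for n :: nat
      by (induction n) (use qr sQ in \<open>auto intro: subgroup.m_closed subgroup.one_closed\<close>)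
    have "\<exists>s\<in>R. a [^] n = q [^] n \<otimes> s" for n :: nat
    proof (induction n)
      case 0 then show ?case using subgroup.one_closed[OF sR] by (auto intro!: bexI[of _ \<one>])
    next
      case (Suc n)
      then obtain s where s: "s \<in> R" "a [^] n = q [^] n \<otimes> s" by blast
      then have "a [^] Suc n = q [^] n \<otimes> (s \<otimes> q) \<otimes> r" using qc rc Rc qr by (simp add: m_assoc subset_iff)
      also have "\<dots> = q [^] n \<otimes> (q \<otimes> (inv q \<otimes> s \<otimes> q)) \<otimes> r"
        using swap[OF qr(1) s(1)] by simp
      also have "\<dots> = q [^] Suc n \<otimes> ((inv q \<otimes> s \<otimes> q) \<otimes> r)"
        using qc rc Rc qr s by (simp add: m_assoc subset_iff)
      finally show ?case using conj[OF qr(1) s(1)] qr(2) sR subgroup.m_closed by metis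
    qed
    moreover obtain m where m: "q [^] (p ^ m) = \<one>" using Q qr by (auto simp: p_subgroup_def)
    ultimately obtain s where s: "s \<in> R" "a [^] (p ^ m) = s" using Rc by (metis l_one subsetD)
    obtain k where "s [^] (p ^ k) = \<one>" using R s by (auto simp: p_subgroup_def)
    then have "a [^] (p ^ (m + k)) = \<one>" using s qc rc qr by (simp add: power_add nat_pow_pow[symmetric])
    then show ?thesis by blast
  qed
  ultimately show ?thesis by (simp add: p_subgroup_def)
qed

lemma p_subgroup_conj:
  assumes fin: "finite (carrier G)" and R: "p_subgroup p R G" and g: "g \<in> carrier G"
  shows "p_subgroup p ((\<lambda>r. g \<otimes> r \<otimes> inv g) ` R) G"
proof -
  have sR: "subgroup R G" using R by (simp add: p_subgroup_def)
  have Rc: "R \<subseteq> carrier G" using sR subgroup.subset by blast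
  have mult: "(g \<otimes> a \<otimes> inv g) \<otimes> (g \<otimes> b \<otimes> inv g) = g \<otimes> (a \<otimes> b) \<otimes> inv g"
    if "a \<in> carrier G" "b \<in> carrier G" for a b
    using that g by (simp add: m_assoc inv_mult_cancel)
  have "subgroup ((\<lambda>r. g \<otimes> r \<otimes> inv g) ` R) G"
  proof (rule finite_subgroupI[OF fin])
    show "\<one> \<in> (\<lambda>r. g \<otimes> r \<otimes> inv g) ` R" using subgroup.one_closed[OF sR] g by force
    show "a \<otimes> b \<in> (\<lambda>r. g \<otimes> r \<otimes> inv g) ` R"
      if "a \<in> (\<lambda>r. g \<otimes> r \<otimes> inv g) ` R" "b \<in> (\<lambda>r. g \<otimes> r \<otimes> inv g) ` R" for a b
      using that Rc by (auto simp: mult subset_iff intro!: imageI subgroup.m_closed[OF sR])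
  qed (use Rc g in auto)
  moreover have "\<exists>m. (g \<otimes> r \<otimes> inv g) [^] (p ^ m) = \<one>" if r: "r \<in> R" for r
  proof -
    have rc: "r \<in> carrier G" using r Rc by blast
    have "(g \<otimes> r \<otimes> inv g) [^] n = g \<otimes> r [^] n \<otimes> inv g" for n :: nat
      by (induction n) (use g rc in \<open>auto simp: mult\<close>)
    moreover obtain m where "r [^] (p ^ m) = \<one>" using R r by (auto simp: p_subgroup_def)
    ultimately show ?thesis using g by (metis r_inv r_one)
  qed
  ultimately show ?thesis by (auto simp: p_subgroup_def)
qed

text \<open>A normal \<open>p\<close>-subgroup of \<open>A\<close> is contained in a characteristic one, namely in the largest
  normal \<open>p\<close>-subgroup of \<open>A\<close>.\<close>

lemma p_subgroup_normal_step:
  assumes fin: "finite (carrier G)" and A: "subgroup A G" and B: "subgroup B G" "A \<subseteq> B"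
    and nrm: "\<And>b. b \<in> B \<Longrightarrow> normalizes G b A"
    and Q: "p_subgroup p Q G" "Q \<subseteq> A" "\<And>a. a \<in> A \<Longrightarrow> normalizes G a Q"
  shows "\<exists>R. p_subgroup p R G \<and> Q \<subseteq> R \<and> R \<subseteq> A \<and> (\<forall>b\<in>B. normalizes G b R)"
proof -
  have Ac: "A \<subseteq> carrier G" and Bc: "B \<subseteq> carrier G" using A B subgroup.subset by blast+
  define \<Q> where "\<Q> = {R. p_subgroup p R G \<and> R \<subseteq> A \<and> (\<forall>a\<in>A. normalizes G a R)}"
  have "\<Q> \<subseteq> Pow (carrier G)" using Ac by (auto simp: \<Q>_def)
  then have "finite \<Q>" using fin finite_subset by blast
  moreover have "Q \<in> \<Q>" using Q by (simp add: \<Q>_def)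
  ultimately obtain R where R: "R \<in> \<Q>" "Q \<subseteq> R" and max: "\<And>S. S \<in> \<Q> \<Longrightarrow> R \<subseteq> S \<Longrightarrow> R = S"
    using finite_has_maximal2[of \<Q> Q] by auto
  have RA: "R \<subseteq> A" and pR: "p_subgroup p R G" and nR: "\<And>a. a \<in> A \<Longrightarrow> normalizes G a R"
    using R by (auto simp: \<Q>_def)
  \<comment> \<open>The product of two normal \<open>p\<close>-subgroups of \<open>A\<close> is
    again one, so the maximal \<open>R\<close> absorbs every \<open>S\<close>.\<close>
  have largest: "S \<subseteq> R" if S: "S \<in> \<Q>" for S
  proof -
    have SA: "S \<subseteq> A" and pS: "p_subgroup p S G" and nS: "\<And>a. a \<in> A \<Longrightarrow> normalizes G a S"
      using S by (auto simp: \<Q>_def)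
    have "p_subgroup p (R <#> S) G" using p_subgroup_mult[OF fin pR pS] nS RA by blast
    moreover have "R <#> S \<subseteq> A"
      using RA SA A by (auto simp: set_mult_def subset_iff intro: subgroup.m_closed)
    moreover have "normalizes G a (R <#> S)" if a: "a \<in> A" for a
      unfolding normalizes_def
    proof
      fix v assume "v \<in> R <#> S"
      then obtain r s where v: "r \<in> R" "s \<in> S" "v = r \<otimes> s" by (auto simp: set_mult_def)
      then have c: "r \<in> carrier G" "s \<in> carrier G" "a \<in> carrier G" using RA SA Ac a by auto
      have "a \<otimes> v \<otimes> inv a = (a \<otimes> r \<otimes> inv a) \<otimes> (a \<otimes> s \<otimes> inv a)"
        using c v(3) by (simp add: m_assoc inv_mult_cancel)
      then show "a \<otimes> v \<otimes> inv a \<in> R <#> S"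
        using nR[OF a] nS[OF a] v by (auto simp: normalizes_def set_mult_def)
    qed
    ultimately have "R <#> S \<in> \<Q>" by (simp add: \<Q>_def)
    moreover have "R \<subseteq> R <#> S"
    proof
      fix r assume r: "r \<in> R"
      have "\<one> \<in> S" using pS subgroup.one_closed by (auto simp: p_subgroup_def)
      then show "r \<in> R <#> S" using r RA Ac unfolding set_mult_def by force
    qed
    ultimately have "R = R <#> S" using max by blast
    moreover have "S \<subseteq> R <#> S"
    proof
      fix s assume s: "s \<in> S"
      have "\<one> \<in> R" using pR subgroup.one_closed by (auto simp: p_subgroup_def)
      then show "s \<in> R <#> S" using s SA Ac unfolding set_mult_def by force
    qed
    ultimately show ?thesis by blast
  qed
  \<comment> \<open>Conjugation by \<open>b\<close> preserves \<open>A\<close> and hence the family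
    \<open>\<Q>\<close>, so the conjugate of \<open>R\<close> is contained in
    \<open>R\<close>.\<close>
  have "normalizes G b R" if b: "b \<in> B" for b
  proof -
    have bc: "b \<in> carrier G" using b Bc by blast
    let ?S = "(\<lambda>r. b \<otimes> r \<otimes> inv b) ` R"
    have "p_subgroup p ?S G" by (rule p_subgroup_conj[OF fin pR bc])
    moreover have "?S \<subseteq> A" using nrm[OF b] RA by (auto simp: normalizes_def)
    moreover have "normalizes G a ?S" if a: "a \<in> A" for a
      unfolding normalizes_def
    proof
      fix v assume "v \<in> ?S"
      then obtain r where r: "r \<in> R" "v = b \<otimes> r \<otimes> inv b" by auto
      have c: "r \<in> carrier G" "a \<in> carrier G" using r RA Ac a by auto
      have "normalizes G (inv b) A" using nrm b B subgroup.m_inv_closed by metis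
      then have a': "inv b \<otimes> a \<otimes> b \<in> A" using a bc by (auto simp: normalizes_def)
      have "a \<otimes> v \<otimes> inv a = b \<otimes> ((inv b \<otimes> a \<otimes> b) \<otimes> r \<otimes> inv (inv b \<otimes> a \<otimes> b)) \<otimes> inv b"
        using c bc r(2) by (simp add: m_assoc inv_mult_group mult_inv_cancel)
      then show "a \<otimes> v \<otimes> inv a \<in> ?S" using nR[OF a'] r(1) by (auto simp: normalizes_def)
    qed
    ultimately have "?S \<in> \<Q>" by (simp add: \<Q>_def)
    then show ?thesis using largest by (auto simp: normalizes_def)
  qed
  then show ?thesis using R RA pR by blast
qed

lemma p_subgroup_generate_single:
  assumes fin: "finite (carrier G)" and x: "x \<in> carrier G" "x [^] (p ^ m) = \<one>"
  shows "p_subgroup p (generate G {x}) G"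
proof -
  have "\<exists>m. q [^] (p ^ m) = \<one>" if q: "q \<in> generate G {x}" for q
  proof -
    have "generate G {x} = {x [^] k |k. k \<in> (UNIV :: nat set)}"
      using generate_pow_nat[OF x(1)] ord_ge_1[OF fin x(1)] by linarith
    then obtain k :: nat where "q = x [^] k" using q by auto
    then have "q [^] (p ^ m) = (x [^] (p ^ m)) [^] k" using x(1) by (simp add: nat_pow_pow mult.commute)
    then have "q [^] (p ^ m) = \<one>" using x(2) by simp
    then show ?thesis by blast
  qed
  then show ?thesis using x generate_is_subgroup[of "{x}"] by (simp add: p_subgroup_def)
qed

lemma generate_single_subset: "subgroup Q G \<Longrightarrow> x \<in> Q \<Longrightarrow> generate G {x} \<subseteq> Q"
  using generate_subgroup_incl[of "{x}" Q] by simp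

text \<open>Climbing the chain, every term has a normal \<open>p\<close>-subgroup containing
  \<open>x\<close>: the first is \<open>generate G {x}\<close>, and
  \<open>p_subgroup_normal_step\<close> enlarges each to one that the next term normalizes. At the
  top \<open>g\<close> normalizes it.\<close>

lemma subnormal_imp_subnormal_set:
  assumes fin: "finite (carrier G)" and x: "x \<in> carrier G" "x [^] (p ^ m) = \<one>" and g: "g \<in> carrier G"
    and sn: "subnormal (generate G {x}) (G\<lparr>carrier := generate G {x, g}\<rparr>)"
  shows "g \<in> subnormal_set p G x"
proof -
  have H: "subgroup (generate G {x, g}) G" using x g by (simp add: generate_is_subgroup)
  obtain n N where N: "subnormal_chain G (generate G {x}) (generate G {x, g}) n N"
    using sn subnormal_iff_chain[OF H] by blast
  have "\<exists>Q. p_subgroup p Q G \<and> x \<in> Q \<and> Q \<subseteq> N i \<and> (\<forall>a\<in>N i. normalizes G a Q)" if "i \<le> n" for i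
    using that
  proof (induction i)
    case 0
    have "N 0 = generate G {x}" using N by (simp add: subnormal_chain_def)
    moreover have "normalizes G a (generate G {x})" if "a \<in> generate G {x}" for a
      using that generate_is_subgroup[of "{x}"] x
      by (auto simp: normalizes_def subgroup.m_closed subgroup.m_inv_closed)
    ultimately show ?case
      using p_subgroup_generate_single[OF fin x] generate.incl[of x "{x}" G] by auto
  next
    case (Suc i)
    then obtain Q where Q: "p_subgroup p Q G" "x \<in> Q" "Q \<subseteq> N i" "\<And>a. a \<in> N i \<Longrightarrow> normalizes G a Q"
      by auto
    have i: "N i \<subseteq> N (Suc i)" "subgroup (N i) G" "subgroup (N (Suc i)) G"
      "\<And>g. g \<in> N (Suc i) \<Longrightarrow> normalizes G g (N i)"
      using N Suc.prems by (auto simp: subnormal_chain_def)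
    have "\<exists>R. p_subgroup p R G \<and> Q \<subseteq> R \<and> R \<subseteq> N i \<and> (\<forall>b\<in>N (Suc i). normalizes G b R)"
      by (rule p_subgroup_normal_step[OF fin i(2,3,1,4) Q(1,3,4)])
    then show ?case using Q(2) i(1) by blast
  qed
  from this[of n] obtain Q where "p_subgroup p Q G" "x \<in> Q" "\<forall>a\<in>generate G {x, g}. normalizes G a Q"
    using N by (auto simp: subnormal_chain_def)
  moreover have "g \<in> generate G {x, g}" by (simp add: generate.incl)
  ultimately show ?thesis using g by (auto simp: subnormal_set_def)
qed

text \<open>Insert the normalizer of \<open>A\<close> in \<open>Q\<close>, which is strictly larger
  than \<open>A\<close> by \<open>normalizer_grows\<close>, and continue from there.\<close>

lemma subgroup_of_p_subgroup_chain:
  assumes p: "prime p" and fin: "finite (carrier G)" and Q: "p_subgroup p Q G"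
    and A: "subgroup A G" "A \<subseteq> Q"
  shows "\<exists>n N. subnormal_chain G A Q n N"
  using A
proof (induction "card Q - card A" arbitrary: A rule: less_induct)
  case less
  have sQ: "subgroup Q G" using Q by (simp add: p_subgroup_def)
  have Qc: "Q \<subseteq> carrier G" using sQ subgroup.subset by blast
  have finQ: "finite Q" using fin Qc finite_subset by blast
  show ?case
  proof (cases "A = Q")
    case True
    then have "subnormal_chain G A Q 0 (\<lambda>_. A)" using less.prems by (simp add: subnormal_chain_def)
    then show ?thesis by blast
  next
    case False
    interpret Q: group "G\<lparr>carrier := Q\<rparr>" using sQ subgroup_imp_group by blast
    have "p_subgroup p (carrier (G\<lparr>carrier := Q\<rparr>)) (G\<lparr>carrier := Q\<rparr>)"
      using Q Q.subgroup_self by (simp add: p_subgroup_def nat_pow_consistent[symmetric])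
    then obtain g where g: "g \<in> Q" "g \<notin> A" "normalizes (G\<lparr>carrier := Q\<rparr>) g A"
      using Q.normalizer_grows[OF p, of A] finQ subgroup_incl[OF less.prems(1) sQ less.prems(2)] False by auto
    have gA: "normalizes G g A" using g sQ by (simp add: normalizes_def)
    define B where "B = Q \<inter> {g \<in> carrier G. normalizes G g A}"
    have Ac: "A \<subseteq> carrier G" using less.prems Qc by blast
    have B: "subgroup B G"
      unfolding B_def using subgroups_Inter_pair[OF sQ subgroup_normalizer_set[OF fin Ac]] .
    have AB: "A \<subseteq> B"
      using less.prems Qc by (auto simp: B_def normalizes_def subgroup.m_closed subgroup.m_inv_closed)
    have "A \<subset> B" using AB g gA Qc by (auto simp: B_def)
    moreover have BQ: "B \<subseteq> Q" by (auto simp: B_def)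
    ultimately have "card A < card B" "card B \<le> card Q"
      using finQ by (auto intro: psubset_card_mono card_mono finite_subset)
    then obtain n N where N: "subnormal_chain G B Q n N"
      using less.hyps[of B] B BQ by fastforce
    have "subnormal_chain G A Q (Suc n) (\<lambda>i. case i of 0 \<Rightarrow> A | Suc j \<Rightarrow> N j)"
      using N less.prems AB by (auto simp: subnormal_chain_def B_def split: nat.split)
    then show ?thesis by blast
  qed
qed

text \<open>Both \<open>x\<close> and \<open>g\<close> normalize \<open>Q\<close>, so
  \<open>Q \<inter> generate G {x, g}\<close> is a normal \<open>p\<close>-subgroup of
  \<open>generate G {x, g}\<close>. A chain leads from the cyclic group up to it, and one more step
  reaches the whole group.\<close>

lemma subnormal_set_imp_subnormal:
  assumes p: "prime p" and fin: "finite (carrier G)" and x: "x \<in> carrier G"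
    and g: "g \<in> subnormal_set p G x"
  shows "subnormal (generate G {x}) (G\<lparr>carrier := generate G {x, g}\<rparr>)"
proof -
  obtain Q where Q: "p_subgroup p Q G" "x \<in> Q" "normalizes G g Q" and gc: "g \<in> carrier G"
    using g by (auto simp: subnormal_set_def)
  have sQ: "subgroup Q G" using Q by (simp add: p_subgroup_def)
  have Qc: "Q \<subseteq> carrier G" using sQ subgroup.subset by blast
  let ?H = "generate G {x, g}"
  have H: "subgroup ?H G" using x gc by (simp add: generate_is_subgroup)
  have QH: "subgroup (Q \<inter> ?H) G" using subgroups_Inter_pair[OF sQ H] .
  have pQH: "p_subgroup p (Q \<inter> ?H) G" using Q QH by (auto simp: p_subgroup_def)
  have "x \<in> ?H" by (simp add: generate.incl)
  then have "generate G {x} \<subseteq> Q \<inter> ?H" using generate_single_subset[OF QH] Q by blast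
  then obtain n N where N: "subnormal_chain G (generate G {x}) (Q \<inter> ?H) n N"
    using subgroup_of_p_subgroup_chain[OF p fin pQH generate_is_subgroup[of "{x}"]] x by auto
  have nQ: "?H \<subseteq> {g \<in> carrier G. normalizes G g Q}"
  proof (rule generate_subgroup_incl[OF _ subgroup_normalizer_set[OF fin Qc]])
    show "{x, g} \<subseteq> {g \<in> carrier G. normalizes G g Q}"
      using Q gc x sQ by (auto simp: normalizes_def subgroup.m_closed subgroup.m_inv_closed)
  qed
  have "normalizes G h (Q \<inter> ?H)" if "h \<in> ?H" for h
    using that nQ H by (auto simp: normalizes_def subgroup.m_closed subgroup.m_inv_closed)
  then have "\<exists>n N. subnormal_chain G (generate G {x}) ?H n N"
    using subnormal_chain_Suc[OF N H] by blast
  then show ?thesis using subnormal_iff_chain[OF H] by blast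
qed

lemma subnormalizer_eq_generate:
  assumes p: "prime p" and fin: "finite (carrier G)" and x: "x \<in> carrier G" "x [^] (p ^ m) = \<one>"
  shows "subnormalizer G x = generate G (subnormal_set p G x)"
proof -
  have "{g \<in> carrier G. subnormal (generate G {x}) (G\<lparr>carrier := generate G {x, g}\<rparr>)} = subnormal_set p G x"
  proof
    show "{g \<in> carrier G. subnormal (generate G {x}) (G\<lparr>carrier := generate G {x, g}\<rparr>)} \<subseteq> subnormal_set p G x"
      using subnormal_imp_subnormal_set[OF fin x] by blast
    show "subnormal_set p G x \<subseteq> {g \<in> carrier G. subnormal (generate G {x}) (G\<lparr>carrier := generate G {x, g}\<rparr>)}"
      using subnormal_set_imp_subnormal[OF p fin x(1)] by (auto simp: subnormal_set_def)
  qed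
  then show ?thesis by (simp add: subnormalizer_def)
qed

end

section \<open>2-groups of permutations\<close>

lemma sym_group_on_simps [simp]:
  "carrier (sym_group_on X) = {p. p permutes X}"
  "mult (sym_group_on X) = (\<circ>)"
  "one (sym_group_on X) = id"
  by (simp_all add: sym_group_on_def)

lemma group_sym_group_on: "group (sym_group_on X)"
  by (rule groupI) (auto simp: permutes_compose permutes_id comp_assoc intro: permutes_inv permutes_inv_o(2))

lemma inv_sym_group_on:
  assumes "p permutes X"
  shows "inv\<^bsub>sym_group_on X\<^esub> p = inv' p"
  by (rule group.inv_equality[OF group_sym_group_on])
    (use assms in \<open>auto simp: permutes_inv permutes_inv_o\<close>)

lemma pow_sym_group_on: "x [^]\<^bsub>sym_group_on X\<^esub> (n::nat) = x ^^ n"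
  by (induction n) (auto simp: nat_pow_def funpow_Suc_right simp del: funpow.simps(2))

lemma finite_sym_group_on: "finite X \<Longrightarrow> finite (carrier (sym_group_on X))"
  by (simp add: finite_permutations)

text \<open>Inverses are not mentioned: for finite \<open>X\<close> they are powers, and
  \<open>two_group_iff_p_subgroup\<close> identifies the notion with
  \<open>p_subgroup 2\<close>.\<close>

definition two_group :: "'a set \<Rightarrow> ('a \<Rightarrow> 'a) set \<Rightarrow> bool"
  where "two_group X Q \<longleftrightarrow> id \<in> Q \<and> (\<forall>a\<in>Q. \<forall>b\<in>Q. a \<circ> b \<in> Q) \<and>
    (\<forall>a\<in>Q. a permutes X \<and> (\<exists>m. a ^^ (2 ^ m) = id))"

text \<open>For finite \<open>X\<close> this is \<open>subnormal_set 2\<close> of the symmetric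
  group on \<open>X\<close>, written with plain functions.\<close>

definition sub_gens :: "'a set \<Rightarrow> ('a \<Rightarrow> 'a) \<Rightarrow> ('a \<Rightarrow> 'a) set"
  where "sub_gens X x = {g. g permutes X \<and>
    (\<exists>Q. two_group X Q \<and> x \<in> Q \<and> (\<forall>q\<in>Q. g \<circ> q \<circ> inv' g \<in> Q))}"

lemma two_groupD:
  assumes "two_group X Q"
  shows "id \<in> Q" "a \<in> Q \<Longrightarrow> b \<in> Q \<Longrightarrow> a \<circ> b \<in> Q" "a \<in> Q \<Longrightarrow> a permutes X"
    "a \<in> Q \<Longrightarrow> \<exists>m. a ^^ (2 ^ m) = id"
  using assms by (auto simp: two_group_def)

lemma two_group_iff_p_subgroup:
  assumes "finite X"
  shows "two_group X Q \<longleftrightarrow> p_subgroup 2 Q (sym_group_on X)"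
proof
  assume Q: "two_group X Q"
  have "subgroup Q (sym_group_on X)"
    by (rule group.finite_subgroupI[OF group_sym_group_on finite_sym_group_on[OF assms]])
      (use Q in \<open>auto simp: two_group_def\<close>)
  then show "p_subgroup 2 Q (sym_group_on X)"
    using Q by (auto simp: p_subgroup_def pow_sym_group_on two_group_def)
next
  assume Q: "p_subgroup 2 Q (sym_group_on X)"
  then have s: "subgroup Q (sym_group_on X)" by (simp add: p_subgroup_def)
  show "two_group X Q"
    using Q subgroup.one_closed[OF s] subgroup.m_closed[OF s] subgroup.mem_carrier[OF s]
    by (auto simp: p_subgroup_def pow_sym_group_on two_group_def)
qed

lemma two_group_subgroup:
  "finite X \<Longrightarrow> two_group X Q \<Longrightarrow> subgroup Q (sym_group_on X)"
  by (simp add: two_group_iff_p_subgroup p_subgroup_def)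

lemma subnormal_set_sym_group_on:
  assumes "finite X"
  shows "subnormal_set 2 (sym_group_on X) x = sub_gens X x"
  unfolding subnormal_set_def sub_gens_def normalizes_def
  using assms by (auto simp: two_group_iff_p_subgroup inv_sym_group_on)

lemma two_group_inv:
  assumes "finite X" "two_group X Q" "a \<in> Q"
  shows "inv' a \<in> Q"
  using subgroup.m_inv_closed[OF two_group_subgroup[OF assms(1,2)] assms(3)]
    two_groupD(3)[OF assms(2,3)] by (simp add: inv_sym_group_on)

lemma two_group_conj:
  assumes "finite X" "two_group X Q" "a \<in> Q" "b \<in> Q"
  shows "a \<circ> b \<circ> inv' a \<in> Q"
  using assms two_groupD(2)[OF assms(2)] two_group_inv by metis

lemma conj_inv_closed:
  assumes fin: "finite X" and Q: "\<And>q. q \<in> Q \<Longrightarrow> q permutes X" and g: "g permutes X"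
    and nrm: "\<And>q. q \<in> Q \<Longrightarrow> g \<circ> q \<circ> inv' g \<in> Q" and q: "q \<in> Q"
  shows "inv' g \<circ> q \<circ> g \<in> Q"
proof -
  have "normalizes (sym_group_on X) (inv\<^bsub>sym_group_on X\<^esub> g) Q"
    by (rule group.normalizes_inv[OF group_sym_group_on finite_sym_group_on[OF fin]])
      (use Q g nrm in \<open>auto simp: normalizes_def inv_sym_group_on\<close>)
  then show ?thesis
    using g q by (simp add: normalizes_def inv_sym_group_on permutes_inv permutes_inv_inv)
qed

lemma sub_gensI:
  assumes "g permutes X" "two_group X Q" "x \<in> Q" "\<And>q. q \<in> Q \<Longrightarrow> g \<circ> q \<circ> inv' g \<in> Q"
  shows "g \<in> sub_gens X x"
  using assms by (auto simp: sub_gens_def)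

lemma sub_gens_member:
  assumes "finite X" "two_group X Q" "x \<in> Q" "g \<in> Q"
  shows "g \<in> sub_gens X x"
  using assms two_group_conj two_groupD(3) by (intro sub_gensI[of g X Q]) auto

text \<open>For finite \<open>X\<close> and a 2-element \<open>x\<close> this is the subnormalizer
  in the symmetric group on \<open>X\<close>; see \<open>subnormalizer_sym_group_on\<close>.\<close>

definition Sub :: "'a set \<Rightarrow> ('a \<Rightarrow> 'a) \<Rightarrow> ('a \<Rightarrow> 'a) set"
  where "Sub X x = generate (sym_group_on X) (sub_gens X x)"

lemma sub_gens_permutes: "g \<in> sub_gens X x \<Longrightarrow> g permutes X"
  by (simp add: sub_gens_def)

lemma subgroup_Sub: "subgroup (Sub X x) (sym_group_on X)"
  unfolding Sub_def
  by (rule group.generate_is_subgroup[OF group_sym_group_on]) (auto dest: sub_gens_permutes)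

lemma sub_gens_Sub: "g \<in> sub_gens X x \<Longrightarrow> g \<in> Sub X x"
  by (simp add: Sub_def generate.incl)

lemma Sub_permutes: "g \<in> Sub X x \<Longrightarrow> g permutes X"
  using subgroup.mem_carrier[OF subgroup_Sub] by fastforce

lemma Sub_id: "id \<in> Sub X x"
  using subgroup.one_closed[OF subgroup_Sub] by (metis sym_group_on_simps(3))

lemma Sub_comp: "a \<in> Sub X x \<Longrightarrow> b \<in> Sub X x \<Longrightarrow> a \<circ> b \<in> Sub X x"
  using subgroup.m_closed[OF subgroup_Sub] by (metis sym_group_on_simps(2))

lemma Sub_inv: "a \<in> Sub X x \<Longrightarrow> inv' a \<in> Sub X x"
  using subgroup.m_inv_closed[OF subgroup_Sub] by (metis Sub_permutes inv_sym_group_on)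

text \<open>Serves for upper bounds on \<open>Sub X x\<close>. By finiteness a set closed under
  composition already contains the inverses of its permutations of \<open>X\<close>.\<close>

lemma Sub_subset:
  assumes fin: "finite X" and T: "id \<in> T" "\<And>a b. a \<in> T \<Longrightarrow> b \<in> T \<Longrightarrow> a \<circ> b \<in> T"
    and S: "sub_gens X x \<subseteq> T"
  shows "Sub X x \<subseteq> T"
proof -
  have "subgroup (T \<inter> {p. p permutes X}) (sym_group_on X)"
    by (rule group.finite_subgroupI[OF group_sym_group_on finite_sym_group_on[OF fin]])
      (use T in \<open>auto simp: permutes_id permutes_compose\<close>)
  then have "Sub X x \<subseteq> T \<inter> {p. p permutes X}"
    unfolding Sub_def using S
    by (intro group.generate_subgroup_incl[OF group_sym_group_on]) (auto dest: sub_gens_permutes)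
  then show ?thesis by blast
qed

lemma subnormalizer_sym_group_on:
  assumes fin: "finite X" and x: "x permutes X" "x ^^ (2 ^ m) = id"
  shows "subnormalizer (sym_group_on X) x = Sub X x"
  using group.subnormalizer_eq_generate[OF group_sym_group_on two_is_prime_nat finite_sym_group_on[OF fin], of x m]
    x fin by (simp add: pow_sym_group_on subnormal_set_sym_group_on Sub_def)

lemma two_group_cyclic:
  assumes x: "x permutes X" "x ^^ (2 ^ m) = id"
  shows "two_group X {x ^^ i | i. True}"
proof -
  have "(x ^^ i) ^^ (2 ^ m) = id" for i
    by (metis funpow_mult id_funpow mult.commute x(2))
  moreover have "x ^^ i \<circ> x ^^ j = x ^^ (i + j)" for i j by (simp add: funpow_add)
  ultimately show ?thesis
    using x(1) unfolding two_group_def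
    by (auto simp: permutes_funpow simp del: id_apply intro: exI[of _ "0::nat"])
qed

section \<open>Sylow 2-subgroups of finite symmetric groups\<close>

definition is_sylow :: "'a set \<Rightarrow> ('a \<Rightarrow> 'a) set \<Rightarrow> bool"
  where "is_sylow X P \<longleftrightarrow> two_group X P \<and> odd (card {p. p permutes X} div card P)"

lemma sylow_exists:
  assumes "finite X"
  shows "\<exists>P. is_sylow X P"
proof -
  let ?G = "sym_group_on X"
  have pos: "order ?G \<noteq> 0" using assms by (simp add: order_def card_permutations)
  then obtain m where m: "order ?G = 2 ^ multiplicity 2 (order ?G) * m" "odd m"
    using multiplicity_decompose'[of "order ?G" "2::nat"] by auto
  then obtain P where P: "subgroup P ?G" "card P = 2 ^ multiplicity 2 (order ?G)"
    using sylow_thm[OF two_is_prime_nat group_sym_group_on m(1) finite_sym_group_on[OF assms]] by blast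
  interpret P: group "?G\<lparr>carrier := P\<rparr>" by (rule group.subgroup_imp_group[OF group_sym_group_on P(1)])
  have "q [^]\<^bsub>?G\<^esub> (2 ^ multiplicity 2 (order ?G) :: nat) = \<one>\<^bsub>?G\<^esub>" if "q \<in> P" for q
    using P.pow_order_eq_1[of q] that P(2)
    by (simp add: order_def group.is_monoid[OF group_sym_group_on, THEN monoid.nat_pow_consistent[symmetric]])
  then have "p_subgroup 2 P ?G" using P(1) unfolding p_subgroup_def by blast
  moreover have "order ?G div card P = m" using m(1) P(2) by (metis nonzero_mult_div_cancel_left power_eq_0_iff zero_neq_numeral)
  ultimately show ?thesis
    using m(2) two_group_iff_p_subgroup[OF assms] by (auto simp: is_sylow_def order_def)
qed

text \<open>The index of \<open>P\<close> in \<open>M\<close> divides its odd index in the full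
  symmetric group, so \<open>p_subgroup_conj_into\<close> applies inside \<open>M\<close>. That the
  conjugating element lies in \<open>M\<close> is what the Frattini argument needs.\<close>

lemma sylow_conj_into:
  assumes fin: "finite X" and P: "is_sylow X P" and M: "subgroup M (sym_group_on X)" "P \<subseteq> M"
    and Q: "two_group X Q" "Q \<subseteq> M"
  shows "\<exists>a\<in>M. \<forall>q\<in>Q. a \<circ> q \<circ> inv' a \<in> P"
proof -
  let ?G = "sym_group_on X"
  let ?M = "?G\<lparr>carrier := M\<rparr>"
  interpret G: group ?G by (rule group_sym_group_on)
  interpret M: group ?M using G.subgroup_imp_group[OF M(1)] .
  have sP: "subgroup P ?G" using P fin by (simp add: is_sylow_def two_group_subgroup)
  have sPM: "subgroup P ?M" using G.subgroup_incl[OF sP M(1) M(2)] .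
  have sQM: "subgroup Q ?M"
    using G.subgroup_incl[OF two_group_subgroup[OF fin Q(1)] M(1) Q(2)] .
  have Mc: "M \<subseteq> {p. p permutes X}" using subgroup.subset[OF M(1)] by simp
  have finM: "finite (carrier ?M)" using Mc fin finite_permutations finite_subset by (metis partial_object.select_convs(1) partial_object.surjective partial_object.update_convs(1))
  have pQ: "p_subgroup 2 Q ?M"
    using sQM two_groupD(4)[OF Q(1)] unfolding p_subgroup_def
    by (simp add: G.nat_pow_consistent[symmetric] pow_sym_group_on)
  have l1: "card (rcosets\<^bsub>?M\<^esub> P) * card P = card M" using M.lagrange[OF sPM] by (simp add: order_def)
  obtain c where l2: "c * card M = card {p. p permutes X}"
    using G.lagrange[OF M(1)] by (auto simp: order_def)
  have "card P > 0" using sP finM M(2) subgroup.one_closed[OF sP]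
    by (metis card_gt_0_iff empty_iff finite_subset partial_object.select_convs(1) partial_object.surjective partial_object.update_convs(1))
  then have "card {p. p permutes X} div card P = c * card (rcosets\<^bsub>?M\<^esub> P)"
    unfolding l2[symmetric] l1[symmetric] by simp
  then have "odd (card (rcosets\<^bsub>?M\<^esub> P))" using P by (simp add: is_sylow_def)
  then obtain a where a: "a \<in> M" "\<forall>k\<in>Q. a \<otimes>\<^bsub>?M\<^esub> k \<otimes>\<^bsub>?M\<^esub> inv\<^bsub>?M\<^esub> a \<in> P"
    using M.p_subgroup_conj_into[OF two_is_prime_nat finM pQ sPM] by auto
  then have "inv\<^bsub>?M\<^esub> a = inv' a" using Mc M(1) by (auto simp: inv_sym_group_on)
  then show ?thesis using a by auto
qed

section \<open>Halvings preserved by a 2-group\<close>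

lemma odd_choose_pow2: "odd ((2 ^ Suc j - 1) choose (2 ^ j - 1))"
proof -
  \<comment> \<open>The multiplicity of 2 in this central binomial coefficient is that of the
    cofactor 2, namely one; dividing by 2 leaves the odd coefficient in question.\<close>
  have "multiplicity 2 ((2 ^ j * 2) choose (2 ^ j)) = multiplicity 2 (2::nat)"
    using const_p_fac[of 2 2 j] by simp
  then have "\<not> 4 dvd ((2 ^ Suc j) choose (2 ^ j))"
  proof -
    have "((2 ^ j * 2) choose (2 ^ j)) \<noteq> 0" by (simp add: binomial_eq_0_iff)
    then have "\<not> 2 ^ 2 dvd ((2 ^ j * 2) choose (2 ^ j))"
      using \<open>multiplicity 2 ((2 ^ j * 2) choose (2 ^ j)) = multiplicity 2 (2::nat)\<close>
      by (subst power_dvd_iff_le_multiplicity) auto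
    then show ?thesis by (simp add: mult.commute)
  qed
  moreover have "2 ^ j * ((2 ^ Suc j) choose (2 ^ j)) = 2 ^ Suc j * ((2 ^ Suc j - 1) choose (2 ^ j - 1))"
    using times_binomial_minus1_eq[of "2 ^ j" "2 ^ Suc j"] by simp
  then have "((2 ^ Suc j) choose (2 ^ j)) = 2 * ((2 ^ Suc j - 1) choose (2 ^ j - 1))" by simp
  ultimately show ?thesis by auto
qed

text \<open>The halves of \<open>D\<close> containing a given point are odd in number, so a 2-group acting on
  them has a fixed point.\<close>

lemma invariant_half_exists:
  assumes fin: "finite X" and Q: "two_group X Q" and D: "D \<subseteq> X" "card D = 2 ^ Suc j"
    and stab: "\<And>q. q \<in> Q \<Longrightarrow> q ` D = D"
  shows "\<exists>A \<subseteq> D. card A = 2 ^ j \<and> (\<forall>q\<in>Q. q ` A = A \<or> q ` A = D - A)"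
proof -
  have finD: "finite D" using fin D finite_subset by blast
  have "D \<noteq> {}" using D(2) by auto
  then obtain c where c: "c \<in> D" by blast
  define W where "W = {A. A \<subseteq> D \<and> card A = 2 ^ j \<and> c \<in> A}"
  \<comment> \<open>A halving \<open>{A, D - A}\<close> is represented by the half that contains
    \<open>c\<close>; if \<open>q\<close> moves that half off \<open>c\<close>, the complement takes
    over.\<close>
  define act where "act q A = (if c \<in> q ` A then q ` A else D - q ` A)" for q :: "'a \<Rightarrow> 'a" and A
  have finW: "finite W" using finD by (auto simp: W_def)
  have bij: "bij_betw (insert c) {B. B \<subseteq> D - {c} \<and> card B = 2 ^ j - 1} W"
  proof (rule bij_betwI[where g = "\<lambda>A. A - {c}"])
    have fB: "finite B" if "B \<subseteq> D" for B using that finD finite_subset by blast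
    show "insert c \<in> {B. B \<subseteq> D - {c} \<and> card B = 2 ^ j - 1} \<rightarrow> W"
    proof
      fix B assume B: "B \<in> {B. B \<subseteq> D - {c} \<and> card B = 2 ^ j - 1}"
      then have "finite B" "c \<notin> B" using fB[of B] by auto
      then show "insert c B \<in> W" using B c by (auto simp: W_def)
    qed
    show "(\<lambda>A. A - {c}) \<in> W \<rightarrow> {B. B \<subseteq> D - {c} \<and> card B = 2 ^ j - 1}"
      by (auto simp: W_def)
  qed (auto simp: W_def)
  have "card W = card {B. B \<subseteq> D - {c} \<and> card B = 2 ^ j - 1}"
    using bij_betw_same_card[OF bij] by simp
  also have "\<dots> = (2 ^ Suc j - 1) choose (2 ^ j - 1)"
    using n_subsets[of "D - {c}" "2 ^ j - 1"] finD c D(2) by simp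
  finally have oddW: "odd (card W)" using odd_choose_pow2 by simp
  have inj: "inj q" if "q \<in> Q" for q using that Q permutes_inj two_groupD(3) by blast
  have compl: "q ` (D - A) = D - q ` A" if "q \<in> Q" for q A
    using stab[OF that] inj[OF that] by (metis image_set_diff)
  have cc: "card (D - A) = 2 ^ j" if "A \<subseteq> D" "card A = 2 ^ j" for A
    using that D(2) finD by (subst card_Diff_subset) (auto intro: finite_subset)
  have "(2::nat) dvd card W \<longleftrightarrow> 2 dvd card {w \<in> W. \<forall>g\<in>Q. act g w = w}"
  proof (rule group.card_fixed_points_cong[OF group_sym_group_on two_is_prime_nat finite_sym_group_on[OF fin] _ finW])
    show "p_subgroup 2 Q (sym_group_on X)" using Q fin two_group_iff_p_subgroup by blast
  next
    fix q A assume q: "q \<in> Q" and A: "A \<in> W"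
    have "q ` A \<subseteq> D" using stab[OF q] A by (auto simp: W_def)
    moreover have "card (q ` A) = 2 ^ j" using inj[OF q] A by (auto simp: W_def card_image inj_on_subset)
    ultimately show "act q A \<in> W" using cc c by (auto simp: act_def W_def)
  next
    show "act \<one>\<^bsub>sym_group_on X\<^esub> w = w" if "w \<in> W" for w using that by (auto simp: act_def W_def)
  next
    fix g h A assume g: "g \<in> Q" and h: "h \<in> Q" and A: "A \<in> W"
    have A1: "A \<subseteq> D" using A by (simp add: W_def)
    have A2: "h ` A \<subseteq> D" using image_mono[OF A1, of h] stab[OF h] by simp
    have A3: "g ` h ` A \<subseteq> D" using image_mono[OF A2, of g] stab[OF g] by simp
    note A' = A1 A2 A3
    show "act (g \<otimes>\<^bsub>sym_group_on X\<^esub> h) A = act g (act h A)"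
      using A' compl[OF g] c by (auto simp: act_def image_comp[symmetric] double_diff)
  qed
  then have "{w \<in> W. \<forall>g\<in>Q. act g w = w} \<noteq> {}" using oddW by (metis card.empty dvd_0_right)
  then obtain A where A: "A \<in> W" "\<And>g. g \<in> Q \<Longrightarrow> act g A = A" by blast
  have "q ` A = A \<or> q ` A = D - A" if q: "q \<in> Q" for q
  proof (cases "c \<in> q ` A")
    case False
    have "q ` A \<subseteq> D" using stab[OF q] image_mono[of A D q] A by (simp add: W_def)
    moreover have "D - q ` A = A" using A(2)[OF q] False by (simp add: act_def)
    ultimately show ?thesis by blast
  qed (use A(2)[OF q] in \<open>simp add: act_def\<close>)
  moreover have "A \<subseteq> D" "card A = 2 ^ j" using A by (auto simp: W_def)
  ultimately show ?thesis by blast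
qed

section \<open>Orbits and full cycles\<close>

lemma funpow_mem:
  assumes "id \<in> Q" "\<And>a b. a \<in> Q \<Longrightarrow> b \<in> Q \<Longrightarrow> a \<circ> b \<in> Q" "g \<in> Q"
  shows "g ^^ n \<in> Q"
proof (induction n)
  case 0
  show ?case unfolding funpow.simps by (rule assms(1))
next
  case (Suc n)
  show ?case unfolding funpow.simps by (rule assms(2)[OF assms(3) Suc])
qed

lemma image_o: "(a \<circ> b) ` S = a ` b ` S"
  by auto

lemma two_group_stabilizer:
  assumes "two_group X Q"
  shows "two_group X {q \<in> Q. q ` D = D}"
proof -
  have "(a \<circ> b) ` D = D" if "a ` D = D" "b ` D = D" for a b :: "'a \<Rightarrow> 'a"
    unfolding image_o using that by simp
  then show ?thesis using assms unfolding two_group_def by auto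
qed

lemma image_conj_inv:
  assumes "h permutes X"
  shows "h ` (inv' h \<circ> w \<circ> h) ` S = w ` h ` S"
  using permutes_inverses(1)[OF assms] by (auto simp: image_iff)

lemma orbit_eq_range:
  assumes "permutation x"
  shows "orbit x a = range (\<lambda>i. (x ^^ i) a)"
  using orbit_altdef_permutation[OF assms] by auto

lemma card_orbit_eq_least_power:
  assumes "permutation x"
  shows "card (orbit x a) = least_power x a"
proof -
  have "card (set (support x a)) = length (support x a)"
    using cycle_of_permutation[OF assms] distinct_card by blast
  then show ?thesis using support_set[OF assms] orbit_eq_range[OF assms] by simp
qed

lemma card_orbit_dvd_iff:
  assumes "permutation x"
  shows "card (orbit x a) dvd n \<longleftrightarrow> (x ^^ n) a = a"
  using least_power_dvd[OF assms] card_orbit_eq_least_power[OF assms] by metis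

lemma finite_orbit_permutation: "permutation x \<Longrightarrow> finite (orbit x a)"
  by (simp add: finite_orbit permutation_self_in_orbit)

lemma card_orbit_pos: "permutation x \<Longrightarrow> card (orbit x a) > 0"
  using finite_orbit_permutation permutation_self_in_orbit by (metis card_gt_0_iff empty_iff)

lemma orbit_eq_of_mem:
  assumes "permutation x" "b \<in> orbit x a"
  shows "orbit x b = orbit x a"
  using orbit_cyclic_eq3[OF cyclic_on_orbit'[OF assms(1)] assms(2)] .

lemma orbit_subset_of_image:
  assumes "x ` A \<subseteq> A" "b \<in> A"
  shows "orbit x b \<subseteq> A"
proof
  fix y assume "y \<in> orbit x b"
  then show "y \<in> A" by induction (use assms in auto)
qed

lemma image_orbit:
  assumes "permutation x"
  shows "x ` orbit x a = orbit x a"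
proof (rule endo_inj_surj)
  show "finite (orbit x a)" by (rule finite_orbit_permutation[OF assms])
  show "x ` orbit x a \<subseteq> orbit x a" by (auto intro: orbit.step)
  show "inj_on x (orbit x a)" using assms by (meson inj_on_subset permutation_bijective bij_is_inj subset_UNIV)
qed

text \<open>Both numbers have the same multiples, namely the \<open>k\<close> with
  \<open>d * n dvd d * k\<close>.\<close>

lemma card_orbit_power:
  assumes x: "permutation x" and c: "card (orbit x a) = d * n" and d: "d > 0"
  shows "card (orbit (x ^^ d) a) = n"
proof -
  have "card (orbit (x ^^ d) a) dvd k \<longleftrightarrow> n dvd k" for k
  proof -
    have "card (orbit (x ^^ d) a) dvd k \<longleftrightarrow> ((x ^^ d) ^^ k) a = a"
      using x by (simp add: card_orbit_dvd_iff permutation_funpow)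
    also have "\<dots> \<longleftrightarrow> d * n dvd d * k"
      using card_orbit_dvd_iff[OF x, of a "d * k"] c by (simp add: funpow_mult)
    finally show ?thesis using d by simp
  qed
  then show ?thesis by (meson dvd_antisym dvd_refl)
qed

text \<open>A cycle swaps the halves of any invariant halving of its support, so its square determines them.\<close>

lemma orbit_square_eq_half:
  assumes w: "permutation w" and D: "card (orbit w a) = 2 ^ Suc j"
    and A: "A \<subseteq> orbit w a" "card A = 2 ^ j" "w ` A = A \<or> w ` A = orbit w a - A" and b: "b \<in> A"
  shows "orbit (w ^^ 2) b = A"
proof -
  let ?D = "orbit w a"
  have Db: "orbit w b = ?D" using orbit_eq_of_mem[OF w] A b by blast
  have finD: "finite ?D" by (rule finite_orbit_permutation[OF w])
  have "w ` A \<noteq> A"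
  proof
    assume "w ` A = A"
    then have "?D \<subseteq> A" using orbit_subset_of_image[of w A b] b Db by simp
    then have "card ?D \<le> card A" using finD A(1) finite_subset card_mono by blast
    then show False using D A(2) by simp
  qed
  then have wA: "w ` A = ?D - A" using A(3) by blast
  have inj: "inj w" using w permutation_bijective bij_is_inj by blast
  have "w ` (w ` A) = w ` ?D - w ` A" unfolding wA using image_set_diff[OF inj] wA by metis
  also have "\<dots> = A" using image_orbit[OF w] wA A(1) by (simp add: double_diff)
  finally have "(w ^^ 2) ` A = A" by (simp add: numeral_2_eq_2 image_comp)
  then have "orbit (w ^^ 2) b \<subseteq> A" using orbit_subset_of_image[of "w ^^ 2" A b] b by simp
  moreover have "card (orbit (w ^^ 2) b) = card A"
    using card_orbit_power[OF w, of b 2 "2 ^ j"] Db D A(2) by simp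
  ultimately show ?thesis using A(1) finD by (metis card_subset_eq finite_subset)
qed

lemma orbit_funpow_id: "orbit id a = {a}"
  by (simp add: orbit_eq_singleton_iff)

text \<open>The automorphism group of the binary tree whose nodes are the orbits of the powers \<open>z ^^ 2\<^sup>i\<close>.\<close>

definition tree_aut :: "'a set \<Rightarrow> ('a \<Rightarrow> 'a) \<Rightarrow> ('a \<Rightarrow> 'a) set"
  where "tree_aut B z = {g. g permutes B \<and>
    (\<forall>i. \<forall>c\<in>B. g ` orbit (z ^^ (2 ^ i)) c = orbit (z ^^ (2 ^ i)) (g c))}"

locale full_cycle =
  fixes B :: "'a set" and z m
  assumes fin: "finite B" and card_B: "card B = 2 ^ m" and z: "z permutes B"
    and full: "\<And>c. c \<in> B \<Longrightarrow> orbit z c = B"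
begin

lemma perm_z: "permutation z"
  using z fin by (auto simp: permutation_permutes)

text \<open>The nodes of depth \<open>i\<close> of the tree: blocks of size
  \<open>2 ^ (m - i)\<close>, and singletons from depth \<open>m\<close> on.\<close>

abbreviation C where "C i c \<equiv> orbit (z ^^ (2 ^ i)) c"

lemma card_C: "c \<in> B \<Longrightarrow> i \<le> m \<Longrightarrow> card (C i c) = 2 ^ (m - i)"
  by (rule card_orbit_power[OF perm_z]) (simp_all add: full card_B flip: power_add)

lemma z_pow_id: "m \<le> i \<Longrightarrow> z ^^ (2 ^ i) = id"
proof
  fix c assume i: "m \<le> i"
  show "(z ^^ (2 ^ i)) c = id c"
  proof (cases "c \<in> B")
    case True
    then have "card (orbit z c) dvd 2 ^ i" using i by (simp add: full card_B le_imp_power_dvd)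
    then show ?thesis using card_orbit_dvd_iff[OF perm_z] by simp
  qed (use permutes_not_in[OF permutes_funpow[OF z]] in simp)
qed

lemma C_ge: "m \<le> i \<Longrightarrow> C i c = {c}"
  by (simp add: z_pow_id orbit_funpow_id)

lemma perm_pow: "permutation (z ^^ n)"
  by (simp add: perm_z permutation_funpow)

lemma C_Suc: "C (Suc i) c = orbit ((z ^^ (2 ^ i)) ^^ 2) c"
  by (simp add: funpow_mult mult.commute)

lemma C_Suc_subset: "C (Suc i) c \<subseteq> C i c"
proof -
  have "permutation ((z ^^ (2 ^ i)) ^^ 2)" using perm_pow permutation_funpow by blast
  then show ?thesis unfolding C_Suc
    by (auto simp: orbit_eq_range[OF perm_pow] orbit_eq_range funpow_mult mult.assoc)
qed

lemma C_subset: "c \<in> B \<Longrightarrow> C i c \<subseteq> B"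
  using permutes_orbit_subset[OF permutes_funpow[OF z]] by blast

lemma self_C: "c \<in> C i c"
  by (simp add: perm_pow permutation_self_in_orbit)

text \<open>A node above the leaves is the disjoint union of two children of equal size, so a point
  of it outside one child has the other as its own child node.\<close>

lemma C_diff:
  assumes c: "c \<in> B" and i: "i < m" and b: "b \<in> C i c" "b \<notin> C (Suc i) c"
  shows "C (Suc i) b = C i c - C (Suc i) c"
proof (rule card_subset_eq)
  have bB: "b \<in> B" using b C_subset[OF c] by blast
  have pw: "(2::nat) ^ (m - i) = 2 * 2 ^ (m - Suc i)"
    using Suc_diff_Suc[OF i] by (metis power_Suc)
  show "finite (C i c - C (Suc i) c)" by (simp add: finite_orbit_permutation perm_pow)
  have "C i b = C i c" using orbit_eq_of_mem[OF perm_pow b(1)] .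
  moreover have "C (Suc i) b \<inter> C (Suc i) c = {}"
    using b(2) orbit_eq_of_mem[OF perm_pow] self_C by blast
  ultimately show "C (Suc i) b \<subseteq> C i c - C (Suc i) c" using C_Suc_subset by blast
  have "card (C i c - C (Suc i) c) = 2 ^ (m - i) - 2 ^ (m - Suc i)"
    using card_C[OF c, of i] card_C[OF c, of "Suc i"] i C_Suc_subset
    by (subst card_Diff_subset) (auto simp: finite_orbit_permutation perm_pow simp del: power_Suc)
  also have "\<dots> = 2 ^ (m - Suc i)" using pw by simp
  also have "\<dots> = card (C (Suc i) b)" using card_C[OF bB, of "Suc i"] i by (simp del: power_Suc)
  finally show "card (C (Suc i) b) = card (C i c - C (Suc i) c)" by simp
qed

text \<open>Descend the tree. The stabilizer in \<open>Q\<close> of a node \<open>?D\<close>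
  preserves a halving of \<open>?D\<close>. As \<open>?w\<close> is a cycle on \<open>?D\<close>,
  the half \<open>E\<close> containing \<open>c\<close> is the child of \<open>c\<close>. The
  conjugate of \<open>?w\<close> under \<open>h\<close> also lies in this stabilizer, so
  \<open>?w\<close> preserves the image halving of the image node, and the image of \<open>E\<close>
  under \<open>h\<close> is again a child.\<close>

lemma normalizer_subset_tree_aut:
  assumes Q: "two_group B Q" "z \<in> Q" and h: "h permutes B" "\<And>q. q \<in> Q \<Longrightarrow> h \<circ> q \<circ> inv' h \<in> Q"
  shows "h \<in> tree_aut B z"
proof -
  have zQ: "z ^^ n \<in> Q" for n
    by (rule funpow_mem[OF two_groupD(1,2)[OF Q(1)] Q(2)])
  have hC: "\<forall>c\<in>B. h ` C i c = C i (h c)" for i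
  proof (induction i)
    case 0
    then show ?case using h(1) by (simp add: full permutes_image permutes_in_image)
  next
    case (Suc i)
    show ?case
    proof (cases "i < m")
      case False
      then show ?thesis using C_ge[of "Suc i"] by (simp del: power_Suc)
    next
      case True
      then obtain j where j: "m - i = Suc j" using Suc_diff_Suc[OF True] by metis
      show ?thesis
      proof
        fix c assume c: "c \<in> B"
        let ?w = "z ^^ (2 ^ i)"
        let ?D = "C i c"
        let ?Q = "{q \<in> Q. q ` ?D = ?D}"
        have cD: "card ?D = 2 ^ Suc j" using card_C[OF c] True j by simp
        have "\<exists>A\<subseteq>?D. card A = 2 ^ j \<and> (\<forall>q\<in>?Q. q ` A = A \<or> q ` A = ?D - A)"
          by (rule invariant_half_exists[OF fin two_group_stabilizer[OF Q(1)] C_subset[OF c] cD]) simp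
        then obtain A where A0: "A \<subseteq> ?D \<and> card A = 2 ^ j \<and> (\<forall>q\<in>?Q. q ` A = A \<or> q ` A = ?D - A)"
          by (elim exE)
        note A = A0[THEN conjunct1] A0[THEN conjunct2, THEN conjunct1]
          A0[THEN conjunct2, THEN conjunct2, THEN bspec]
        \<comment> \<open>\<open>invariant_half_exists\<close> does not say on which side
          \<open>c\<close> lies.\<close>
        define E where "E = (if c \<in> A then A else ?D - A)"
        have finD: "finite ?D" by (simp add: finite_orbit_permutation perm_pow)
        have inj: "inj q" if "q \<in> Q" for q using that Q(1) permutes_inj two_groupD(3) by blast
        have AD: "q ` (?D - A) = A \<or> q ` (?D - A) = ?D - A" if q: "q \<in> ?Q" for q
          using A(3)[OF q] q A(1) image_set_diff[OF inj, of q ?D A] by (auto simp: double_diff)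
        have E: "c \<in> E" "E \<subseteq> ?D" "card E = 2 ^ j" "\<And>q. q \<in> ?Q \<Longrightarrow> q ` E = E \<or> q ` E = ?D - E"
        proof -
          show "c \<in> E" "E \<subseteq> ?D" using A(1) self_C by (auto simp: E_def)
          show "card E = 2 ^ j"
            using A(1,2) cD finD by (auto simp: E_def card_Diff_subset finite_subset)
          show "q ` E = E \<or> q ` E = ?D - E" if q: "q \<in> ?Q" for q
          proof (cases "c \<in> A")
            case True
            then have "E = A" by (simp add: E_def)
            then show ?thesis using A(3)[OF q] by simp
          next
            case False
            then have E: "E = ?D - A" by (simp add: E_def)
            then have "?D - E = A" using A(1) by (simp add: double_diff)
            then show ?thesis using AD[OF q] E by metis
          qed
        qed
        have wQ: "?w \<in> ?Q" using zQ image_orbit[OF perm_pow] by simp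
        have E_eq: "C (Suc i) c = E"
          unfolding C_Suc by (rule orbit_square_eq_half[OF perm_pow cD E(2,3) E(4)[OF wQ] E(1)])
        have hD: "h ` ?D = C i (h c)" using Suc.IH c by blast
        have injh: "inj h" using h(1) permutes_inj by blast
        have hc: "h c \<in> B" using h(1) c permutes_in_image by fastforce
        \<comment> \<open>Conjugating by \<open>h\<close> moves the invariance question for the
          image of \<open>E\<close> back to \<open>E\<close>.\<close>
        let ?v = "inv' h \<circ> ?w \<circ> h"
        have hv: "h ` ?v ` S = ?w ` h ` S" for S by (rule image_conj_inv[OF h(1)])
        have vQ: "?v \<in> ?Q"
        proof -
          have "?v \<in> Q"
            by (rule conj_inv_closed[OF fin _ h zQ]) (rule two_groupD(3)[OF Q(1)])
          moreover have "h ` ?v ` ?D = h ` ?D"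
            unfolding hv hD using image_orbit[OF perm_pow] by blast
          then have "?v ` ?D = ?D" using injh by (meson inj_image_eq_iff)
          ultimately show ?thesis by blast
        qed
        have e1: "?w ` h ` E = h ` E \<or> ?w ` h ` E = C i (h c) - h ` E"
          using E(4)[OF vQ] unfolding hv[symmetric] hD[symmetric] by (metis image_set_diff injh)
        have e2: "card (h ` E) = 2 ^ j" using E(3) injh by (simp add: card_image inj_on_subset)
        have e3: "h ` E \<subseteq> C i (h c)" using E(2) hD by blast
        have e4: "card (C i (h c)) = 2 ^ Suc j" using card_C[OF hc] True j by simp
        have e5: "h c \<in> h ` E" using E(1) by blast
        have "C (Suc i) (h c) = h ` E"
          unfolding C_Suc by (rule orbit_square_eq_half[OF perm_pow e4 e3 e2 e1 e5])
        then show "h ` C (Suc i) c = C (Suc i) (h c)" using E_eq by simp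
      qed
    qed
  qed
  then show ?thesis using h by (simp add: tree_aut_def)
qed

lemma tree_autD:
  assumes "g \<in> tree_aut B z"
  shows "g permutes B" "c \<in> B \<Longrightarrow> g ` C i c = C i (g c)"
  using assms by (auto simp: tree_aut_def)

lemma tree_aut_comp: "a \<in> tree_aut B z \<Longrightarrow> b \<in> tree_aut B z \<Longrightarrow> a \<circ> b \<in> tree_aut B z"
  using tree_autD(1)[of a] tree_autD(1)[of b] tree_autD(2)[of a] tree_autD(2)[of b]
  unfolding tree_aut_def image_o mem_Collect_eq by (metis comp_apply permutes_compose permutes_in_image)

lemma id_tree_aut: "id \<in> tree_aut B z"
  by (simp add: tree_aut_def permutes_id)

text \<open>\<open>g ^^ (2 ^ i)\<close> fixes every node of depth \<open>i\<close>: it then fixes or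
  swaps the two children of such a node, so its square fixes them. At depth \<open>m\<close> the
  nodes are single points.\<close>

lemma two_group_tree_aut: "two_group B (tree_aut B z)"
proof -
  have pw: "g ^^ n \<in> tree_aut B z" if "g \<in> tree_aut B z" for g n
    by (rule funpow_mem[OF id_tree_aut tree_aut_comp that])
  have "g ^^ (2 ^ m) = id" if g: "g \<in> tree_aut B z" for g
  proof -
    have *: "\<forall>c\<in>B. (g ^^ (2 ^ i)) ` C i c = C i c" if "i \<le> m" for i
      using that
    proof (induction i)
      case 0
      show ?case using permutes_image[OF tree_autD(1)[OF g]] by (simp add: full)
    next
      case (Suc i)
      show ?case
      proof
        fix c assume c: "c \<in> B"
        let ?f = "g ^^ (2 ^ i)"
        let ?E = "C (Suc i) c"
        have f: "?f \<in> tree_aut B z" using pw g by blast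
        have fD: "?f ` C i c = C i c" using Suc c by simp
        have fE: "?f ` ?E = C (Suc i) (?f c)" using tree_autD(2)[OF f c] .
        have ff: "g ^^ (2 ^ Suc i) = ?f \<circ> ?f" by (simp add: mult_2 funpow_add)
        have fc: "?f c \<in> C i c" using fD self_C by blast
        show "(g ^^ (2 ^ Suc i)) ` ?E = ?E"
        proof (cases "?f c \<in> ?E")
          case True
          then have "?f ` ?E = ?E" using fE orbit_eq_of_mem[OF perm_pow] by blast
          then show ?thesis unfolding ff image_o by simp
        next
          case False
          then have E: "?f ` ?E = C i c - ?E" using fE C_diff[OF c _ fc] Suc.prems by simp
          have "inj ?f" using tree_autD(1)[OF f] permutes_inj by blast
          then have "?f ` (C i c - ?E) = C i c - (C i c - ?E)" using E fD by (metis image_set_diff)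
          then show ?thesis using E C_Suc_subset[of i c] unfolding ff image_o by (simp add: double_diff del: power_Suc)
        qed
      qed
    qed
    show ?thesis
    proof
      fix c
      show "(g ^^ (2 ^ m)) c = id c"
      proof (cases "c \<in> B")
        case True
        then show ?thesis using *[of m] C_ge[of m c] by auto
      next
        case False
        then show ?thesis using permutes_not_in[OF permutes_funpow[OF tree_autD(1)[OF g]]] by simp
      qed
    qed
  qed
  then show ?thesis
    using id_tree_aut tree_aut_comp tree_autD(1) unfolding two_group_def by blast
qed

text \<open>\<open>P\<close> normalizes itself, so it lies in \<open>tree_aut B z\<close>; that
  2-group is conjugate into the Sylow subgroup \<open>P\<close>, so the two coincide. In particular
  the full cycle \<open>z\<close> lies in only one Sylow 2-subgroup.\<close>

lemma normalizer_subset_sylow: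
  assumes P: "is_sylow B P" "z \<in> P" and Q: "two_group B Q" "z \<in> Q"
    and h: "h permutes B" "\<And>q. q \<in> Q \<Longrightarrow> h \<circ> q \<circ> inv' h \<in> Q"
  shows "h \<in> P"
proof -
  have tP: "two_group B P" using P by (simp add: is_sylow_def)
  let ?T = "tree_aut B z"
  have finT: "finite ?T" using finite_permutations[OF fin] by (rule rev_finite_subset) (auto dest: tree_autD)
  have "P \<subseteq> ?T"
    using normalizer_subset_tree_aut[OF tP P(2)] two_groupD(3)[OF tP] two_group_conj[OF fin tP] by blast
  moreover obtain a where a: "a permutes B" "\<forall>q\<in>?T. a \<circ> q \<circ> inv' a \<in> P"
    using sylow_conj_into[OF fin P(1) group.subgroup_self[OF group_sym_group_on] _ two_group_tree_aut]
      two_groupD(3)[OF tP] tree_autD(1) by auto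
  have "inj_on (\<lambda>q. a \<circ> q \<circ> inv' a) ?T"
  proof (rule inj_onI)
    fix p q assume "a \<circ> p \<circ> inv' a = a \<circ> q \<circ> inv' a"
    then have "inv' a \<circ> (a \<circ> p \<circ> inv' a) \<circ> a = inv' a \<circ> (a \<circ> q \<circ> inv' a) \<circ> a" by simp
    then show "p = q" using permutes_inv_o[OF a(1)] by (metis comp_assoc comp_id id_comp)
  qed
  then have "card ?T \<le> card P"
    using a(2) finT \<open>P \<subseteq> ?T\<close> by (intro card_inj_on_le[of _ ?T P]) (auto intro: finite_subset)
  ultimately have "P = ?T" using finT card_seteq by blast
  then show ?thesis using normalizer_subset_tree_aut[OF Q h] by blast
qed

end

section \<open>Restriction to an invariant block\<close>

text \<open>Transpose a point of \<open>E\<close> with a point outside: the image of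
  \<open>E\<close> contains \<open>f\<close> from outside and still \<open>e'\<close> from
  inside.\<close>

lemma halving_not_invariant:
  assumes E: "e \<in> E" "e' \<in> E" "e \<noteq> e'" "f \<in> X" "f \<notin> E" "E \<subseteq> X"
    and T: "\<And>g. g \<in> T \<Longrightarrow> g ` E = E \<or> g ` E = X - E"
  shows "\<exists>g. g permutes X \<and> g \<notin> T"
proof (intro exI conjI notI)
  show "transpose e f permutes X" using E by (auto intro: permutes_swap_id)
  assume "transpose e f \<in> T"
  then have "transpose e f ` E = E \<or> transpose e f ` E = X - E" by (rule T)
  moreover have "f \<in> transpose e f ` E" using E by (metis image_eqI transpose_apply_first)
  moreover have "e' \<in> transpose e f ` E" using E by (metis image_eqI transpose_apply_other)
  ultimately show False using E by auto
qed

text \<open>The fixed point \<open>c\<close> prevents \<open>x\<close> from swapping the halves of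
  an invariant halving, so each half is a union of cycles, and the half containing \<open>b\<close>
  is the cycle of \<open>b\<close>. This applies to the halving preserved by \<open>Q\<close> and,
  because \<open>g\<close> normalizes \<open>Q\<close>, to its image under \<open>g\<close>.\<close>

lemma sub_gens_preserve_halves:
  assumes fin: "finite X" and card_X: "card X = 2 ^ Suc j" and x: "x permutes X"
    and B: "b \<in> X" "card (orbit x b) = 2 ^ j" and c: "c \<in> X" "c \<notin> orbit x b" "x c = c"
    and g: "g \<in> sub_gens X x"
  shows "g ` orbit x b = orbit x b \<or> g ` orbit x b = X - orbit x b"
proof -
  let ?B = "orbit x b"
  obtain Q where Q: "two_group X Q" "x \<in> Q" and gQ: "\<And>q. q \<in> Q \<Longrightarrow> g \<circ> q \<circ> inv' g \<in> Q"
    and gX: "g permutes X"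
    using g by (auto simp: sub_gens_def)
  have perm: "permutation x" using x fin by (auto simp: permutation_permutes)
  have BX: "?B \<subseteq> X" using permutes_orbit_subset[OF x B(1)] .
  have bB: "b \<in> ?B" using permutation_self_in_orbit[OF perm] .
  have injx: "inj x" and injg: "inj g" using x gX permutes_inj by auto
  have QX: "q ` X = X" if "q \<in> Q" for q using two_groupD(3)[OF Q(1) that] permutes_image by blast
  have halves: "E = ?B \<or> E = X - ?B"
    if E: "E \<subseteq> X" "card E = 2 ^ j" "x ` E = E \<or> x ` E = X - E" for E
  proof -
    have "x ` E = E"
    proof (cases "c \<in> E")
      case True
      then have "c \<in> x ` E" using c(3) by force
      then show ?thesis using E(3) True by blast
    next
      case False
      then have "c \<notin> x ` E" using c(3) injx by (metis image_iff inj_eq)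
      then show ?thesis using E(3) False c(1) by blast
    qed
    then have E': "x ` (X - E) = X - E" using image_set_diff[OF injx] permutes_image[OF x] by metis
    show ?thesis
    proof (cases "b \<in> E")
      case True
      then have "?B \<subseteq> E" using orbit_subset_of_image[of x E b] \<open>x ` E = E\<close> by simp
      then show ?thesis using card_subset_eq[of E ?B] E B(2) fin finite_subset by metis
    next
      case False
      then have "?B \<subseteq> X - E" using orbit_subset_of_image[of x "X - E" b] E' B(1) by blast
      moreover have "card (X - E) = 2 ^ j"
        using E card_X fin by (simp add: card_Diff_subset finite_subset)
      ultimately have "?B = X - E" using card_subset_eq[of "X - E" ?B] B(2) fin by simp
      then show ?thesis using E(1) by blast
    qed
  qed
  obtain A where A: "A \<subseteq> X" "card A = 2 ^ j" "\<And>q. q \<in> Q \<Longrightarrow> q ` A = A \<or> q ` A = X - A"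
    using invariant_half_exists[OF fin Q(1) order.refl card_X QX] by metis
  have A1: "A = ?B \<or> A = X - ?B" using halves[OF A(1,2) A(3)[OF Q(2)]] .
  let ?v = "inv' g \<circ> x \<circ> g"
  have "?v \<in> Q" by (rule conj_inv_closed[OF fin two_groupD(3)[OF Q(1)] gX gQ Q(2)])
  then have "?v ` A = A \<or> ?v ` A = X - A" by (rule A(3))
  moreover have hv: "g ` ?v ` S = x ` g ` S" for S by (rule image_conj_inv[OF gX])
  ultimately have "x ` g ` A = g ` A \<or> x ` g ` A = X - g ` A"
    using image_set_diff[OF injg] permutes_image[OF gX] by metis
  moreover have "g ` A \<subseteq> X" using A(1) permutes_image[OF gX] by blast
  moreover have "card (g ` A) = 2 ^ j" using A(2) injg by (simp add: card_image inj_on_subset)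
  ultimately have A2: "g ` A = ?B \<or> g ` A = X - ?B" by (intro halves)
  have "g ` (X - A) = X - g ` A" using image_set_diff[OF injg] permutes_image[OF gX] by metis
  moreover have "X - (X - ?B) = ?B" using BX by (simp add: double_diff)
  ultimately show ?thesis using A1 A2 by metis
qed

text \<open>The two nodes of depth 1 form a partition preserved by \<open>tree_aut B z\<close>;
  since \<open>m \<ge> 2\<close>, they have at least two points each, and a transposition breaks the
  partition.\<close>

lemma (in full_cycle) Sub_psubset:
  assumes "m \<ge> 2"
  shows "Sub B z \<subset> {p. p permutes B}"
proof -
  have *: "sub_gens B z \<subseteq> tree_aut B z"
    using normalizer_subset_tree_aut by (auto simp: sub_gens_def)
  have T: "Sub B z \<subseteq> tree_aut B z"
    by (rule Sub_subset[OF fin id_tree_aut tree_aut_comp *])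
  have "B \<noteq> {}" using card_B by auto
  then obtain c where c: "c \<in> B" by blast
  let ?E = "C (Suc 0) c"
  have cE: "card ?E = 2 ^ (m - 1)" using card_C[OF c, of "Suc 0"] assms by simp
  have EB: "?E \<subseteq> B" using C_subset[OF c] .
  have pw: "(2::nat) ^ m = 2 * 2 ^ (m - 1)" "(2::nat) ^ (m - 1) = 2 * 2 ^ (m - 2)"
    using assms by (simp_all flip: power_Suc add: Suc_diff_le numeral_2_eq_2)
  have "?E \<noteq> B" using cE card_B pw(1) by (metis add_eq_self_zero mult_2 power_not_zero zero_neq_numeral)
  then obtain f where f: "f \<in> B" "f \<notin> ?E" using EB by blast
  have "?E \<noteq> {c}" using cE pw(2) by (metis One_nat_def card.empty card.insert empty_iff finite.emptyI dvd_triv_left nat_dvd_1_iff_1 numeral_eq_one_iff semiring_norm(85))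
  then obtain e where e: "e \<in> ?E" "e \<noteq> c" using self_C[of c "Suc 0"] by blast
  have "g ` ?E = ?E \<or> g ` ?E = B - ?E" if g: "g \<in> tree_aut B z" for g
  proof (cases "g c \<in> ?E")
    case True
    then show ?thesis using tree_autD(2)[OF g c, of "Suc 0"] orbit_eq_of_mem[OF perm_pow] by blast
  next
    case False
    have "C 0 c = B" using full[OF c] by simp
    moreover have "g c \<in> B" using tree_autD(1)[OF g] c permutes_in_image by fastforce
    ultimately show ?thesis
      using tree_autD(2)[OF g c, of "Suc 0"] C_diff[OF c, of 0 "g c"] False assms by simp
  qed
  then obtain g where "g permutes B" "g \<notin> tree_aut B z"
    using halving_not_invariant[OF self_C e(1) e(2)[symmetric] f EB, of "tree_aut B z"] by blast
  then show ?thesis using T Sub_permutes by blast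
qed

lemma perm_restrict_comp_invariant:
  assumes "h ` A \<subseteq> A"
  shows "perm_restrict (g \<circ> h) A = perm_restrict g A \<circ> perm_restrict h A"
  using assms by (auto simp: perm_restrict_def fun_eq_iff)

lemma perm_restrict_id_eq: "perm_restrict id A = id"
  by (auto simp: perm_restrict_def fun_eq_iff)

lemma perm_restrict_funpow:
  assumes "g ` A \<subseteq> A"
  shows "perm_restrict (g ^^ n) A = perm_restrict g A ^^ n"
proof (induction n)
  case (Suc n)
  have "(g ^^ n) ` A \<subseteq> A" by (induction n) (use assms in auto)
  then show ?case unfolding funpow.simps Suc[symmetric] by (rule perm_restrict_comp_invariant)
qed (simp only: funpow.simps perm_restrict_id_eq)

lemma perm_restrict_permutes:
  assumes "inj g" "g ` A = A"
  shows "perm_restrict g A permutes A"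
proof (rule bij_imp_permutes)
  show "bij_betw (perm_restrict g A) A A"
    using assms by (auto simp: bij_betw_def perm_restrict_def inj_on_def inj_def)
qed (simp add: perm_restrict_simps)

lemma image_inv_eq:
  assumes "g permutes X" "g ` A = A'"
  shows "inv' g ` A' = A"
  unfolding assms(2)[symmetric] using permutes_inverses(2)[OF assms(1)] by (auto simp: image_iff)

lemma inv_perm_restrict:
  assumes "g permutes X" "g ` A = A"
  shows "inv' (perm_restrict g A) = perm_restrict (inv' g) A"
proof (rule inv_unique_comp)
  have i: "inv' g ` A = A" using image_inv_eq[OF assms] .
  show "perm_restrict g A \<circ> perm_restrict (inv' g) A = id"
    using perm_restrict_comp_invariant[of "inv' g" A g] i permutes_inv_o(1)[OF assms(1)]
    by (simp add: perm_restrict_id_eq)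
  show "perm_restrict (inv' g) A \<circ> perm_restrict g A = id"
    using perm_restrict_comp_invariant[of g A "inv' g"] assms(2) permutes_inv_o(2)[OF assms(1)]
    by (simp add: perm_restrict_id_eq)
qed

lemma two_group_restrict:
  assumes Q: "two_group X Q"
  shows "two_group A {perm_restrict q A | q. q \<in> Q \<and> q ` A = A}"
  unfolding two_group_def
proof (intro conjI ballI)
  show "id \<in> {perm_restrict q A | q. q \<in> Q \<and> q ` A = A}"
    using two_groupD(1)[OF Q] perm_restrict_id_eq[of A, symmetric] by force
next
  fix a b assume "a \<in> {perm_restrict q A | q. q \<in> Q \<and> q ` A = A}" "b \<in> {perm_restrict q A | q. q \<in> Q \<and> q ` A = A}"
  then obtain p q where pq: "p \<in> Q" "p ` A = A" "a = perm_restrict p A" "q \<in> Q" "q ` A = A" "b = perm_restrict q A"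
    by auto
  then have "a \<circ> b = perm_restrict (p \<circ> q) A" by (simp add: perm_restrict_comp_invariant)
  moreover have "(p \<circ> q) ` A = A" unfolding image_o using pq by simp
  ultimately show "a \<circ> b \<in> {perm_restrict q A | q. q \<in> Q \<and> q ` A = A}"
    using two_groupD(2)[OF Q pq(1,4)] by blast
next
  fix a assume "a \<in> {perm_restrict q A | q. q \<in> Q \<and> q ` A = A}"
  then obtain q where q: "q \<in> Q" "q ` A = A" "a = perm_restrict q A" by auto
  show "a permutes A" unfolding q(3) by (rule perm_restrict_permutes[OF permutes_inj[OF two_groupD(3)[OF Q q(1)]] q(2)])
  obtain m where "q ^^ (2 ^ m) = id" using two_groupD(4)[OF Q q(1)] by blast
  then have "a ^^ (2 ^ m) = id" using q perm_restrict_funpow[of q A] by (metis order.refl perm_restrict_id_eq)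
  then show "\<exists>m. a ^^ (2 ^ m) = id" by blast
qed

lemma normalizes_restrict:
  assumes gX: "g permutes X" and gA: "g ` A = A" and gQ: "\<And>q. q \<in> Q \<Longrightarrow> g \<circ> q \<circ> inv' g \<in> Q"
    and p: "p \<in> {perm_restrict q A | q. q \<in> Q \<and> q ` A = A}"
  shows "perm_restrict g A \<circ> p \<circ> inv' (perm_restrict g A) \<in> {perm_restrict q A | q. q \<in> Q \<and> q ` A = A}"
proof -
  obtain q where q: "q \<in> Q" "q ` A = A" "p = perm_restrict q A" using p by auto
  have i: "inv' g ` A = A" using image_inv_eq[OF gX gA] .
  have "perm_restrict g A \<circ> p \<circ> inv' (perm_restrict g A) = perm_restrict (g \<circ> q \<circ> inv' g) A"
    using q gA i inv_perm_restrict[OF gX gA] by (simp add: perm_restrict_comp_invariant)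
  moreover have "(g \<circ> q \<circ> inv' g) ` A = A" unfolding image_o using q gA i by simp
  ultimately show ?thesis using gQ[OF q(1)] by blast
qed

text \<open>The restrictions to \<open>A\<close> of the stabilizer of \<open>A\<close> in
  \<open>Q\<close> form a 2-group, normalized by the restriction of \<open>g\<close>.\<close>

lemma sub_gens_restrict:
  assumes x: "x ` A = A" and g: "g \<in> sub_gens X x" "g ` A = A"
  shows "perm_restrict g A \<in> sub_gens A (perm_restrict x A)"
proof -
  obtain Q where Q: "two_group X Q" "x \<in> Q" and gQ: "\<And>q. q \<in> Q \<Longrightarrow> g \<circ> q \<circ> inv' g \<in> Q"
    and gX: "g permutes X"
    using g by (auto simp: sub_gens_def)
  show ?thesis
    by (rule sub_gensI[OF _ two_group_restrict[OF Q(1), of A] _ normalizes_restrict[OF gX g(2) gQ]])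
      (use perm_restrict_permutes permutes_inj[OF gX] g(2) Q(2) x in auto)
qed

text \<open>The target \<open>Y\<close> may differ from \<open>X\<close>, since the lemma also
  serves to transport a 2-group from one block to the other.\<close>

lemma two_group_conj_group:
  assumes Q: "two_group X Q" and a: "bij a" and P: "\<And>q. q \<in> Q \<Longrightarrow> inv' a \<circ> q \<circ> a permutes Y"
  shows "two_group Y {inv' a \<circ> q \<circ> a | q. q \<in> Q}"
proof -
  have aa: "a \<circ> inv' a = id" "inv' a \<circ> a = id"
    using bij_is_surj[OF a] bij_is_inj[OF a] by (simp_all add: surj_iff inj_iff)
  have mult: "(inv' a \<circ> p \<circ> a) \<circ> (inv' a \<circ> q \<circ> a) = inv' a \<circ> (p \<circ> q) \<circ> a" for p q
    using aa(1) by (metis comp_assoc comp_id)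
  have pow: "(inv' a \<circ> q \<circ> a) ^^ n = inv' a \<circ> q ^^ n \<circ> a" for q n
  proof (induction n)
    case 0
    show ?case unfolding funpow.simps comp_id using aa(2) by simp
  next
    case (Suc n)
    show ?case unfolding funpow.simps Suc mult ..
  qed
  show ?thesis
    unfolding two_group_def
  proof (intro conjI ballI)
    have "id = inv' a \<circ> id \<circ> a" using aa(2) by simp
    then show "id \<in> {inv' a \<circ> q \<circ> a | q. q \<in> Q}" using two_groupD(1)[OF Q] by blast
  next
    fix u v assume "u \<in> {inv' a \<circ> q \<circ> a | q. q \<in> Q}" "v \<in> {inv' a \<circ> q \<circ> a | q. q \<in> Q}"
    then show "u \<circ> v \<in> {inv' a \<circ> q \<circ> a | q. q \<in> Q}" using mult two_groupD(2)[OF Q] by blast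
  next
    fix u assume "u \<in> {inv' a \<circ> q \<circ> a | q. q \<in> Q}"
    then obtain q where q: "q \<in> Q" "u = inv' a \<circ> q \<circ> a" by blast
    show "u permutes Y" using P q by blast
    obtain m where "q ^^ (2 ^ m) = id" using two_groupD(4)[OF Q q(1)] by blast
    then have "u ^^ (2 ^ m) = id" unfolding q(2) pow using aa(2) by simp
    then show "\<exists>m. u ^^ (2 ^ m) = id" by blast
  qed
qed

section \<open>Sylow subgroups containing a given 2-element, and the Frattini argument\<close>

lemma is_sylow_conj:
  assumes P: "is_sylow X P" and a: "a permutes X"
  shows "is_sylow X {inv' a \<circ> q \<circ> a | q. q \<in> P}"
proof -
  let ?R = "{inv' a \<circ> q \<circ> a | q. q \<in> P}"
  have tP: "two_group X P" using P by (simp add: is_sylow_def)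
  have "two_group X ?R"
    by (rule two_group_conj_group[OF tP permutes_bij[OF a]])
      (use a two_groupD(3)[OF tP] in \<open>auto intro!: permutes_compose permutes_inv\<close>)
  moreover have "?R = (\<lambda>q. inv' a \<circ> q \<circ> a) ` P" by auto
  moreover have "inj_on (\<lambda>q. inv' a \<circ> q \<circ> a) P"
  proof (rule inj_onI)
    fix p q assume "inv' a \<circ> p \<circ> a = inv' a \<circ> q \<circ> a"
    then have "a \<circ> (inv' a \<circ> p \<circ> a) \<circ> inv' a = a \<circ> (inv' a \<circ> q \<circ> a) \<circ> inv' a" by simp
    then show "p = q" using permutes_inv_o(1)[OF a] by (metis comp_assoc comp_id id_comp)
  qed
  ultimately show ?thesis using P by (simp add: is_sylow_def card_image)
qed

lemma sylow_containing:
  assumes fin: "finite X" and y: "y permutes X" "y ^^ (2 ^ m) = id"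
  shows "\<exists>P. is_sylow X P \<and> y \<in> P"
proof -
  obtain P where P: "is_sylow X P" using sylow_exists[OF fin] by blast
  have tP: "two_group X P" using P by (simp add: is_sylow_def)
  have cyc: "two_group X {y ^^ i | i. True}" by (rule two_group_cyclic[OF y])
  have "\<exists>a\<in>carrier (sym_group_on X). \<forall>q\<in>{y ^^ i | i. True}. a \<circ> q \<circ> inv' a \<in> P"
    by (rule sylow_conj_into[OF fin P group.subgroup_self[OF group_sym_group_on] _ cyc])
      (use two_groupD(3)[OF tP] two_groupD(3)[OF cyc] in auto)
  moreover have "y = y ^^ 1" by simp
  ultimately obtain a where a: "a permutes X" "a \<circ> y \<circ> inv' a \<in> P"
    unfolding sym_group_on_simps by blast
  have "y = inv' a \<circ> (a \<circ> y \<circ> inv' a) \<circ> a"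
    using permutes_inv_o(2)[OF a(1)] by (metis comp_assoc comp_id id_comp)
  then have "y \<in> {inv' a \<circ> q \<circ> a | q. q \<in> P}" using a(2) by blast
  then show ?thesis using is_sylow_conj[OF P a(1)] by blast
qed

text \<open>A Frattini argument: both \<open>P\<close> and its conjugate by \<open>c\<close> are Sylow subgroups of
  \<open>Sub X y\<close>, so \<open>c\<close> normalizes \<open>P\<close> up to an element of \<open>Sub X y\<close>.\<close>

lemma conj_into_sylow_imp_Sub:
  assumes fin: "finite X" and P: "is_sylow X P" "y \<in> P" and c: "c permutes X" "c \<circ> y \<circ> inv' c \<in> P"
  shows "c \<in> Sub X y"
proof -
  have tP: "two_group X P" using P by (simp add: is_sylow_def)
  let ?R = "{inv' c \<circ> q \<circ> c | q. q \<in> P}"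
  have tR: "two_group X ?R" using is_sylow_conj[OF P(1) c(1)] by (simp add: is_sylow_def)
  have "y = inv' c \<circ> (c \<circ> y \<circ> inv' c) \<circ> c"
    using permutes_inv_o(2)[OF c(1)] by (metis comp_assoc comp_id id_comp)
  then have yR: "y \<in> ?R" using c(2) by blast
  have "P \<subseteq> Sub X y" "?R \<subseteq> Sub X y"
    using sub_gens_Sub sub_gens_member[OF fin tP P(2)] sub_gens_member[OF fin tR yR] by blast+
  then have "\<exists>h\<in>Sub X y. \<forall>q\<in>?R. h \<circ> q \<circ> inv' h \<in> P"
    using sylow_conj_into[OF fin P(1) subgroup_Sub _ tR] by blast
  then obtain h where h: "h \<in> Sub X y" "\<forall>q\<in>?R. h \<circ> q \<circ> inv' h \<in> P" ..
  have hX: "h permutes X" using Sub_permutes[OF h(1)] .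
  \<comment> \<open>\<open>h\<close> brings the conjugate \<open>?R\<close> of \<open>P\<close> back
    into \<open>P\<close>, so \<open>?g\<close> normalizes \<open>P\<close>; then \<open>c\<close>
    is recovered as \<open>inv' ?g \<circ> h\<close>.\<close>
  let ?g = "h \<circ> inv' c"
  have "?g \<in> sub_gens X y"
  proof (rule sub_gensI[OF _ tP P(2)])
    show "?g permutes X" using hX c(1) by (simp add: permutes_compose permutes_inv)
    fix q assume "q \<in> P"
    then have "h \<circ> (inv' c \<circ> q \<circ> c) \<circ> inv' h \<in> P" using h(2) by blast
    moreover have "inv' ?g = c \<circ> inv' h"
      using permutes_bij[OF hX] permutes_bij[OF permutes_inv[OF c(1)]] permutes_inv_inv[OF c(1)]
      by (simp add: o_inv_distrib)
    ultimately show "?g \<circ> q \<circ> inv' ?g \<in> P" by (simp add: comp_assoc)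
  qed
  then have "?g \<in> Sub X y" by (rule sub_gens_Sub)
  then have "inv' h \<circ> ?g \<in> Sub X y" using Sub_comp Sub_inv[OF h(1)] by blast
  moreover have "inv' h \<circ> ?g = inv' c" using permutes_inv_o(2)[OF hX] by (metis comp_assoc id_comp)
  ultimately show ?thesis using Sub_inv permutes_inv_inv[OF c(1)] by metis
qed

section \<open>Imprimitive wreath products\<close>

locale halving =
  fixes X A :: "'a set" and t :: "'a \<Rightarrow> 'a"
  assumes fin: "finite X" and AX: "A \<subseteq> X" and swap: "block_swap X A t" and nonempty: "A \<noteq> {}"
begin

lemma tX: "t permutes X" and tt: "t \<circ> t = id" and tA: "t ` A = X - A"
  using swap by (auto simp: block_swap_def)

lemma tt' [simp]: "t (t c) = c"
  using tt by (metis comp_apply id_apply)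

lemma A_ne_compl: "A \<noteq> X - A"
  using AX nonempty by blast

lemma inv_t: "inv' t = t"
  using inv_unique_comp[OF tt tt] .

lemma t_mem: "c \<in> A \<Longrightarrow> t c \<in> X - A" "c \<in> X - A \<Longrightarrow> t c \<in> A"
  using tA by (auto, metis imageE tt' DiffI)

lemma tA': "t ` (X - A) = A"
  unfolding tA[symmetric] by (auto simp: image_iff)

text \<open>Membership test for the wreath product: a permutation respecting the partition is judged
  by its two coordinates, read as permutations of \<open>A\<close> after transporting the other
  block with \<open>t\<close>. The agreement is \<open>wreath_S2_eq_W\<close>.\<close>

definition W :: "('a \<Rightarrow> 'a) set \<Rightarrow> ('a \<Rightarrow> 'a) set"
  where "W H = {g. g permutes X \<and>
    (g ` A = A \<and> perm_restrict g A \<in> H \<and> perm_restrict (t \<circ> g \<circ> t) A \<in> H \<or>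
     g ` A = X - A \<and> perm_restrict (t \<circ> g) A \<in> H \<and> perm_restrict (g \<circ> t) A \<in> H)}"

lemma image_compl:
  assumes "g permutes X"
  shows "g ` A = A \<Longrightarrow> g ` (X - A) = X - A" "g ` A = X - A \<Longrightarrow> g ` (X - A) = A"
  using image_set_diff[OF permutes_inj[OF assms], of X A] permutes_image[OF assms] AX
  by (auto simp: double_diff)

lemma base_decomp:
  assumes g: "g permutes X" "g ` A = A"
  shows "g = perm_restrict g A \<circ> (t \<circ> perm_restrict (t \<circ> g \<circ> t) A \<circ> t)"
proof
  fix c
  have gB: "g ` (X - A) = X - A" using image_compl(1)[OF g] .
  consider "c \<in> A" | "c \<in> X - A" | "c \<notin> X" using AX by blast
  then show "g c = (perm_restrict g A \<circ> (t \<circ> perm_restrict (t \<circ> g \<circ> t) A \<circ> t)) c"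
  proof cases
    case 1
    then show ?thesis using t_mem by (simp add: perm_restrict_def)
  next
    case 2
    then have "g c \<in> X - A" using gB by blast
    then show ?thesis using t_mem(2)[OF 2] by (simp add: perm_restrict_def)
  next
    case 3
    then show ?thesis using permutes_not_in[OF g(1)] permutes_not_in[OF tX] AX
      by (auto simp: perm_restrict_def)
  qed
qed

lemma base_comp:
  assumes a: "a permutes A" and b: "b permutes A"
  defines "g \<equiv> a \<circ> (t \<circ> b \<circ> t)"
  shows "g permutes X" "g ` A = A" "perm_restrict g A = a" "perm_restrict (t \<circ> g \<circ> t) A = b"
proof -
  show "g permutes X"
    unfolding g_def
    using permutes_subset[OF a AX] permutes_subset[OF b AX] tX by (intro permutes_compose)
  have gA: "g c = a c" if "c \<in> A" for c
    using that t_mem(1)[OF that] permutes_not_in[OF b, of "t c"] by (simp add: g_def)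
  show "g ` A = A" using gA permutes_image[OF a] by (metis image_cong)
  show "perm_restrict g A = a"
    using gA permutes_not_in[OF a] by (auto simp: perm_restrict_def fun_eq_iff)
  have "(t \<circ> g \<circ> t) c = b c" if c: "c \<in> A" for c
  proof -
    have "b c \<in> A" using b c permutes_in_image by fastforce
    then have "a (t (b c)) = t (b c)" using t_mem(1) permutes_not_in[OF a] by blast
    then show ?thesis by (simp add: g_def)
  qed
  then show "perm_restrict (t \<circ> g \<circ> t) A = b"
    using permutes_not_in[OF b] by (auto simp: perm_restrict_def fun_eq_iff)
qed

lemma wreath_S2I:
  "a \<in> H \<Longrightarrow> b \<in> H \<Longrightarrow> s \<in> {id, t} \<Longrightarrow> a \<circ> (t \<circ> b \<circ> t) \<circ> s \<in> wreath_S2 H t"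
  unfolding wreath_S2_def by blast

text \<open>If \<open>g\<close> swaps the blocks, then \<open>g \<circ> t\<close> lies in the base
  group, and its coordinates are the restrictions of \<open>g \<circ> t\<close> and
  \<open>t \<circ> g\<close>.\<close>

lemma wreath_S2_eq_W:
  assumes H: "\<And>h. h \<in> H \<Longrightarrow> h permutes A"
  shows "wreath_S2 H t = W H"
proof
  show "wreath_S2 H t \<subseteq> W H"
  proof
    fix g assume "g \<in> wreath_S2 H t"
    then obtain a b s where ab: "a \<in> H" "b \<in> H" "g = a \<circ> (t \<circ> b \<circ> t) \<circ> s" "s = id \<or> s = t"
      by (auto simp: wreath_S2_def)
    let ?g = "a \<circ> (t \<circ> b \<circ> t)"
    note bc = base_comp[OF H[OF ab(1)] H[OF ab(2)]]
    show "g \<in> W H"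
    proof (cases "s = id")
      case True
      then have "g = ?g" using ab by simp
      then show ?thesis using bc ab(1,2) by (simp add: W_def)
    next
      case False
      then have g: "g = ?g \<circ> t" using ab by simp
      then have gt: "g \<circ> t = ?g" using tt by (metis comp_assoc comp_id)
      have "g permutes X" using g permutes_compose[OF tX bc(1)] by simp
      moreover have "g ` A = ?g ` t ` A" unfolding g by (rule image_o)
      then have "g ` A = X - A" unfolding tA image_compl(1)[OF bc(1,2)] .
      moreover have "perm_restrict (g \<circ> t) A \<in> H" unfolding gt using bc(3) ab(1) by simp
      moreover have "perm_restrict (t \<circ> g) A \<in> H" unfolding g using bc(4) ab(2) by (simp add: comp_assoc)
      ultimately show ?thesis by (simp add: W_def)
    qed
  qed
next
  show "W H \<subseteq> wreath_S2 H t"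
  proof
    fix g assume g: "g \<in> W H"
    then have gX: "g permutes X" by (simp add: W_def)
    consider "g ` A = A" "perm_restrict g A \<in> H" "perm_restrict (t \<circ> g \<circ> t) A \<in> H"
      | "g ` A = X - A" "perm_restrict (t \<circ> g) A \<in> H" "perm_restrict (g \<circ> t) A \<in> H"
      using g by (auto simp: W_def)
    then show "g \<in> wreath_S2 H t"
    proof cases
      case 1
      show ?thesis
        using wreath_S2I[OF 1(2,3), of id] base_decomp[OF gX 1(1)] by simp
    next
      case 2
      have gt: "g \<circ> t permutes X" "(g \<circ> t) ` A = A"
        using permutes_compose[OF tX gX] image_compl(2)[OF gX 2(1)] unfolding image_o tA by auto
      have e: "t \<circ> (g \<circ> t) \<circ> t = t \<circ> g" "g \<circ> t \<circ> t = g" using tt by (simp_all add: comp_assoc)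
      have "g \<circ> t = perm_restrict (g \<circ> t) A \<circ> (t \<circ> perm_restrict (t \<circ> g) A \<circ> t)"
        using base_decomp[OF gt] unfolding e .
      then have "g = perm_restrict (g \<circ> t) A \<circ> (t \<circ> perm_restrict (t \<circ> g) A \<circ> t) \<circ> t"
        using e(2) by simp
      then show ?thesis using wreath_S2I[OF 2(3,2), of t] by simp
    qed
  qed
qed

text \<open>Each coordinate of a product is a product of coordinates; inserting
  \<open>t \<circ> t = id\<close> between the factors shows which ones, depending on which factor
  swaps the blocks.\<close>

lemma W_comp:
  assumes cl: "\<And>a b. a \<in> H \<Longrightarrow> b \<in> H \<Longrightarrow> a \<circ> b \<in> H" and g: "g \<in> W H" and h: "h \<in> W H"
  shows "g \<circ> h \<in> W H"
proof -
  have gX: "g permutes X" and hX: "h permutes X" using g h by (auto simp: W_def)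
  have ghX: "g \<circ> h permutes X" using permutes_compose[OF hX gX] .
  have r: "perm_restrict (u \<circ> v) A \<in> H"
    if "v ` A \<subseteq> A" "perm_restrict u A \<in> H" "perm_restrict v A \<in> H" for u v
    using that cl by (simp add: perm_restrict_comp_invariant)
  have ttx: "t \<circ> (t \<circ> u) = u" for u using tt by (simp add: comp_assoc[symmetric])
  have tm: "(t \<circ> u) ` A = A" if "u ` A = X - A" for u unfolding image_o that by (rule tA')
  have mt: "(u \<circ> t) ` A = u ` (X - A)" for u unfolding image_o tA ..
  have tmt: "(t \<circ> u \<circ> t) ` A = A" if "u permutes X" "u ` A = A" for u
    using image_compl(1)[OF that] tA' unfolding image_o tA by simp
  consider (pp) "g ` A = A" "h ` A = A" | (ps) "g ` A = A" "h ` A = X - A"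
    | (sp) "g ` A = X - A" "h ` A = A" | (ss) "g ` A = X - A" "h ` A = X - A"
    using g h by (auto simp: W_def)
  then show ?thesis
  proof cases
    case pp
    then have gH: "perm_restrict g A \<in> H \<and> perm_restrict (t \<circ> g \<circ> t) A \<in> H"
      and hH: "perm_restrict h A \<in> H \<and> perm_restrict (t \<circ> h \<circ> t) A \<in> H"
      using g h A_ne_compl by (auto simp: W_def)
    have "t \<circ> (g \<circ> h) \<circ> t = (t \<circ> g \<circ> t) \<circ> (t \<circ> h \<circ> t)" by (simp add: comp_assoc ttx)
    then have "perm_restrict (t \<circ> (g \<circ> h) \<circ> t) A \<in> H" using r[of "t \<circ> h \<circ> t"] tmt[OF hX pp(2)] gH hH by simp
    moreover have "perm_restrict (g \<circ> h) A \<in> H" using r pp gH hH by simp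
    moreover have "(g \<circ> h) ` A = A" unfolding image_o using pp by simp
    ultimately show ?thesis using ghX by (simp add: W_def)
  next
    case ps
    then have gH: "perm_restrict g A \<in> H \<and> perm_restrict (t \<circ> g \<circ> t) A \<in> H"
      and hH: "perm_restrict (t \<circ> h) A \<in> H \<and> perm_restrict (h \<circ> t) A \<in> H"
      using g h A_ne_compl by (auto simp: W_def)
    have "t \<circ> (g \<circ> h) = (t \<circ> g \<circ> t) \<circ> (t \<circ> h)" by (simp add: comp_assoc ttx)
    then have "perm_restrict (t \<circ> (g \<circ> h)) A \<in> H" using r[of "t \<circ> h"] tm[OF ps(2)] gH hH by simp
    moreover have "perm_restrict ((g \<circ> h) \<circ> t) A \<in> H"
      using r[of "h \<circ> t" g] mt[of h] image_compl(2)[OF hX ps(2)] gH hH by (simp add: comp_assoc)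
    moreover have "(g \<circ> h) ` A = X - A" unfolding image_o using ps image_compl(1)[OF gX] by simp
    ultimately show ?thesis using ghX by (simp add: W_def)
  next
    case sp
    then have gH: "perm_restrict (t \<circ> g) A \<in> H \<and> perm_restrict (g \<circ> t) A \<in> H"
      and hH: "perm_restrict h A \<in> H \<and> perm_restrict (t \<circ> h \<circ> t) A \<in> H"
      using g h A_ne_compl by (auto simp: W_def)
    have "(g \<circ> h) \<circ> t = (g \<circ> t) \<circ> (t \<circ> h \<circ> t)" by (simp add: comp_assoc ttx)
    then have "perm_restrict ((g \<circ> h) \<circ> t) A \<in> H" using r[of "t \<circ> h \<circ> t"] tmt[OF hX sp(2)] gH hH by simp
    moreover have "perm_restrict (t \<circ> (g \<circ> h)) A \<in> H"
      using r[of h "t \<circ> g"] sp(2) gH hH by (simp add: comp_assoc)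
    moreover have "(g \<circ> h) ` A = X - A" unfolding image_o using sp by simp
    ultimately show ?thesis using ghX by (simp add: W_def)
  next
    case ss
    then have gH: "perm_restrict (t \<circ> g) A \<in> H \<and> perm_restrict (g \<circ> t) A \<in> H"
      and hH: "perm_restrict (t \<circ> h) A \<in> H \<and> perm_restrict (h \<circ> t) A \<in> H"
      using g h A_ne_compl by (auto simp: W_def)
    have "g \<circ> h = (g \<circ> t) \<circ> (t \<circ> h)" by (simp add: comp_assoc ttx)
    then have "perm_restrict (g \<circ> h) A \<in> H" using r[of "t \<circ> h"] tm[OF ss(2)] gH hH by simp
    moreover have "t \<circ> (g \<circ> h) \<circ> t = (t \<circ> g) \<circ> (h \<circ> t)" by (simp add: comp_assoc)
    then have "perm_restrict (t \<circ> (g \<circ> h) \<circ> t) A \<in> H"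
      using r[of "h \<circ> t"] mt[of h] image_compl(2)[OF hX ss(2)] gH hH by simp
    moreover have "(g \<circ> h) ` A = A" unfolding image_o using ss image_compl(2)[OF gX] by simp
    ultimately show ?thesis using ghX by (simp add: W_def)
  qed
qed

lemma W_id: "id \<in> H \<Longrightarrow> id \<in> W H"
  using tt by (simp add: W_def permutes_id perm_restrict_id_eq)

lemma t_in_W: "id \<in> H \<Longrightarrow> t \<in> W H"
  using tt tX tA by (simp add: W_def perm_restrict_id_eq)

text \<open>A block-preserving element becomes trivial at an exponent that kills both of its
  coordinates; the square of a swapping element preserves the blocks.\<close>

lemma two_group_W:
  assumes P: "two_group A P"
  shows "two_group X (W P)"
proof -
  have cl: "g \<circ> h \<in> W P" if "g \<in> W P" "h \<in> W P" for g h
    by (rule W_comp[OF _ that]) (rule two_groupD(2)[OF P])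
  have pres: "\<exists>m. g ^^ (2 ^ m) = id" if g: "g \<in> W P" "g ` A = A" for g
  proof -
    have gX: "g permutes X" and gP: "perm_restrict g A \<in> P" "perm_restrict (t \<circ> g \<circ> t) A \<in> P"
      using g A_ne_compl by (auto simp: W_def)
    let ?u = "t \<circ> g \<circ> t"
    have uA: "?u ` A = A" using image_compl(1)[OF gX g(2)] tA' unfolding image_o tA by simp
    obtain m n where mn: "perm_restrict g A ^^ (2 ^ m) = id" "perm_restrict ?u A ^^ (2 ^ n) = id"
      using two_groupD(4)[OF P] gP by blast
    let ?N = "2 ^ (m + n) :: nat"
    have "perm_restrict g A ^^ ?N = id" "perm_restrict ?u A ^^ ?N = id"
      using mn by (metis funpow_mult id_funpow power_add mult.commute)+
    then have 1: "perm_restrict (g ^^ ?N) A = id" "perm_restrict (?u ^^ ?N) A = id"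
      using perm_restrict_funpow[of g A ?N] perm_restrict_funpow[of ?u A ?N] g(2) uA by simp_all
    have upow: "?u ^^ k = t \<circ> g ^^ k \<circ> t" for k
    proof (induction k)
      case 0 show ?case using tt by (simp only: funpow.simps comp_id)
    next
      case (Suc k)
      show ?case unfolding funpow.simps Suc using tt by (metis comp_assoc comp_id)
    qed
    have "(g ^^ ?N) c = id c" for c
    proof -
      consider "c \<in> A" | "c \<in> X - A" | "c \<notin> X" using AX by blast
      then show ?thesis
      proof cases
        case 1
        then show ?thesis using fun_cong[OF \<open>perm_restrict (g ^^ ?N) A = id\<close>, of c] by (simp add: perm_restrict_def)
      next
        case 2
        have "(?u ^^ ?N) (t c) = t c"
          using fun_cong[OF \<open>perm_restrict (?u ^^ ?N) A = id\<close>, of "t c"] t_mem(2)[OF 2] by (simp add: perm_restrict_def)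
        then have "t ((g ^^ ?N) c) = t c" unfolding upow by simp
        then show ?thesis by (metis tt' id_apply)
      next
        case 3
        then show ?thesis using permutes_not_in[OF permutes_funpow[OF gX]] by simp
      qed
    qed
    then show ?thesis by blast
  qed
  have "\<exists>m. g ^^ (2 ^ m) = id" if g: "g \<in> W P" for g
  proof (cases "g ` A = A")
    case False
    then have "g ` A = X - A" "g permutes X" using g by (auto simp: W_def)
    then have "(g \<circ> g) ` A = A" unfolding image_o using image_compl(2) by simp
    then obtain m where "(g \<circ> g) ^^ (2 ^ m) = id" using pres cl[OF g g] by blast
    moreover have "g \<circ> g = g ^^ 2" by (simp add: numeral_2_eq_2)
    ultimately have "g ^^ (2 ^ Suc m) = id" by (simp add: funpow_mult)
    then show ?thesis by blast
  qed (use pres g in blast)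
  then show ?thesis
    using W_id[OF two_groupD(1)[OF P]] cl unfolding two_group_def by (auto simp: W_def)
qed

end

section \<open>The subnormalizer as a wreath product\<close>

lemma permutes_disjoint_commute:
  assumes "f permutes A" "g permutes B" "A \<inter> B = {}"
  shows "f \<circ> g = g \<circ> f"
proof
  fix c
  show "(f \<circ> g) c = (g \<circ> f) c"
  proof (cases "c \<in> A")
    case True
    then have "c \<notin> B" "f c \<notin> B" using assms permutes_in_image[OF assms(1)] by blast+
    then show ?thesis using permutes_not_in[OF assms(2)] by simp
  next
    case False
    then have "g c \<notin> A"
      using assms permutes_in_image[OF assms(2), of c] permutes_not_in[OF assms(2), of c] by (cases "c \<in> B") auto
    then show ?thesis using permutes_not_in[OF assms(1)] False by simp
  qed
qed

lemma funpow_comp_commute: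
  assumes "f \<circ> g = g \<circ> f"
  shows "(f \<circ> g) ^^ n = f ^^ n \<circ> g ^^ n"
proof (induction n)
  case (Suc n)
  have fg: "f (g c) = g (f c)" for c using assms by (metis comp_apply)
  have "g ((f ^^ n) c) = (f ^^ n) (g c)" for c
    by (induction n) (simp_all add: fg[symmetric])
  then show ?case using Suc by (auto simp: fun_eq_iff)
qed simp

text \<open>A permutation of \<open>A\<close> commutes with \<open>z\<close>. So if \<open>g\<close>
  normalizes a 2-group \<open>Q\<close> on \<open>A\<close>, it also normalizes the 2-group
  generated by \<open>Q\<close> and \<open>z\<close>, which contains
  \<open>y \<circ> z\<close>.\<close>

lemma Sub_disjoint_extend:
  assumes fin: "finite X" and AX: "A \<subseteq> X" and z: "z permutes X - A" "z ^^ (2 ^ n) = id"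
  shows "Sub A y \<subseteq> Sub X (y \<circ> z)"
proof (rule Sub_subset)
  show "finite A" using fin AX finite_subset by blast
  show "sub_gens A y \<subseteq> Sub X (y \<circ> z)"
  proof
    fix g assume "g \<in> sub_gens A y"
    then obtain Q where Q: "two_group A Q" "y \<in> Q" and gQ: "\<And>q. q \<in> Q \<Longrightarrow> g \<circ> q \<circ> inv' g \<in> Q"
      and gA: "g permutes A"
      by (auto simp: sub_gens_def)
    have comm: "q \<circ> z ^^ i = z ^^ i \<circ> q" if "q permutes A" for q i
      by (rule permutes_disjoint_commute[OF that permutes_funpow[OF z(1)]]) blast
    let ?R = "{q \<circ> z ^^ i | q i. q \<in> Q}"
    have "two_group X ?R"
      unfolding two_group_def
    proof (intro conjI ballI)
      have "id = id \<circ> z ^^ 0" by simp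
      then show "id \<in> ?R" using two_groupD(1)[OF Q(1)] by blast
    next
      fix a b assume "a \<in> ?R" "b \<in> ?R"
      then obtain p i q j where ab: "p \<in> Q" "a = p \<circ> z ^^ i" "q \<in> Q" "b = q \<circ> z ^^ j" by blast
      have "a \<circ> b = p \<circ> (z ^^ i \<circ> q) \<circ> z ^^ j" unfolding ab by (simp add: comp_assoc)
      also have "\<dots> = (p \<circ> q) \<circ> (z ^^ i \<circ> z ^^ j)"
        unfolding comm[OF two_groupD(3)[OF Q(1) ab(3)], symmetric] by (simp add: comp_assoc)
      also have "\<dots> = (p \<circ> q) \<circ> z ^^ (i + j)" by (simp add: funpow_add)
      finally show "a \<circ> b \<in> ?R" using two_groupD(2)[OF Q(1) ab(1,3)] by blast
    next
      fix a assume "a \<in> ?R"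
      then obtain p i where a: "p \<in> Q" "a = p \<circ> z ^^ i" by blast
      have pA: "p permutes A" using two_groupD(3)[OF Q(1) a(1)] .
      show "a permutes X" unfolding a(2)
        using permutes_subset[OF pA AX] permutes_subset[OF permutes_funpow[OF z(1)]] by (intro permutes_compose) auto
      obtain m where "p ^^ (2 ^ m) = id" using two_groupD(4)[OF Q(1) a(1)] by blast
      then have "p ^^ (2 ^ (m + n)) = id" by (metis funpow_mult id_funpow power_add mult.commute)
      moreover have "(z ^^ i) ^^ (2 ^ (m + n)) = id"
        using z(2) by (metis funpow_mult id_funpow power_add mult.commute mult.left_commute)
      ultimately have "a ^^ (2 ^ (m + n)) = id"
        unfolding a(2) funpow_comp_commute[OF comm[OF pA]] by simp
      then show "\<exists>m. a ^^ (2 ^ m) = id" by blast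
    qed
    moreover have "y \<circ> z \<in> ?R"
    proof -
      have "y \<circ> z = y \<circ> z ^^ 1" by simp
      then show ?thesis using Q(2) by blast
    qed
    moreover have "g \<circ> r \<circ> inv' g \<in> ?R" if r: "r \<in> ?R" for r
    proof -
      obtain q i where q: "q \<in> Q" "r = q \<circ> z ^^ i" using r by blast
      have "g \<circ> r \<circ> inv' g = (g \<circ> q \<circ> inv' g) \<circ> z ^^ i"
        unfolding q(2) using comm[OF permutes_inv[OF gA], of i] by (simp add: comp_assoc)
      then show ?thesis using gQ[OF q(1)] by blast
    qed
    ultimately show "g \<in> Sub X (y \<circ> z)"
      using permutes_subset[OF gA AX] by (intro sub_gens_Sub sub_gensI[of g X ?R])
  qed
qed (auto intro: Sub_id Sub_comp)

lemma permutes_iff_bij: "p permutes S \<longleftrightarrow> bij p \<and> (\<forall>c. c \<notin> S \<longrightarrow> p c = c)"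
  by (auto simp: permutes_def bij_iff)

lemma exists_block_swap:
  assumes fin: "finite X" and AX: "A \<subseteq> X" and card: "card A = card (X - A)"
  shows "\<exists>t. block_swap X A t"
proof -
  obtain f where f: "bij_betw f A (X - A)"
    using finite_same_card_bij[OF finite_subset[OF AX fin] finite_Diff[OF fin] card] by blast
  define t where "t c = (if c \<in> A then f c else if c \<in> X then inv_into A f c else c)" for c
  have fA: "f c \<in> X - A" if "c \<in> A" for c using f that by (auto simp: bij_betw_def)
  have gB: "inv_into A f c \<in> A" if "c \<in> X - A" for c
    using f that by (metis bij_betw_imp_surj_on inv_into_into)
  have tt: "t (t c) = c" for c
    using fA gB f bij_betw_inv_into_left[OF f] bij_betw_inv_into_right[OF f] AX by (auto simp: t_def)
  have "t permutes X"
    unfolding permutes_iff_bij using tt AX by (auto simp: t_def intro: involuntory_imp_bij)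
  moreover have "t ` A = X - A"
    using f by (auto simp: t_def bij_betw_def)
  moreover have "t \<circ> t = id" using tt by auto
  ultimately show ?thesis by (auto simp: block_swap_def)
qed

lemma sub_gens_conj:
  assumes t: "t permutes X" and g: "g \<in> sub_gens X x"
  shows "t \<circ> g \<circ> inv' t \<in> sub_gens X (t \<circ> x \<circ> inv' t)"
proof -
  obtain Q where Q: "two_group X Q" "x \<in> Q" and gQ: "\<And>q. q \<in> Q \<Longrightarrow> g \<circ> q \<circ> inv' g \<in> Q"
    and gX: "g permutes X"
    using g by (auto simp: sub_gens_def)
  have it: "inv' (inv' t) = t" using permutes_inv_inv[OF t] .
  have ti: "inv' t permutes X" using permutes_inv[OF t] .
  have itt: "inv' t \<circ> (t \<circ> u) = u" for u using permutes_inv_o(2)[OF t] by (simp add: comp_assoc[symmetric])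
  let ?R = "{t \<circ> q \<circ> inv' t | q. q \<in> Q}"
  have "two_group X ?R"
    using two_group_conj_group[OF Q(1) permutes_bij[OF ti], of X] two_groupD(3)[OF Q(1)] t ti
    unfolding it by (simp add: permutes_compose)
  moreover have "(t \<circ> g \<circ> inv' t) \<circ> r \<circ> inv' (t \<circ> g \<circ> inv' t) \<in> ?R" if r: "r \<in> ?R" for r
  proof -
    obtain q where q: "q \<in> Q" "r = t \<circ> q \<circ> inv' t" using r by blast
    have "inv' (t \<circ> g \<circ> inv' t) = t \<circ> inv' g \<circ> inv' t"
      using o_inv_distrib[OF bij_comp[OF permutes_bij[OF ti] permutes_bij[OF gX]] permutes_bij[OF t]]
        o_inv_distrib[OF permutes_bij[OF gX] permutes_bij[OF ti]] it
        o_inv_distrib[of "t \<circ> g" "inv' t"] o_inv_distrib[of t g] bij_comp[of g t]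
        permutes_bij[OF t] permutes_bij[OF gX] permutes_bij[OF ti] by (simp add: comp_assoc)
    then have "(t \<circ> g \<circ> inv' t) \<circ> r \<circ> inv' (t \<circ> g \<circ> inv' t) = t \<circ> (g \<circ> q \<circ> inv' g) \<circ> inv' t"
      unfolding q(2) by (simp add: comp_assoc itt)
    then show ?thesis using gQ[OF q(1)] by blast
  qed
  moreover have "t \<circ> g \<circ> inv' t permutes X" using t ti gX by (intro permutes_compose)
  moreover have "t \<circ> x \<circ> inv' t \<in> ?R" using Q(2) by blast
  ultimately show ?thesis by (intro sub_gensI)
qed

lemma (in halving) conj_permutes:
  assumes "q permutes X - A"
  shows "t \<circ> q \<circ> t permutes A"
  unfolding permutes_iff_bij
proof (intro conjI allI impI)
  show "bij (t \<circ> q \<circ> t)" using permutes_bij[OF tX] permutes_bij[OF assms] by (intro bij_comp)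
  fix c assume c: "c \<notin> A"
  then have "t c \<notin> X - A" using t_mem(2)[of c] permutes_not_in[OF tX, of c] by (cases "c \<in> X") auto
  then show "(t \<circ> q \<circ> t) c = c" using permutes_not_in[OF assms] by simp
qed

text \<open>Write \<open>x = y \<circ> z\<close> with \<open>z\<close> the long cycle. The
  involution \<open>t\<close> is chosen such that one Sylow subgroup \<open>P\<close> of the
  symmetric group on \<open>A\<close> contains both \<open>y\<close> and the transported cycle
  \<open>zA\<close>. Then \<open>W P\<close> is a 2-group containing \<open>x\<close> and
  \<open>t\<close>, which yields one inclusion. For the other, \<open>P\<close> absorbs the
  coordinates on the block of \<open>z\<close>, and the Frattini argument handles generators that
  swap the blocks.\<close>

lemma Sub_eq_wreath:
  assumes finX: "finite X" and card_X: "card X = 2 ^ Suc m" and x: "x permutes X" "x ^^ (2 ^ n) = id"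
    and b: "b \<in> X" "card (orbit x b) = 2 ^ m" and c: "c \<in> X" "c \<notin> orbit x b" "x c = c"
    and A_def: "A = X - orbit x b" and y_def: "y = perm_restrict x A"
  shows "\<exists>t. block_swap X A t \<and> Sub X x = wreath_S2 (Sub A y) t"
proof -
  let ?B = "orbit x b"
  define z where "z = perm_restrict x ?B"
  have perm: "permutation x" using x finX by (auto simp: permutation_permutes)
  have BX: "?B \<subseteq> X" using permutes_orbit_subset[OF x(1) b(1)] .
  have finB: "finite ?B" using finite_orbit_permutation[OF perm] .
  have AX: "A \<subseteq> X" and XA: "X - A = ?B" and cA: "c \<in> A" using BX c by (auto simp: A_def)
  have finA: "finite A" using finite_subset[OF AX finX] .
  have card_A: "card A = 2 ^ m" unfolding A_def using card_X b(2) BX finB by (simp add: card_Diff_subset)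
  have injx: "inj x" using permutes_inj[OF x(1)] .
  have xB: "x ` ?B = ?B" by (rule image_orbit[OF perm])
  have xA: "x ` A = A" unfolding A_def using image_set_diff[OF injx] permutes_image[OF x(1)] xB by metis
  have yA: "y permutes A" unfolding y_def by (rule perm_restrict_permutes[OF injx xA])
  have zB: "z permutes ?B" unfolding z_def by (rule perm_restrict_permutes[OF injx xB])
  have ypow: "y ^^ (2 ^ n) = id"
    using perm_restrict_funpow[of x A "2 ^ n"] xA x(2) by (simp add: y_def perm_restrict_id_eq)
  have zpow: "z ^^ (2 ^ n) = id"
    using perm_restrict_funpow[of x ?B "2 ^ n"] xB x(2) by (simp add: z_def perm_restrict_id_eq)
  have xyz: "x = y \<circ> z"
  proof
    fix d
    consider "d \<in> A" | "d \<in> ?B" | "d \<notin> X" using AX XA by blast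
    then show "x d = (y \<circ> z) d"
    proof cases
      case 1
      then show ?thesis using permutes_not_in[OF zB] by (simp add: A_def y_def perm_restrict_def)
    next
      case 2
      then have "x d \<in> ?B" using xB by blast
      then show ?thesis using 2 permutes_not_in[OF yA, of "x d"] by (simp add: A_def z_def perm_restrict_def)
    next
      case 3
      then show ?thesis using permutes_not_in[OF x(1)] AX BX by (auto simp: y_def z_def perm_restrict_def)
    qed
  qed
  obtain P where P: "is_sylow A P" "y \<in> P" using sylow_containing[OF finA yA ypow] by blast
  have tP: "two_group A P" using P by (simp add: is_sylow_def)
  obtain t0 where t0: "block_swap X A t0" using exists_block_swap[OF finX AX] card_A b(2) XA by auto
  interpret t0: halving X A t0 by unfold_locales (use finX AX t0 cA in auto)
  \<comment> \<open>The long cycle transported to \<open>A\<close> by a provisional swap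
    \<open>t0\<close>; Sylow's theorem supplies an \<open>h\<close> moving it into
    \<open>P\<close>.\<close>
  let ?Z0 = "{t0 \<circ> q \<circ> t0 | q. q \<in> {z ^^ i | i. True}}"
  have tZ0: "two_group A ?Z0"
  proof -
    have "t0 \<circ> q \<circ> t0 permutes A" if "q \<in> {z ^^ i | i. True}" for q
      using that permutes_funpow[OF zB] by (intro t0.conj_permutes) (auto simp: XA)
    then show ?thesis
      using two_group_conj_group[OF two_group_cyclic[OF zB zpow] permutes_bij[OF t0.tX], of A]
      unfolding t0.inv_t by blast
  qed
  have "\<exists>h\<in>carrier (sym_group_on A). \<forall>q\<in>?Z0. h \<circ> q \<circ> inv' h \<in> P"
    by (rule sylow_conj_into[OF finA P(1) group.subgroup_self[OF group_sym_group_on] _ tZ0])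
      (use two_groupD(3)[OF tP] two_groupD(3)[OF tZ0] in auto)
  then obtain h where h: "h permutes A" "\<forall>q\<in>?Z0. h \<circ> q \<circ> inv' h \<in> P"
    unfolding sym_group_on_simps by blast
  have hX: "h permutes X" using permutes_subset[OF h(1) AX] .
  have ihX: "inv' h permutes X" using permutes_inv[OF hX] .
  have hh: "h \<circ> inv' h = id" "inv' h \<circ> h = id" using permutes_inv_o[OF h(1)] by auto
  \<comment> \<open>Conjugating by \<open>h\<close>, which commutes with \<open>z\<close>, corrects
    the swap: now \<open>t \<circ> z \<circ> t\<close> lies in \<open>P\<close>.\<close>
  define t where "t = h \<circ> t0 \<circ> inv' h"
  have "block_swap X A t"
    unfolding block_swap_def
  proof (intro conjI)
    show "t permutes X" unfolding t_def using hX ihX t0.tX by (intro permutes_compose)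
    show "t \<circ> t = id" unfolding t_def using hh t0.tt by (metis comp_assoc comp_id)
    have "inv' h ` A = A" using permutes_image[OF permutes_inv[OF h(1)]] .
    moreover have "h ` (X - A) = X - A"
      using image_set_diff[OF permutes_inj[OF hX]] permutes_image[OF hX] permutes_image[OF h(1)] by metis
    ultimately show "t ` A = X - A" unfolding t_def image_o using t0.tA by simp
  qed
  interpret halving X A t by unfold_locales (use finX AX \<open>block_swap X A t\<close> cA in auto)
  define zA where "zA = t \<circ> z \<circ> t"
  have zAP: "zA \<in> P"
  proof -
    have AB: "A \<inter> ?B = {}" by (auto simp: A_def)
    have "z \<circ> h = h \<circ> z" using permutes_disjoint_commute[OF h(1) zB AB] by simp
    then have "zA = h \<circ> (t0 \<circ> z \<circ> t0) \<circ> inv' h"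
      unfolding zA_def t_def using hh by (metis comp_assoc comp_id)
    moreover have "z = z ^^ 1" by simp
    then have "t0 \<circ> z \<circ> t0 \<in> ?Z0" by blast
    ultimately show ?thesis using h(2) by simp
  qed
  have zAA: "zA permutes A" using two_groupD(3)[OF tP zAP] .
  have cyc: "cyclic_on zA A"
  proof -
    have "cyclic_on x ?B" by (rule cyclic_on_orbit'[OF perm])
    then have "cyclic_on zA (t ` ?B)"
      by (rule cyclic_on_image) (simp add: zA_def z_def perm_restrict_def)
    then show ?thesis using tA' XA by simp
  qed
  interpret full_cycle A zA m
    by unfold_locales (use finA card_A zAA orbit_cyclic_eq3[OF cyc] in auto)
  have r_txt: "perm_restrict (t \<circ> x \<circ> t) A = zA"
  proof
    fix d
    show "perm_restrict (t \<circ> x \<circ> t) A d = zA d"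
      using t_mem(1)[of d] permutes_not_in[OF zAA, of d] XA
      by (auto simp: perm_restrict_def zA_def z_def)
  qed
  have txtA: "(t \<circ> x \<circ> t) ` A = A" using xB XA tA' unfolding image_o tA by simp
  have sub_zA: "g \<in> P" if "g \<in> sub_gens A zA" for g
    using that normalizer_subset_sylow[OF P(1) zAP] by (auto simp: sub_gens_def)
  have P_Sub: "P \<subseteq> Sub A y"
    using sub_gens_Sub[OF sub_gens_member[OF finA tP P(2)]] by (rule subsetI)
  \<comment> \<open>The stabilizer of the blocks in a 2-group containing \<open>x\<close> acts on
    the block of \<open>z\<close> as a 2-group containing \<open>z\<close>; transported to
    \<open>A\<close> it contains the full cycle \<open>zA\<close>, so it lies in
    \<open>P\<close>.\<close>
  have key: "perm_restrict (t \<circ> q \<circ> t) A \<in> P"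
    if Q: "two_group X Q" "x \<in> Q" and q: "q \<in> Q" "q ` A = A" for Q q
  proof -
    let ?Q = "{t \<circ> q \<circ> t | q. q \<in> Q}"
    have "two_group X ?Q"
      using two_group_conj_group[OF Q(1) permutes_bij[OF tX], of X] two_groupD(3)[OF Q(1)] tX
      unfolding inv_t by (simp add: permutes_compose)
    note R = two_group_restrict[OF this, of A]
    have "(t \<circ> q \<circ> t) ` A = A"
      using image_compl(1)[OF two_groupD(3)[OF Q(1) q(1)] q(2)] tA' unfolding image_o tA by simp
    then have k1: "perm_restrict (t \<circ> q \<circ> t) A \<in> {perm_restrict q A | q. q \<in> ?Q \<and> q ` A = A}"
      using q by blast
    have k2: "zA \<in> {perm_restrict q A | q. q \<in> ?Q \<and> q ` A = A}"
      using Q(2) txtA r_txt by blast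
    show ?thesis by (rule sub_zA[OF sub_gens_member[OF finA R k2 k1]])
  qed
  have WE: "wreath_S2 (Sub A y) t = W (Sub A y)" by (rule wreath_S2_eq_W) (rule Sub_permutes)
  have "sub_gens X x \<subseteq> W (Sub A y)"
  proof
    fix g assume g: "g \<in> sub_gens X x"
    obtain Q where Q: "two_group X Q" "x \<in> Q" and gQ: "\<And>q. q \<in> Q \<Longrightarrow> g \<circ> q \<circ> inv' g \<in> Q"
      and gX: "g permutes X"
      using g by (auto simp: sub_gens_def)
    have "g ` ?B = ?B \<or> g ` ?B = A"
      unfolding A_def by (rule sub_gens_preserve_halves[OF finX card_X x(1) b c g])
    then have "g ` A = A \<or> g ` A = X - A"
      using image_set_diff[OF permutes_inj[OF gX], of X ?B] permutes_image[OF gX] XA by (metis A_def)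
    then show "g \<in> W (Sub A y)"
    proof
      assume gA: "g ` A = A"
      have "perm_restrict g A \<in> Sub A y"
        unfolding y_def by (rule sub_gens_Sub[OF sub_gens_restrict[OF xA g gA]])
      moreover have "t \<circ> g \<circ> t \<in> sub_gens X (t \<circ> x \<circ> t)" using sub_gens_conj[OF tX g] by (simp add: inv_t)
      then have "perm_restrict (t \<circ> g \<circ> t) A \<in> sub_gens A zA"
        unfolding r_txt[symmetric]
      proof (rule sub_gens_restrict[OF txtA])
        show "(t \<circ> g \<circ> t) ` A = A" using image_compl(1)[OF gX gA] tA' unfolding image_o tA by simp
      qed
      then have "perm_restrict (t \<circ> g \<circ> t) A \<in> Sub A y" using sub_zA P_Sub by blast
      ultimately show ?thesis using gX gA by (simp add: W_def)
    next
      assume gA: "g ` A = X - A"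
      have gB: "g ` (X - A) = A" by (rule image_compl(2)[OF gX gA])
      have igB: "inv' g ` (X - A) = A" and igA: "inv' g ` A = X - A"
        using image_inv_eq[OF gX gA] image_inv_eq[OF gX gB] by auto
      have xXA: "x ` (X - A) = X - A" using xB XA by simp
      let ?u = "t \<circ> g" and ?v = "g \<circ> t"
      have u: "?u permutes X" "?u ` A = A" using permutes_compose[OF gX tX] gA tA' unfolding image_o by auto
      have v: "?v permutes X" "?v ` A = A" using permutes_compose[OF tX gX] gB tA unfolding image_o by auto
      have iu: "inv' ?u = inv' g \<circ> t" and iv: "inv' ?v = t \<circ> inv' g"
        using permutes_bij[OF gX] permutes_bij[OF tX] by (simp_all add: o_inv_distrib inv_t)
      have iuA: "inv' ?u ` A = A" and ivA: "inv' ?v ` A = A"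
        using image_inv_eq[OF u] image_inv_eq[OF v] by auto
      \<comment> \<open>\<open>?u\<close> conjugates \<open>y\<close> to the transported action of
        \<open>g \<circ> x \<circ> inv' g\<close> on the other block; that element is in
        \<open>Q\<close>, so by \<open>key\<close> the result lies in \<open>P\<close>.\<close>
      have "perm_restrict ?u A \<in> Sub A y"
      proof (rule conj_into_sylow_imp_Sub[OF finA P])
        show "perm_restrict ?u A permutes A" by (rule perm_restrict_permutes[OF permutes_inj[OF u(1)] u(2)])
        have "perm_restrict ?u A \<circ> y \<circ> inv' (perm_restrict ?u A) = perm_restrict (?u \<circ> x \<circ> inv' ?u) A"
          unfolding y_def inv_perm_restrict[OF u] using iuA xA by (simp add: perm_restrict_comp_invariant)
        also have "?u \<circ> x \<circ> inv' ?u = t \<circ> (g \<circ> x \<circ> inv' g) \<circ> t" unfolding iu by (simp add: comp_assoc)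
        also have "perm_restrict (t \<circ> (g \<circ> x \<circ> inv' g) \<circ> t) A \<in> P"
          by (rule key[OF Q gQ[OF Q(2)]]) (simp only: image_o igA xXA gB)
        finally show "perm_restrict ?u A \<circ> y \<circ> inv' (perm_restrict ?u A) \<in> P" .
      qed
      \<comment> \<open>For \<open>?v\<close> the roles are reversed: it is the inverse that
        conjugates \<open>y\<close> into \<open>P\<close>.\<close>
      moreover have "inv' (perm_restrict ?v A) \<in> Sub A y"
      proof (rule conj_into_sylow_imp_Sub[OF finA P])
        have pv: "perm_restrict ?v A permutes A" by (rule perm_restrict_permutes[OF permutes_inj[OF v(1)] v(2)])
        show "inv' (perm_restrict ?v A) permutes A" by (rule permutes_inv[OF pv])
        have "inv' (perm_restrict ?v A) \<circ> y \<circ> inv' (inv' (perm_restrict ?v A)) = perm_restrict (inv' ?v \<circ> x \<circ> ?v) A"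
          unfolding permutes_inv_inv[OF pv] unfolding y_def inv_perm_restrict[OF v] using v(2) xA
          by (simp add: perm_restrict_comp_invariant)
        also have "inv' ?v \<circ> x \<circ> ?v = t \<circ> (inv' g \<circ> x \<circ> g) \<circ> t" unfolding iv by (simp add: comp_assoc)
        also have "perm_restrict (t \<circ> (inv' g \<circ> x \<circ> g) \<circ> t) A \<in> P"
        proof (rule key[OF Q])
          show "inv' g \<circ> x \<circ> g \<in> Q" by (rule conj_inv_closed[OF finX two_groupD(3)[OF Q(1)] gX gQ Q(2)])
        qed (simp only: image_o gA xXA igB)
        finally show "inv' (perm_restrict ?v A) \<circ> y \<circ> inv' (inv' (perm_restrict ?v A)) \<in> P" .
      qed
      then have "inv' (inv' (perm_restrict ?v A)) \<in> Sub A y" by (rule Sub_inv)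
      then have "perm_restrict ?v A \<in> Sub A y"
        using permutes_inv_inv[OF perm_restrict_permutes[OF permutes_inj[OF v(1)] v(2)]] by simp
      ultimately show ?thesis using gX gA by (simp add: W_def)
    qed
  qed
  then have "Sub X x \<subseteq> W (Sub A y)"
    by (intro Sub_subset[OF finX]) (auto intro: W_id Sub_id W_comp Sub_comp)
  moreover have "wreath_S2 (Sub A y) t \<subseteq> Sub X x"
  proof -
    have 1: "Sub A y \<subseteq> Sub X x"
      unfolding xyz by (rule Sub_disjoint_extend[OF finX AX _ zpow]) (use zB XA in simp)
    \<comment> \<open>The coordinates of \<open>x\<close> are \<open>y\<close> and
      \<open>zA\<close>, both in \<open>P\<close>; so \<open>t\<close> lies in a 2-group containing
      \<open>x\<close>.\<close>
    have "x \<in> W P" using x(1) xA P(2) r_txt zAP by (simp add: W_def y_def)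
    then have 2: "t \<in> Sub X x"
      using sub_gens_Sub sub_gens_member[OF finX two_group_W[OF tP]] t_in_W[OF two_groupD(1)[OF tP]] by blast
    show ?thesis
    proof
      fix g assume "g \<in> wreath_S2 (Sub A y) t"
      then obtain a b s where "a \<in> Sub A y" "b \<in> Sub A y" "s = id \<or> s = t" "g = a \<circ> (t \<circ> b \<circ> t) \<circ> s"
        by (auto simp: wreath_S2_def)
      then show "g \<in> Sub X x" using 1 2 by (auto intro!: Sub_comp Sub_id)
    qed
  qed
  ultimately have "Sub X x = wreath_S2 (Sub A y) t" using WE by simp
  then show ?thesis using \<open>block_swap X A t\<close> by blast
qed

section \<open>Involutions commuting with a permutation\<close>

text \<open>On each pair \<open>{c, t c}\<close> such an \<open>e\<close> is the identity or the
  swap, because it commutes with \<open>t\<close>.\<close>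

lemma two_power_id_of_pairing:
  assumes eX: "e permutes X" and tt: "\<And>c. t (t c) = c" and comm: "e \<circ> t = t \<circ> e"
    and e: "\<And>c. c \<in> X \<Longrightarrow> e c = c \<or> e c = t c"
  shows "e \<circ> e = id"
proof
  fix c
  have et: "e (t c) = t (e c)" using comm by (metis comp_apply)
  show "(e \<circ> e) c = id c"
  proof (cases "c \<in> X")
    case True
    then show ?thesis using e[OF True] et tt by auto
  qed (use permutes_not_in[OF eX] in simp)
qed

text \<open>The products of some of the transpositions \<open>(c, t c)\<close> form an elementary abelian 2-group
  normalized by \<open>x\<close>.\<close>

lemma transpose_sub_gens:
  assumes fin: "finite X" and x: "x permutes X" "x ^^ (2 ^ n) = id" and t: "t permutes X" "t \<circ> t = id"
    and comm: "t \<circ> x = x \<circ> t" and a: "a \<in> X"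
  shows "transpose a (t a) \<in> sub_gens X x"
proof -
  have tt: "t (t c) = c" for c using t(2) by (metis comp_apply id_apply)
  have tx: "t ((x ^^ i) c) = (x ^^ i) (t c)" for i c
  proof (induction i)
    case (Suc i)
    then show ?case using comm by (simp add: fun_eq_iff)
  qed simp
  \<comment> \<open>The elementary abelian group extended by \<open>x\<close>: permutations
    commuting with \<open>t\<close> that act on the pairs as one power of \<open>x\<close>.\<close>
  define Q where "Q = {q. q permutes X \<and> q \<circ> t = t \<circ> q \<and> (\<exists>i. \<forall>c\<in>X. q c = (x ^^ i) c \<or> q c = t ((x ^^ i) c))}"
  have cl: "p \<circ> q \<in> Q" if p: "p \<in> Q" and q: "q \<in> Q" for p q
  proof -
    obtain i j where i: "\<forall>c\<in>X. p c = (x ^^ i) c \<or> p c = t ((x ^^ i) c)"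
      and j: "\<forall>c\<in>X. q c = (x ^^ j) c \<or> q c = t ((x ^^ j) c)" using p q by (auto simp: Q_def)
    have "(p \<circ> q) c = (x ^^ (i + j)) c \<or> (p \<circ> q) c = t ((x ^^ (i + j)) c)" if c: "c \<in> X" for c
    proof -
      have "q c \<in> X" using q c permutes_in_image by (fastforce simp: Q_def)
      then have "p (q c) = (x ^^ i) (q c) \<or> p (q c) = t ((x ^^ i) (q c))" using i by blast
      then show ?thesis using j c tx tt by (auto simp: funpow_add)
    qed
    moreover have "(p \<circ> q) \<circ> t = t \<circ> (p \<circ> q)"
      using p q by (auto simp: Q_def) (metis comp_assoc)
    moreover have "p \<circ> q permutes X" using p q permutes_compose by (auto simp: Q_def)
    ultimately show ?thesis unfolding Q_def by blast
  qed
  have id: "id \<in> Q" unfolding Q_def by (auto simp: permutes_id intro: exI[of _ 0])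
  have pw: "q ^^ k \<in> Q" if "q \<in> Q" for q k by (rule funpow_mem[OF id cl that])
  have pwi: "\<forall>c\<in>X. (q ^^ k) c = (x ^^ (i * k)) c \<or> (q ^^ k) c = t ((x ^^ (i * k)) c)"
    if q: "q \<in> Q" "\<forall>c\<in>X. q c = (x ^^ i) c \<or> q c = t ((x ^^ i) c)" for q i k
  proof (induction k)
    case (Suc k)
    have "q ^^ k permutes X" using pw[OF q(1)] by (simp add: Q_def)
    then have "(q ^^ k) c \<in> X" if "c \<in> X" for c using that permutes_in_image by fastforce
    then have "q ((q ^^ k) c) = (x ^^ i) ((q ^^ k) c) \<or> q ((q ^^ k) c) = t ((x ^^ i) ((q ^^ k) c))" if "c \<in> X" for c
      using q(2) that by blast
    then show ?case using Suc tx tt by (auto simp: funpow_add) metis+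
  qed simp
  have tQ: "two_group X Q"
    unfolding two_group_def
  proof (intro conjI ballI)
    fix q assume q: "q \<in> Q"
    then obtain i where i: "\<forall>c\<in>X. q c = (x ^^ i) c \<or> q c = t ((x ^^ i) c)" by (auto simp: Q_def)
    let ?e = "q ^^ (2 ^ n)"
    have eQ: "?e \<in> Q" using pw q by blast
    have xi: "x ^^ (i * 2 ^ n) = id" by (metis funpow_mult id_funpow mult.commute x(2))
    have "?e \<circ> ?e = id"
      by (rule two_power_id_of_pairing[OF _ tt]) (use eQ pwi[OF q i, of "2 ^ n"] xi in \<open>auto simp: Q_def\<close>)
    moreover have "q ^^ (2 ^ Suc n) = ?e \<circ> ?e" by (simp add: mult_2 funpow_add)
    ultimately show "\<exists>m. q ^^ (2 ^ m) = id" by metis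
  qed (use id cl in \<open>auto simp: Q_def\<close>)
  have "x \<in> Q" using x(1) comm unfolding Q_def by (auto intro: exI[of _ 1])
  moreover have "transpose a (t a) \<in> Q"
  proof -
    have "t a \<in> X" using a t(1) permutes_in_image by fastforce
    then have "transpose a (t a) permutes X" using a by (intro permutes_swap_id)
    moreover have "t c = t d \<longleftrightarrow> c = d" for c d using tt by metis
    then have "transpose a (t a) (t c) = t (transpose a (t a) c)" for c
      by (cases "c = a"; cases "c = t a"; cases "t c = a") (auto simp: transpose_def tt)
    then have "transpose a (t a) \<circ> t = t \<circ> transpose a (t a)" by auto
    moreover have "transpose a (t a) c = (x ^^ 0) c \<or> transpose a (t a) c = t ((x ^^ 0) c)" for c
      by (auto simp: transpose_def tt)
    ultimately show ?thesis unfolding Q_def by blast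
  qed
  ultimately show ?thesis using sub_gens_member[OF fin tQ] by blast
qed

lemma exists_transversal:
  assumes fin: "finite X" and t: "t permutes X" "t \<circ> t = id" and nofix: "\<And>c. c \<in> X \<Longrightarrow> t c \<noteq> c"
  shows "\<exists>Y \<subseteq> X. block_swap X Y t \<and> 2 * card Y = card X"
proof -
  have tt: "t (t c) = c" for c using t(2) by (metis comp_apply id_apply)
  \<comment> \<open>The choice depends only on the set \<open>{c, t c}\<close>, so both points of a
    pair get the same representative.\<close>
  define s where "s c = (SOME d. d \<in> {c, t c})" for c
  have s: "s c = c \<or> s c = t c" for c
    using someI_ex[of "\<lambda>d. d \<in> {c, t c}"] by (auto simp: s_def)
  have st: "s (t c) = s c" for c by (simp add: s_def tt insert_commute)
  have tX: "t c \<in> X" if "c \<in> X" for c using that t(1) permutes_in_image by fastforce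
  define Y where "Y = s ` X"
  have YX: "Y \<subseteq> X" using s tX by (auto simp: Y_def) metis
  have sY: "s c = c" if "c \<in> Y" for c using that s st by (auto simp: Y_def) metis
  have tY: "t ` Y = X - Y"
  proof
    show "t ` Y \<subseteq> X - Y"
    proof
      fix d assume "d \<in> t ` Y"
      then obtain c where c: "c \<in> Y" "d = t c" by blast
      have "d \<notin> Y"
      proof
        assume "d \<in> Y"
        then have "t c = c" using sY[of d] sY[of c] st c by metis
        then show False using nofix c YX by blast
      qed
      then show "d \<in> X - Y" using c YX tX by blast
    qed
    show "X - Y \<subseteq> t ` Y"
    proof
      fix d assume d: "d \<in> X - Y"
      then have "s d \<in> Y" by (auto simp: Y_def)
      then have "s d = t d" using s[of d] d by auto
      then have "d = t (s d)" by (simp add: tt)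
      then show "d \<in> t ` Y" using \<open>s d \<in> Y\<close> by blast
    qed
  qed
  have "card (X - Y) = card Y" unfolding tY[symmetric]
    using permutes_inj[OF t(1)] by (simp add: card_image inj_on_subset)
  moreover have "card X = card Y + card (X - Y)"
    using card_Diff_subset[OF finite_subset[OF YX fin] YX] card_mono[OF fin YX] by simp
  ultimately have "2 * card Y = card X" by simp
  then show ?thesis using YX tY t unfolding block_swap_def by blast
qed

lemma exists_fixfree_involution:
  assumes fin: "finite X" and ev: "even (card X)"
  shows "\<exists>t. t permutes X \<and> t \<circ> t = id \<and> (\<forall>c\<in>X. t c \<noteq> c)"
proof -
  obtain A where A: "A \<subseteq> X" "card A = card X div 2" using obtain_subset_with_card_n[of "card X div 2" X] by auto
  have "card (X - A) = card A" using A ev fin by (auto simp: card_Diff_subset finite_subset)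
  then obtain t where t: "block_swap X A t" using exists_block_swap[OF fin A(1)] by auto
  have tt: "t (t c) = c" for c using t by (metis block_swap_def comp_apply id_apply)
  have "t c \<noteq> c" if c: "c \<in> X" for c
  proof (cases "c \<in> A")
    case True
    then have "t c \<in> X - A" using t unfolding block_swap_def by blast
    then show ?thesis using True by auto
  next
    case False
    then have "c \<in> t ` A" using t c by (auto simp: block_swap_def)
    then have "t c \<in> A" using tt by auto
    then show ?thesis using False by auto
  qed
  then show ?thesis using t by (auto simp: block_swap_def)
qed

section \<open>The action on the pairs of an involution\<close>

context halving
begin

text \<open>\<open>q\<close> permutes the pairs \<open>{c, t c}\<close> as \<open>p\<close> permutes their representatives in \<open>A\<close>.\<close>

definition rel :: "('a \<Rightarrow> 'a) \<Rightarrow> ('a \<Rightarrow> 'a) \<Rightarrow> bool"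
  where "rel q p \<longleftrightarrow> q permutes X \<and> q \<circ> t = t \<circ> q \<and> p permutes A \<and>
    (\<forall>c\<in>A. q c = p c \<or> q c = t (p c))"

text \<open>The element above \<open>p\<close> that acts alike on both blocks; by
  \<open>lift_comp\<close> it is a homomorphic section of the passage to pairs.\<close>

definition lift :: "('a \<Rightarrow> 'a) \<Rightarrow> 'a \<Rightarrow> 'a"
  where "lift p = p \<circ> (t \<circ> p \<circ> t)"

lemma relD: "rel q p \<Longrightarrow> q permutes X" "rel q p \<Longrightarrow> q (t c) = t (q c)" "rel q p \<Longrightarrow> p permutes A"
  "rel q p \<Longrightarrow> c \<in> A \<Longrightarrow> q c = p c \<or> q c = t (p c)"
  by (auto simp: rel_def fun_eq_iff)

lemma relI:
  assumes "q permutes X" "\<And>c. q (t c) = t (q c)" "p permutes A" "\<And>c. c \<in> A \<Longrightarrow> q c = p c \<or> q c = t (p c)"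
  shows "rel q p"
  using assms by (auto simp: rel_def)

lemma rel_id: "rel id id"
  by (rule relI) (simp_all add: permutes_id)

lemma rel_comp:
  assumes "rel q p" "rel q' p'"
  shows "rel (q \<circ> q') (p \<circ> p')"
proof (rule relI)
  show "q \<circ> q' permutes X" "p \<circ> p' permutes A"
    using assms by (auto intro: permutes_compose dest: relD)
  show "(q \<circ> q') (t c) = t ((q \<circ> q') c)" for c using relD(2)[OF assms(1)] relD(2)[OF assms(2)] by simp
  fix c assume c: "c \<in> A"
  have "p' c \<in> A" using c relD(3)[OF assms(2)] permutes_in_image by fastforce
  then show "(q \<circ> q') c = (p \<circ> p') c \<or> (q \<circ> q') c = t ((p \<circ> p') c)"
    using relD(4)[OF assms(2) c] relD(4)[OF assms(1), of "p' c"] relD(2)[OF assms(1), of "p' c"] by auto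
qed

lemma rel_pow: "rel q p \<Longrightarrow> rel (q ^^ n) (p ^^ n)"
proof (induction n)
  case 0
  show ?case unfolding funpow.simps by (rule rel_id)
next
  case (Suc n)
  then show ?case unfolding funpow.simps by (intro rel_comp)
qed

lemma rel_inv:
  assumes "rel q p"
  shows "rel (inv' q) (inv' p)"
proof (rule relI)
  have q: "q permutes X" and p: "p permutes A" using relD assms by auto
  show "inv' q permutes X" "inv' p permutes A" using q p permutes_inv by auto
  have iq: "inv' q (q c) = c" "q (inv' q c) = c" for c using permutes_inverses[OF q] by auto
  show it: "inv' q (t c) = t (inv' q c)" for c
    using relD(2)[OF assms, of "inv' q c"] iq by metis
  fix c assume c: "c \<in> A"
  let ?d = "inv' p c"
  have "?d \<in> A" using c permutes_in_image[OF permutes_inv[OF p]] by fastforce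
  then have "q ?d = c \<or> q ?d = t c" using relD(4)[OF assms, of ?d] permutes_inverses(1)[OF p] by simp
  then show "inv' q c = ?d \<or> inv' q c = t ?d" using iq it by (metis tt')
qed

lemma lift_apply: "p permutes A \<Longrightarrow> c \<in> A \<Longrightarrow> lift p c = p c"
  using t_mem(1)[of c] permutes_not_in[of p A "t c"] by (simp add: lift_def)

lemma rel_lift:
  assumes p: "p permutes A"
  shows "rel (lift p) p"
proof (rule relI)
  show "lift p permutes X" using base_comp(1)[OF p p] by (simp add: lift_def)
  have "A \<inter> (X - A) = {}" by blast
  moreover have "t \<circ> p \<circ> t permutes X - A"
    unfolding permutes_iff_bij
  proof (intro conjI allI impI)
    show "bij (t \<circ> p \<circ> t)" using permutes_bij[OF tX] permutes_bij[OF p] by (intro bij_comp)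
    fix c assume "c \<notin> X - A"
    then have "t c \<notin> A" using t_mem(1)[of c] permutes_not_in[OF tX, of c] AX by (cases "c \<in> X") auto
    then show "(t \<circ> p \<circ> t) c = c" using permutes_not_in[OF p] by simp
  qed
  ultimately have "p \<circ> (t \<circ> p \<circ> t) = (t \<circ> p \<circ> t) \<circ> p" using permutes_disjoint_commute[OF p] by blast
  then have "p (t (p (t c))) = t (p (t (p c)))" for c by (auto simp: fun_eq_iff)
  then show "lift p (t c) = t (lift p c)" for c by (simp add: lift_def)
qed (use p lift_apply in auto)

lemma rel_eq:
  assumes "rel q p" "c \<in> A" "q c = d \<or> q c = t d" "d \<in> A"
  shows "p c = d"
proof -
  have pA: "p c \<in> A" using assms relD(3) permutes_in_image by fastforce
  then have "p c = d \<or> p c = t d" using relD(4)[OF assms(1,2)] assms(3) by (metis tt')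
  then show ?thesis using t_mem(1)[OF assms(4)] pA by auto
qed

text \<open>The preimage of a 2-group is one: some power of \<open>a\<close> with 2-power exponent
  acts trivially on the pairs, and then its square is \<open>id\<close>.\<close>

lemma two_group_rel:
  assumes Q: "two_group A Q"
  shows "two_group X {q. \<exists>p\<in>Q. rel q p}"
  unfolding two_group_def
proof (intro conjI ballI)
  show "id \<in> {q. \<exists>p\<in>Q. rel q p}" using rel_id two_groupD(1)[OF Q] by blast
next
  fix a b assume "a \<in> {q. \<exists>p\<in>Q. rel q p}" "b \<in> {q. \<exists>p\<in>Q. rel q p}"
  then show "a \<circ> b \<in> {q. \<exists>p\<in>Q. rel q p}" using rel_comp two_groupD(2)[OF Q] by blast
next
  fix a assume "a \<in> {q. \<exists>p\<in>Q. rel q p}"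
  then obtain p where p: "p \<in> Q" "rel a p" by blast
  show "a permutes X" using relD p by blast
  obtain m where m: "p ^^ (2 ^ m) = id" using two_groupD(4)[OF Q p(1)] by blast
  let ?e = "a ^^ (2 ^ m)"
  have r: "rel ?e id" using rel_pow[OF p(2), of "2 ^ m"] m by simp
  have "?e c = c \<or> ?e c = t c" if c: "c \<in> X" for c
  proof (cases "c \<in> A")
    case True
    then show ?thesis using relD(4)[OF r] by simp
  next
    case False
    then have "t c \<in> A" using t_mem(2) c by blast
    then show ?thesis using relD(4)[OF r, of "t c"] relD(2)[OF r, of c] by (metis id_apply tt')
  qed
  then have "?e \<circ> ?e = id"
    using relD(1)[OF r] r by (intro two_power_id_of_pairing[of _ X t]) (auto simp: rel_def)
  moreover have "a ^^ (2 ^ Suc m) = ?e \<circ> ?e" by (simp add: mult_2 funpow_add)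
  ultimately show "\<exists>m. a ^^ (2 ^ m) = id" by metis
qed

text \<open>\<open>lift g\<close> normalizes the preimage of any \<open>Q\<close> normalized by
  \<open>g\<close>, and this preimage contains \<open>x\<close> when \<open>Q\<close> contains
  \<open>x'\<close>.\<close>

lemma lift_sub_gens:
  assumes x: "rel x x'" and g: "g \<in> sub_gens A x'"
  shows "lift g \<in> sub_gens X x"
proof -
  obtain Q where Q: "two_group A Q" "x' \<in> Q" and gQ: "\<And>q. q \<in> Q \<Longrightarrow> g \<circ> q \<circ> inv' g \<in> Q"
    and gA: "g permutes A"
    using g by (auto simp: sub_gens_def)
  note r = rel_lift[OF gA]
  show ?thesis
  proof (rule sub_gensI[OF relD(1)[OF r] two_group_rel[OF Q(1)]])
    show "x \<in> {q. \<exists>p\<in>Q. rel q p}" using x Q(2) by blast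
    fix q assume "q \<in> {q. \<exists>p\<in>Q. rel q p}"
    then obtain p where p: "p \<in> Q" "rel q p" by blast
    have "rel (lift g \<circ> q \<circ> inv' (lift g)) (g \<circ> p \<circ> inv' g)"
      by (intro rel_comp r p(2) rel_inv)
    then show "lift g \<circ> q \<circ> inv' (lift g) \<in> {q. \<exists>p\<in>Q. rel q p}" using gQ[OF p(1)] by blast
  qed
qed

lemma lift_comp:
  assumes p: "p permutes A" and q: "q permutes A"
  shows "lift (p \<circ> q) = lift p \<circ> lift q"
proof -
  note r = rel_comp[OF rel_lift[OF p] rel_lift[OF q]]
  note r' = rel_lift[OF permutes_compose[OF q p]]
  have A: "lift (p \<circ> q) c = (lift p \<circ> lift q) c" if c: "c \<in> A" for c
  proof -
    have "q c \<in> A" using c q permutes_in_image by fastforce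
    then show ?thesis using c lift_apply p q permutes_compose[OF q p] by simp
  qed
  show ?thesis
  proof
    fix c
    consider "c \<in> A" | "c \<in> X - A" | "c \<notin> X" by blast
    then show "lift (p \<circ> q) c = (lift p \<circ> lift q) c"
    proof cases
      case 2
      have "t (lift (p \<circ> q) c) = t ((lift p \<circ> lift q) c)"
        using A[OF t_mem(2)[OF 2]] relD(2)[OF r, of c] relD(2)[OF r', of c] by metis
      then show ?thesis by (metis tt')
    next
      case 3
      then show ?thesis using permutes_not_in[OF relD(1)[OF r]] permutes_not_in[OF relD(1)[OF r']] by simp
    qed (rule A)
  qed
qed

lemma lift_id: "lift id = id"
  by (simp add: lift_def tt)

lemma lift_Sub:
  assumes x: "rel x x'" and p: "p \<in> Sub A x'"
  shows "lift p \<in> Sub X x"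
proof -
  have "Sub A x' \<subseteq> {p. p permutes A \<and> lift p \<in> Sub X x}"
  proof (rule Sub_subset[OF finite_subset[OF AX fin]])
    show "id \<in> {p. p permutes A \<and> lift p \<in> Sub X x}" unfolding mem_Collect_eq lift_id
      by (simp only: permutes_id Sub_id simp_thms)
    show "sub_gens A x' \<subseteq> {p. p permutes A \<and> lift p \<in> Sub X x}"
      using lift_sub_gens[OF x] sub_gens_Sub sub_gens_permutes by blast
  qed (auto simp: lift_comp permutes_compose Sub_comp)
  then show ?thesis using p by blast
qed

text \<open>\<open>A\<close> holds exactly one point of each pair, so \<open>p\<close> can pick the
  representative of the image pair; two points of \<open>A\<close> with the same image pair are
  equal.\<close>

lemma exists_rel:
  assumes q: "q permutes X" and comm: "q \<circ> t = t \<circ> q"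
  shows "\<exists>p. rel q p"
proof -
  define p where "p c = (if c \<in> A then if q c \<in> A then q c else t (q c) else c)" for c
  have qt: "q (t c) = t (q c)" for c using comm by (metis comp_apply)
  have qX: "q c \<in> X" if "c \<in> A" for c using that AX q permutes_in_image by fastforce
  have "p permutes A"
  proof (rule bij_imp_permutes)
    have "p ` A \<subseteq> A" using qX t_mem(2) by (auto simp: p_def)
    moreover have "inj_on p A"
    proof (rule inj_onI)
      fix c d assume cd: "c \<in> A" "d \<in> A" "p c = p d"
      then have "q c = q d \<or> q c = t (q d)" by (auto simp: p_def split: if_splits) (metis tt')+
      then have "c = d \<or> c = t d" using qt permutes_inj[OF q] by (metis injD)
      then show "c = d" using t_mem(1)[OF cd(2)] cd(1) by auto
    qed
    ultimately show "bij_betw p A A"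
      using endo_inj_surj[OF finite_subset[OF AX fin]] by (auto simp: bij_betw_def)
  qed (simp add: p_def)
  then have "rel q p" using q qt by (intro relI) (auto simp: p_def)
  then show ?thesis by blast
qed

end

section \<open>Orbits of equal length\<close>

text \<open>Whether two powers agree at a point depends only on the difference of the exponents
  modulo the orbit length.\<close>

lemma funpow_eq_transfer:
  assumes x: "permutation x" and ab: "card (orbit x a) = card (orbit x b)"
    and eq: "(x ^^ i) a = (x ^^ j) a"
  shows "(x ^^ i) b = (x ^^ j) b"
proof -
  have inj: "inj x" using bij_is_inj[OF permutation_bijective[OF x]] .
  have *: "(x ^^ i) b = (x ^^ j) b" if ij: "i \<le> j" and eq: "(x ^^ i) a = (x ^^ j) a" for i j
  proof -
    have "(x ^^ (j - i)) a = a" using funpow_diff[OF inj ij eq] .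
    then have "(x ^^ (j - i)) b = b" using card_orbit_dvd_iff[OF x, of a "j - i"] card_orbit_dvd_iff[OF x, of b "j - i"] ab by simp
    then have "(x ^^ (i + (j - i))) b = (x ^^ i) b" by (simp only: funpow_add comp_apply)
    then show ?thesis by (metis ij le_add_diff_inverse)
  qed
  show ?thesis
  proof (cases "i \<le> j")
    case True
    then show ?thesis using eq by (rule *)
  next
    case False
    then have "j \<le> i" by simp
    then show ?thesis using *[OF _ eq[symmetric]] by simp
  qed
qed

text \<open>Send \<open>(x ^^ i) a\<close> to \<open>(x ^^ i) b\<close> and back; this is well
  defined because the orbits have equal length.\<close>

lemma exists_orbit_swap:
  assumes x: "permutation x" and ab: "card (orbit x a) = card (orbit x b)" "b \<notin> orbit x a"
  shows "\<exists>w. w permutes orbit x a \<union> orbit x b \<and> w \<circ> w = id \<and> w \<circ> x = x \<circ> w \<and> w a = b"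
proof -
  define w where "w c = (if c \<in> orbit x a then (x ^^ funpow_dist x a c) b
    else if c \<in> orbit x b then (x ^^ funpow_dist x b c) a else c)" for c
  have disj: "c \<notin> orbit x a" if "c \<in> orbit x b" for c
    using that orbit_eq_of_mem[OF x] ab(2) permutation_self_in_orbit[OF x] by blast
  have ina: "(x ^^ i) a \<in> orbit x a" and inb: "(x ^^ i) b \<in> orbit x b" for i
    using orbit_eq_range[OF x] by auto
  have wa: "w ((x ^^ i) a) = (x ^^ i) b" for i
    using funpow_eq_transfer[OF x ab(1) funpow_dist_prop[OF ina[of i]]] ina by (simp add: w_def)
  have wb: "w ((x ^^ i) b) = (x ^^ i) a" for i
    using funpow_eq_transfer[OF x ab(1)[symmetric] funpow_dist_prop[OF inb[of i]]] inb disj by (simp add: w_def)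
  have wo: "w c = c" if "c \<notin> orbit x a \<union> orbit x b" for c using that by (simp add: w_def)
  have cases: "(\<exists>i. c = (x ^^ i) a) \<or> (\<exists>i. c = (x ^^ i) b) \<or> c \<notin> orbit x a \<union> orbit x b" for c
    using orbit_eq_range[OF x] by auto
  have ww: "w (w c) = c" for c using cases[of c] wa wb wo by auto
  have xo: "x c \<in> orbit x d \<longleftrightarrow> c \<in> orbit x d" for c d
    using permutation_orbit_step[OF x, of c] orbit_eq_of_mem[OF x] permutation_self_in_orbit[OF x] by metis
  have wx: "w (x c) = x (w c)" for c
  proof -
    consider i where "c = (x ^^ i) a" | i where "c = (x ^^ i) b" | "c \<notin> orbit x a \<union> orbit x b"
      using cases[of c] by blast
    then show ?thesis
    proof cases
      case 1 then show ?thesis using wa[of i] wa[of "Suc i"] by simp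
    next
      case 2 then show ?thesis using wb[of i] wb[of "Suc i"] by simp
    next
      case 3 then show ?thesis using wo xo by simp
    qed
  qed
  have "w permutes orbit x a \<union> orbit x b"
    unfolding permutes_iff_bij using ww wo by (auto intro: involuntory_imp_bij)
  moreover have "w a = b" using wa[of 0] by simp
  ultimately show ?thesis using ww wx by (intro exI[of _ w]) auto
qed

lemma dvd_card_invariant:
  assumes x: "permutation x" and fin: "finite S" and inv: "\<And>c. c \<in> S \<Longrightarrow> orbit x c \<subseteq> S"
    and d: "\<And>c. c \<in> S \<Longrightarrow> d dvd card (orbit x c)"
  shows "d dvd card S"
proof -
  have S: "S = \<Union>(orbit x ` S)" using inv permutation_self_in_orbit[OF x] by blast
  have "d dvd card (\<Union>(orbit x ` S))"
  proof (rule dvd_partition)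
    show "finite (\<Union>(orbit x ` S))" using fin S by simp
    show "\<forall>c\<in>orbit x ` S. d dvd card c" using d by blast
    show "\<forall>c1\<in>orbit x ` S. \<forall>c2\<in>orbit x ` S. c1 \<noteq> c2 \<longrightarrow> c1 \<inter> c2 = {}"
    proof (intro ballI impI, rule ccontr)
      fix c1 c2 assume "c1 \<in> orbit x ` S" "c2 \<in> orbit x ` S" "c1 \<noteq> c2" "c1 \<inter> c2 \<noteq> {}"
      then obtain a b e where "c1 = orbit x a" "c2 = orbit x b" "e \<in> orbit x a" "e \<in> orbit x b" by auto
      then show False using orbit_eq_of_mem[OF x] \<open>c1 \<noteq> c2\<close> by metis
    qed
  qed
  then show ?thesis using S by simp
qed

lemma Sub_transpose_conj:
  assumes g: "g \<in> Sub X x" and de: "transpose d e \<in> Sub X x"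
  shows "transpose (g d) (g e) \<in> Sub X x"
proof -
  have "bij g" using Sub_permutes[OF g] permutes_bij by blast
  then have "transpose (g d) (g e) \<circ> g = g \<circ> transpose d e"
    by (auto simp: fun_eq_iff transpose_def bij_def inj_eq)
  then have "transpose (g d) (g e) = g \<circ> transpose d e \<circ> inv' g"
    using permutes_inv_o(1)[OF Sub_permutes[OF g]] by (metis comp_assoc comp_id)
  then show ?thesis using Sub_comp Sub_inv g de by metis
qed

lemma Sub_transpose_trans:
  assumes "transpose d e \<in> Sub X x" "transpose e f \<in> Sub X x"
  shows "transpose d f \<in> Sub X x"
proof (cases "d = f \<or> d = e")
  case True
  then show ?thesis using assms Sub_id by auto
next
  case False
  then show ?thesis using Sub_transpose_conj[OF assms(2,1)] by (metis transpose_apply_first transpose_apply_other)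
qed

lemma transposes_generate:
  assumes fin: "finite X" and H: "id \<in> H" "\<And>a b. a \<in> H \<Longrightarrow> b \<in> H \<Longrightarrow> a \<circ> b \<in> H"
    and t: "\<And>a b. a \<in> X \<Longrightarrow> b \<in> X \<Longrightarrow> transpose a b \<in> H"
  shows "{p. p permutes X} \<subseteq> H"
proof
  fix p assume "p \<in> {p. p permutes X}"
  then have "p permutes X" by simp
  then show "p \<in> H" using fin
  proof (induction rule: permutes_induct)
    case id
    show ?case by (rule H(1))
  next
    case (swap a b p)
    show ?case by (rule H(2)[OF t[OF swap.hyps(1,2)] swap.IH])
  qed
qed

section \<open>Cycle lengths of a 2-element\<close>

locale two_element_perm =
  fixes X :: "'a set" and x n
  assumes fin: "finite X" and xX: "x permutes X" and xpow: "x ^^ (2 ^ n) = id"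
begin

abbreviation sz where "sz c \<equiv> card (orbit x c)"

lemma perm: "permutation x" using xX fin by (auto simp: permutation_permutes)

lemma sz_pow2: "\<exists>i. sz c = 2 ^ i"
proof -
  have "sz c dvd 2 ^ n" using card_orbit_dvd_iff[OF perm] xpow by simp
  then show ?thesis using divides_primepow_nat[OF two_is_prime_nat] by blast
qed

lemma sz_step: "sz (x c) = sz c"
  by (simp add: permutation_orbit_step[OF perm])

lemma sz_mem: "d \<in> orbit x c \<Longrightarrow> sz d = sz c"
  by (simp add: orbit_eq_of_mem[OF perm])

lemma self: "c \<in> orbit x c"
  by (rule permutation_self_in_orbit[OF perm])

lemma orbit_X: "c \<in> X \<Longrightarrow> orbit x c \<subseteq> X"
  by (rule permutes_orbit_subset[OF xX])

lemma sz_1_iff: "sz c = 1 \<longleftrightarrow> x c = c"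
  using card_orbit_dvd_iff[OF perm, of c 1] by simp

lemma dvd_card_sz:
  assumes "\<And>c. c \<in> X \<Longrightarrow> P (sz c) \<Longrightarrow> d dvd sz c"
  shows "d dvd card {c \<in> X. P (sz c)}"
proof (rule dvd_card_invariant[OF perm])
  show "orbit x c \<subseteq> {c \<in> X. P (sz c)}" if "c \<in> {c \<in> X. P (sz c)}" for c
    using that orbit_X sz_mem by auto
qed (use fin assms in auto)

text \<open>Meant for a transposition that ignores a given pairing: of \<open>b\<close> and
  \<open>b'\<close>, at most one is the partner of \<open>a\<close>. If there were no such points,
  there would be at most two fixed points and at most one cycle of each length \<open>2 ^ i\<close>
  with \<open>i > 0\<close>, as a second cycle would contain two admissible points. Divisibility
  then leaves a single full cycle, or two fixed points with one cycle of each length up to half of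
  \<open>card X\<close>; both are excluded.\<close>

lemma exists_equal_orbits:
  assumes card_X: "card X = 2 ^ Suc (Suc j)" and nofull: "\<And>a. a \<in> X \<Longrightarrow> sz a \<noteq> 2 ^ Suc (Suc j)"
    and notbad: "\<And>a c. a \<in> X \<Longrightarrow> c \<in> X \<Longrightarrow> sz a = 2 ^ Suc j \<Longrightarrow> x c \<noteq> c"
  shows "\<exists>a\<in>X. \<exists>b\<in>X. \<exists>b'\<in>X. b \<noteq> b' \<and> b \<notin> orbit x a \<and> b' \<notin> orbit x a \<and> sz b = sz a \<and> sz b' = sz a"
proof (rule ccontr)
  assume "\<not> ?thesis"
  then have thin: False
    if "a \<in> X" "b \<in> X" "b' \<in> X" "b \<noteq> b'" "b \<notin> orbit x a" "b' \<notin> orbit x a" "sz b = sz a" "sz b' = sz a"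
    for a b b' using that by blast
  define E where "E i = {c \<in> X. sz c = 2 ^ i}" for i
  define N where "N i = {c \<in> X. sz c dvd 2 ^ i}" for i
  have E: "card (E i) = 0 \<or> card (E i) = 2 ^ i" if i: "i > 0" for i
  proof (cases "E i = {}")
    case False
    then obtain a where a: "a \<in> E i" by blast
    have "E i = orbit x a"
    proof
      show "orbit x a \<subseteq> E i" using a orbit_X sz_mem by (auto simp: E_def)
      show "E i \<subseteq> orbit x a"
      proof (rule ccontr)
        assume "\<not> E i \<subseteq> orbit x a"
        then obtain b where b: "b \<in> E i" "b \<notin> orbit x a" by blast
        have bo: "x b \<in> orbit x b" by (rule orbit.base)
        have "x b \<notin> orbit x a"
          using b(2) orbit_eq_of_mem[OF perm] self bo by metis
        moreover have "x b \<noteq> b" using b(1) one_less_power[of "2::nat" i] i sz_1_iff[of b] by (auto simp: E_def)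
        moreover have "x b \<in> X" using b(1) bo orbit_X by (auto simp: E_def)
        ultimately show False using thin[of a b "x b"] a b sz_step by (auto simp: E_def)
      qed
    qed
    moreover have "sz a = 2 ^ i" using a by (simp add: E_def)
    ultimately show ?thesis by simp
  qed simp
  have E0: "card (E 0) \<le> 2"
  proof (rule ccontr)
    assume "\<not> card (E 0) \<le> 2"
    then obtain T where T: "T \<subseteq> E 0" "card T = 3" using obtain_subset_with_card_n[of 3 "E 0"] by auto
    then obtain a b c where abc: "T = {a, b, c}" "a \<noteq> b" "b \<noteq> c" "a \<noteq> c" by (auto simp: card_3_iff)
    then have m: "a \<in> E 0" "b \<in> E 0" "c \<in> E 0" using T by auto
    then have "orbit x a = {a}" using sz_1_iff by (auto simp: E_def orbit_eq_singleton_iff)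
    then show False using thin[of a b c] m abc by (auto simp: E_def)
  qed
  have finN: "finite (N i)" "finite (E i)" for i using fin by (auto simp: N_def E_def)
  have N0: "N 0 = E 0" by (auto simp: N_def E_def)
  have NSuc: "card (N (Suc i)) = card (N i) + card (E (Suc i))" for i
  proof -
    have "N (Suc i) = N i \<union> E (Suc i)"
      using divides_primepow_nat[OF two_is_prime_nat] by (auto simp: N_def E_def le_Suc_eq simp del: power_Suc)
    moreover have "N i \<inter> E (Suc i) = {}" by (auto simp: N_def E_def dest: dvd_imp_le)
    ultimately show ?thesis using finN by (simp add: card_Un_disjoint)
  qed
  \<comment> \<open>The points outside \<open>N i\<close> lie on cycles whose length is divisible by
    \<open>2 ^ Suc i\<close>, and so is \<open>card X\<close>.\<close>
  have dvdN: "2 ^ Suc i dvd card (N i)" if i: "i \<le> Suc j" for i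
  proof -
    have "2 ^ Suc i dvd card {c \<in> X. \<not> sz c dvd 2 ^ i}"
    proof (rule dvd_card_sz)
      fix c assume c: "\<not> sz c dvd 2 ^ i"
      obtain l where l: "sz c = 2 ^ l" using sz_pow2 by blast
      then have "\<not> l \<le> i" using c le_imp_power_dvd by metis
      then show "2 ^ Suc i dvd sz c" unfolding l by (intro le_imp_power_dvd) simp
    qed
    moreover have "card X = card (N i) + card {c \<in> X. \<not> sz c dvd 2 ^ i}"
    proof -
      have "X = N i \<union> {c \<in> X. \<not> sz c dvd 2 ^ i}" "N i \<inter> {c \<in> X. \<not> sz c dvd 2 ^ i} = {}"
        by (auto simp: N_def)
      then show ?thesis using card_Un_disjoint[of "N i" "{c \<in> X. \<not> sz c dvd 2 ^ i}"] finN(1)[of i] fin by simp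
    qed
    moreover have "2 ^ Suc i dvd card X" unfolding card_X using i by (intro le_imp_power_dvd) simp
    ultimately show ?thesis by (simp add: dvd_add_left_iff del: power_Suc)
  qed
  have "card (E 0) = 0 \<or> card (E 0) = 2" using dvdN[of 0] E0 unfolding N0 by (auto elim!: dvdE)
  \<comment> \<open>Without fixed points, a lone cycle of length \<open>2 ^ Suc i\<close> would
    violate \<open>dvdN\<close>; with two fixed points, \<open>dvdN\<close> forces exactly one such
    cycle.\<close>
  have Ncard: "card (N i) = card (E 0) * 2 ^ i" if "i \<le> Suc j" for i
    using that
  proof (induction i)
    case (Suc i)
    have dv: "2 * (2 * 2 ^ i) dvd card (N (Suc i))" using dvdN[OF Suc.prems] by simp
    have e: "card (E (Suc i)) = 0 \<or> card (E (Suc i)) = 2 * 2 ^ i" using E[of "Suc i"] by simp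
    have IH: "card (N i) = card (E 0) * 2 ^ i" using Suc by simp
    show ?case
      using \<open>card (E 0) = 0 \<or> card (E 0) = 2\<close>
    proof
      assume z: "card (E 0) = 0"
      then have "2 * (2 * 2 ^ i) dvd card (E (Suc i))" using dv NSuc[of i] IH by simp
      then have "card (E (Suc i)) = 0" using e by (auto dest: dvd_imp_le)
      then show ?thesis using NSuc[of i] IH z by simp
    next
      assume z: "card (E 0) = 2"
      then have N: "card (N (Suc i)) = 2 * 2 ^ i + card (E (Suc i))" using NSuc[of i] IH by simp
      have "card (E (Suc i)) \<noteq> 0"
      proof
        assume "card (E (Suc i)) = 0"
        then have "2 * (2 * 2 ^ i) dvd 2 * 2 ^ i" using dv N by simp
        then have "2 * (2 * 2 ^ i) \<le> 2 * (2 ^ i :: nat)" by (rule dvd_imp_le) simp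
        then show False by simp
      qed
      then show ?thesis using N e z by simp
    qed
  qed (simp add: N0)
  have le: "sz c \<le> 2 ^ Suc (Suc j)" if "c \<in> X" for c
    using card_mono[OF fin orbit_X[OF that]] card_X by simp
  show False
    using \<open>card (E 0) = 0 \<or> card (E 0) = 2\<close>
  proof
    assume "card (E 0) = 0"
    then have "N (Suc j) = {}" using Ncard[of "Suc j"] finN by simp
    moreover have "X \<noteq> {}" using card_X by auto
    then obtain a where a: "a \<in> X" by blast
    obtain l where l: "sz a = 2 ^ l" using sz_pow2 by blast
    then have "l \<le> Suc (Suc j)" using le[OF a] by (simp del: power_Suc)
    then have "l \<le> Suc j" using l nofull[OF a] le_SucE by blast
    then have "sz a dvd 2 ^ Suc j" unfolding l by (rule le_imp_power_dvd)
    then show False using a \<open>N (Suc j) = {}\<close> by (auto simp: N_def)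
  next
    assume z: "card (E 0) = 2"
    then have "card (E (Suc j)) \<noteq> 0" using Ncard[of "Suc j"] Ncard[of j] NSuc[of j] by simp
    then obtain a where "a \<in> E (Suc j)" using finN by fastforce
    moreover obtain c where "c \<in> E 0" using z by fastforce
    ultimately show False using notbad[of a c] sz_1_iff by (auto simp: E_def)
  qed
qed

text \<open>The point opposite to \<open>c\<close> on its cycle; a fixed point is sent to itself,
  since \<open>1 div 2 = 0\<close>.\<close>

definition half where "half c = (x ^^ (sz c div 2)) c"

lemma half_in_orbit: "half c \<in> orbit x c"
  by (simp add: half_def orbit_eq_range[OF perm])

lemma half_half: "even (sz c) \<Longrightarrow> half (half c) = c"
proof -
  assume e: "even (sz c)"
  have "half (half c) = (x ^^ (sz c div 2 + sz c div 2)) c"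
    using sz_mem[OF half_in_orbit[of c]] by (simp add: half_def funpow_add)
  also have "sz c div 2 + sz c div 2 = sz c" using e by auto
  finally show ?thesis using card_orbit_dvd_iff[OF perm, of c "sz c"] by simp
qed

lemma half_ne: "even (sz c) \<Longrightarrow> half c \<noteq> c"
proof
  assume e: "even (sz c)" "half c = c"
  have "sz c > 0" by (rule card_orbit_pos[OF perm])
  moreover have "sz c dvd sz c div 2" using card_orbit_dvd_iff[OF perm] e(2) unfolding half_def by blast
  ultimately show False using e(1) by (auto dest!: dvd_imp_le elim!: evenE)
qed

lemma half_step: "half (x c) = x (half c)"
  by (simp add: half_def sz_step funpow_swap1)

lemma extend_by_half:
  assumes W: "W \<subseteq> X" "\<And>c. x c \<in> W \<longleftrightarrow> c \<in> W"
    and v: "v permutes W" "v \<circ> v = id" "\<And>c. c \<in> W \<Longrightarrow> v c \<noteq> c" "\<And>c. c \<in> W \<Longrightarrow> v (x c) = x (v c)"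
    and ev: "\<And>c. c \<in> X - W \<Longrightarrow> even (sz c)"
  shows "\<exists>u. u permutes X \<and> u \<circ> u = id \<and> u \<circ> x = x \<circ> u \<and> (\<forall>c\<in>X. u c \<noteq> c) \<and>
    (\<forall>c\<in>W. u c = v c) \<and> (\<forall>c\<in>X - W. u c = half c)"
proof -
  define u where "u c = (if c \<in> W then v c else if c \<in> X then half c else c)" for c
  have pW: "(x ^^ i) c \<in> W \<longleftrightarrow> c \<in> W" for i c by (induction i) (use W(2) in auto)
  have hW: "half c \<in> W \<longleftrightarrow> c \<in> W" for c by (simp add: half_def pW)
  have hX: "half c \<in> X" if "c \<in> X" for c using half_in_orbit orbit_X that by blast
  have vW: "v c \<in> W" if "c \<in> W" for c using that v(1) permutes_in_image by fastforce
  have vv: "v (v c) = c" for c using v(2) by (metis comp_apply id_apply)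
  have uu: "u (u c) = c" for c using vW vv hW hX half_half ev by (auto simp: u_def)
  have xXi: "x c \<in> X \<longleftrightarrow> c \<in> X" for c using permutes_in_image[OF xX] by fastforce
  have ux: "u (x c) = x (u c)" for c using W(2) v(4) half_step xXi permutes_not_in[OF xX] by (auto simp: u_def)
  have "u permutes X"
    unfolding permutes_iff_bij using uu W(1) by (auto simp: u_def intro: involuntory_imp_bij)
  moreover have "u c \<noteq> c" if "c \<in> X" for c using that v(3) half_ne ev by (auto simp: u_def)
  moreover have "u c = half c" if "c \<in> X - W" for c using that by (simp add: u_def)
  ultimately show ?thesis using uu ux by (intro exI[of _ u]) (auto simp: u_def)
qed

text \<open>The lift of the transposition of the pairs of \<open>b\<close> and \<open>c\<close>
  fixes \<open>a\<close> and moves \<open>b\<close> to \<open>c\<close> or to \<open>u c\<close>;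
  conjugate \<open>transpose a b\<close> by it and combine the result with the transposition of the
  pair of \<open>c\<close>.\<close>

lemma transposes_in_Sub:
  assumes u: "u permutes X" "u \<circ> u = id" "u \<circ> x = x \<circ> u" and Y: "halving X Y u"
    and lifts: "\<And>p. p permutes Y \<Longrightarrow> halving.lift u p \<in> Sub X x"
    and ab: "a \<in> X" "b \<in> X" "b \<noteq> a" "b \<noteq> u a" "transpose a b \<in> Sub X x"
    and c: "c \<in> X"
  shows "transpose a c \<in> Sub X x"
proof -
  interpret halving X Y u by (rule Y)
  have uX: "u d \<in> X" if "d \<in> X" for d using that u(1) permutes_in_image by fastforce
  have tu: "transpose d (u d) \<in> Sub X x" if "d \<in> X" for d
    by (rule sub_gens_Sub[OF transpose_sub_gens[OF fin xX xpow u that]])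
  note conj = Sub_transpose_conj and trans = Sub_transpose_trans
  have au: "transpose a (u a) \<in> Sub X x" and bu: "transpose b (u b) \<in> Sub X x" using tu ab by auto
  consider "c = a" | "c = u a \<or> c = b" | "c = u b" | "c \<noteq> a" "c \<noteq> u a" "c \<noteq> b" "c \<noteq> u b" by blast
  then show ?thesis
  proof cases
    case 1
    then show ?thesis using Sub_id by simp
  next
    case 2
    then show ?thesis using au ab(5) by auto
  next
    case 3
    then show ?thesis using trans[OF ab(5) bu] by simp
  next
    case 4
    define r where "r d = (if d \<in> Y then d else u d)" for d
    have rY: "r d \<in> Y" if "d \<in> X" for d using t_mem(2) that by (auto simp: r_def)
    have r: "r d = d \<or> r d = u d" for d by (simp add: r_def)
    define p where "p = transpose (r b) (r c)"
    have pY: "p permutes Y" unfolding p_def using rY ab(2) c by (intro permutes_swap_id)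
    let ?l = "lift p"
    have l: "?l d = p d \<or> ?l d = u (p (u d))" "d \<in> Y \<Longrightarrow> ?l d = p d" "d \<in> X - Y \<Longrightarrow> ?l d = u (p (u d))" for d
    proof -
      show *: "d \<in> Y \<Longrightarrow> ?l d = p d" for d using lift_apply[OF pY] .
      show **: "d \<in> X - Y \<Longrightarrow> ?l d = u (p (u d))" for d
        using *[OF t_mem(2)] relD(2)[OF rel_lift[OF pY], of "u d"] by simp
      show "?l d = p d \<or> ?l d = u (p (u d))"
        using *[of d] **[of d] permutes_not_in[OF relD(1)[OF rel_lift[OF pY]], of d] permutes_not_in[OF pY, of d] AX
        by (cases "d \<in> Y"; cases "d \<in> X") auto
    qed
    have ne: "a \<noteq> r b" "a \<noteq> r c" "u a \<noteq> r b" "u a \<noteq> r c"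
      using r[of b] r[of c] ab(3,4) 4 by (metis tt')+
    have "?l a = a" using l(1)[of a] ne by (auto simp: p_def transpose_def)
    moreover have "?l b = c \<or> ?l b = u c"
    proof (cases "b \<in> Y")
      case True
      then have "?l b = r c" using l(2) by (simp add: p_def r_def)
      then show ?thesis using r by metis
    next
      case False
      then have "?l b = u (r c)" using l(3) ab(2) by (simp add: p_def r_def)
      then show ?thesis using r by (metis tt')
    qed
    ultimately have "transpose a c \<in> Sub X x \<or> transpose a (u c) \<in> Sub X x"
      using conj[OF lifts[OF pY] ab(5)] by auto
    then show ?thesis using trans[where d = a and e = "u c" and f = c] tu[OF uX[OF c]] by auto
  qed
qed

end

section \<open>The non-exceptional case\<close>

context two_element_perm
begin

text \<open>Nontrivial cycles have even length, so the fixed points are even in number and can be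
  paired arbitrarily; elsewhere the half turn is used, which halves every nontrivial cycle on the
  pairs.\<close>

lemma pairing_with_fixed_points:
  assumes ev: "even (card X)"
  shows "\<exists>u. u permutes X \<and> u \<circ> u = id \<and> u \<circ> x = x \<circ> u \<and> (\<forall>c\<in>X. u c \<noteq> c) \<and>
    (\<forall>c\<in>X. x c \<noteq> c \<longrightarrow> u c = half c)"
proof -
  let ?W = "{c \<in> X. sz c = 1}"
  have evsz: "even (sz c)" if "sz c \<noteq> 1" for c using sz_pow2[of c] that by auto
  have "2 dvd card {c \<in> X. \<not> sz c = 1}" by (rule dvd_card_sz) (rule evsz)
  moreover have "X = ?W \<union> {c \<in> X. \<not> sz c = 1}" "?W \<inter> {c \<in> X. \<not> sz c = 1} = {}" by auto
  then have "card X = card ?W + card {c \<in> X. \<not> sz c = 1}"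
    using card_Un_disjoint[of ?W "{c \<in> X. \<not> sz c = 1}"] fin by simp
  ultimately have "even (card ?W)" using ev by simp
  then obtain v where v: "v permutes ?W" "v \<circ> v = id" "\<forall>c\<in>?W. v c \<noteq> c"
    using exists_fixfree_involution[of ?W] fin by auto
  have xW: "x c = c" if "c \<in> ?W" for c using that sz_1_iff by auto
  have "\<exists>u. u permutes X \<and> u \<circ> u = id \<and> u \<circ> x = x \<circ> u \<and> (\<forall>c\<in>X. u c \<noteq> c) \<and>
    (\<forall>c\<in>?W. u c = v c) \<and> (\<forall>c\<in>X - ?W. u c = half c)"
  proof (rule extend_by_half[OF _ _ v(1,2)])
    show "x c \<in> ?W \<longleftrightarrow> c \<in> ?W" for c using permutes_in_image[OF xX, of c] sz_step by auto
    show "v (x c) = x (v c)" if "c \<in> ?W" for c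
      using xW[OF that] xW[of "v c"] that permutes_in_image[OF v(1), of c] by simp
  qed (use v(3) evsz in auto)
  then show ?thesis using sz_1_iff by blast
qed

text \<open>If the half turn agreed with \<open>x\<close> at \<open>c\<close>, then
  \<open>sz c\<close> would divide \<open>sz c div 2 - 1\<close>, which is positive and
  smaller.\<close>

lemma half_ne_step:
  assumes "sz c \<noteq> 1" "sz c \<noteq> 2"
  shows "half c \<noteq> x c"
proof
  assume h: "half c = x c"
  obtain i where i: "sz c = 2 ^ i" using sz_pow2 by blast
  have "i \<noteq> 0" "i \<noteq> 1" using assms i by auto
  then obtain l where l: "i = Suc (Suc l)" by (metis One_nat_def not0_implies_Suc)
  have "sz c div 2 = 2 * 2 ^ l" unfolding i l by simp
  also have "\<dots> = Suc (2 * 2 ^ l - 1)" by simp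
  finally have d: "sz c div 2 = Suc (2 * 2 ^ l - 1)" .
  have "x ((x ^^ (2 * 2 ^ l - 1)) c) = x c" using h unfolding half_def d funpow.simps comp_apply .
  then have "(x ^^ (2 * 2 ^ l - 1)) c = c" using permutes_inj[OF xX] by (simp add: inj_eq)
  then have "sz c dvd 2 * 2 ^ l - 1" by (simp only: card_orbit_dvd_iff[OF perm])
  moreover have "(1::nat) \<le> 2 ^ l" by simp
  ultimately have "sz c \<le> 2 * 2 ^ l - 1" by (intro dvd_imp_le) linarith+
  then show False using i l \<open>1 \<le> 2 ^ l\<close> by simp
qed

text \<open>On a 2-cycle the half turn is \<open>x\<close> itself, so the cycle would collapse to a
  fixed point. Instead the 2-cycles, an even number, are matched with each other: take a transversal
  \<open>T\<close>, an involution of \<open>T\<close> without fixed points, and its lift.\<close>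

lemma pairing_of_two_cycles:
  fixes W
  defines "W \<equiv> {c \<in> X. sz c = 2}"
  assumes dv: "4 dvd card W"
  shows "\<exists>v. v permutes W \<and> v \<circ> v = id \<and> (\<forall>c\<in>W. v c \<noteq> c \<and> v c \<noteq> x c \<and> v (x c) = x (v c))"
proof (cases "W = {}")
  case True
  then show ?thesis using permutes_id by fastforce
next
  case False
  have finW: "finite W" using fin by (simp add: W_def)
  have xW: "x c \<in> W \<longleftrightarrow> c \<in> W" for c unfolding W_def using permutes_in_image[OF xX, of c] sz_step by auto
  have xx: "x (x c) = c" "x c \<noteq> c" if "c \<in> W" for c
    using that card_orbit_dvd_iff[OF perm, of c 2] sz_1_iff[of c] by (auto simp: W_def numeral_2_eq_2)
  define r where "r = perm_restrict x W"
  have rx: "c \<in> W \<Longrightarrow> r c = x c" for c by (simp add: r_def perm_restrict_def)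
  have rr: "r (r c) = c" for c using xx(1) xW by (auto simp: r_def perm_restrict_def)
  have "r permutes W"
    unfolding permutes_iff_bij using rr by (auto simp: r_def perm_restrict_def intro: involuntory_imp_bij)
  moreover have "r \<circ> r = id" using rr by auto
  ultimately obtain T where T: "T \<subseteq> W" "block_swap W T r" "2 * card T = card W"
    using exists_transversal[OF finW, of r] rx xx(2) by auto
  have "T \<noteq> {}" using T(3) False finW by auto
  interpret H: halving W T r by unfold_locales (use finW T \<open>T \<noteq> {}\<close> in auto)
  have "even (card T)" using T(3) dv by (auto elim!: dvdE)
  then obtain w where w: "w permutes T" "w \<circ> w = id" "\<forall>c\<in>T. w c \<noteq> c"
    using exists_fixfree_involution[of T] finW T(1) finite_subset by blast
  define v where "v = H.lift w"
  have rel: "H.rel v w" unfolding v_def by (rule H.rel_lift[OF w(1)])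
  have vW: "v permutes W" and vr: "v (r c) = r (v c)" for c using H.relD[OF rel] by auto
  have vv: "v \<circ> v = id" unfolding v_def using H.lift_comp[OF w(1) w(1)] w(2) H.lift_id by simp
  have T1: "v c \<in> T" "v c \<noteq> c" if "c \<in> T" for c
    using H.lift_apply[OF w(1) that] w(3) that permutes_in_image[OF w(1)] by (auto simp: v_def)
  have "v c \<noteq> c \<and> v c \<noteq> r c" if c: "c \<in> W" for c
  proof (cases "c \<in> T")
    case True
    then show ?thesis using T1[OF True] H.t_mem(1)[OF True] by auto
  next
    case False
    then have "r c \<in> T" using H.t_mem(2) c by blast
    then have "v (r c) \<in> T" "v (r c) \<noteq> r c" using T1 by auto
    then show ?thesis using vr[of c] rr False by metis
  qed
  moreover have "v (x c) = x (v c)" if "c \<in> W" for c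
    using vr[of c] rx[OF that] rx[of "v c"] permutes_in_image[OF vW, of c] that by simp
  ultimately show ?thesis using vW vv rx by (intro exI[of _ v]) auto
qed

text \<open>All cycle lengths other than 2 are multiples of 4, so the number of points on 2-cycles
  is a multiple of 4 as well. The condition \<open>u c \<noteq> x c\<close> keeps the action on the
  pairs free of fixed points.\<close>

lemma pairing_without_fixed_points:
  assumes dv: "4 dvd card X" and nofix: "\<And>c. c \<in> X \<Longrightarrow> x c \<noteq> c"
  shows "\<exists>u. u permutes X \<and> u \<circ> u = id \<and> u \<circ> x = x \<circ> u \<and> (\<forall>c\<in>X. u c \<noteq> c) \<and>
    (\<forall>c\<in>X. u c \<noteq> x c) \<and> (\<forall>c\<in>X. sz c \<noteq> 2 \<longrightarrow> u c = half c)"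
proof -
  let ?W = "{c \<in> X. sz c = 2}"
  have ne1: "sz c \<noteq> 1" if "c \<in> X" for c using nofix[OF that] sz_1_iff by blast
  have "4 dvd card {c \<in> X. \<not> sz c = 2}"
  proof (rule dvd_card_sz)
    fix c assume c: "c \<in> X" "sz c \<noteq> 2"
    obtain i where i: "sz c = 2 ^ i" using sz_pow2 by blast
    have "i \<noteq> 0" using ne1[OF c(1)] i by auto
    moreover have "i \<noteq> 1" using c(2) i by auto
    ultimately obtain l where l: "i = Suc (Suc l)" by (metis One_nat_def not0_implies_Suc)
    then show "4 dvd sz c" unfolding i by simp
  qed
  moreover have "X = ?W \<union> {c \<in> X. \<not> sz c = 2}" "?W \<inter> {c \<in> X. \<not> sz c = 2} = {}" by auto
  then have "card X = card ?W + card {c \<in> X. \<not> sz c = 2}"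
    using card_Un_disjoint[of ?W "{c \<in> X. \<not> sz c = 2}"] fin by simp
  ultimately have "4 dvd card ?W" using dv by (simp add: dvd_add_left_iff)
  then obtain v where v: "v permutes ?W" "v \<circ> v = id" "\<forall>c\<in>?W. v c \<noteq> c \<and> v c \<noteq> x c \<and> v (x c) = x (v c)"
    using pairing_of_two_cycles by blast
  have "\<exists>u. u permutes X \<and> u \<circ> u = id \<and> u \<circ> x = x \<circ> u \<and> (\<forall>c\<in>X. u c \<noteq> c) \<and>
    (\<forall>c\<in>?W. u c = v c) \<and> (\<forall>c\<in>X - ?W. u c = half c)"
  proof (rule extend_by_half[OF _ _ v(1,2)])
    show "x c \<in> ?W \<longleftrightarrow> c \<in> ?W" for c using permutes_in_image[OF xX, of c] sz_step by auto
    show "even (sz c)" if "c \<in> X - ?W" for c using sz_pow2[of c] ne1[of c] that by auto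
  qed (use v(3) in auto)
  then obtain u where u: "u permutes X" "u \<circ> u = id" "u \<circ> x = x \<circ> u" "\<forall>c\<in>X. u c \<noteq> c"
    "\<forall>c\<in>?W. u c = v c" "\<forall>c\<in>X - ?W. u c = half c" by blast
  have "u c \<noteq> x c" if c: "c \<in> X" for c
  proof (cases "c \<in> ?W")
    case True
    then show ?thesis using u(5) v(3) by simp
  next
    case False
    then show ?thesis using u(6) c half_ne_step[OF ne1[OF c]] by simp
  qed
  moreover have "u c = half c" if "c \<in> X" "sz c \<noteq> 2" for c using u(6) that by blast
  ultimately show ?thesis using u(1-4) by blast
qed

end

text \<open>The symmetric group on two points is itself a 2-group.\<close>

lemma Sub_two_points:
  assumes "card X = 2" and x: "x permutes X"
  shows "Sub X x = {p. p permutes X}"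
proof -
  obtain a b where X: "X = {a, b}" using assms(1) by (auto simp: card_2_iff)
  have "two_group X {p. p permutes X}"
    unfolding two_group_def
  proof (intro conjI ballI)
    fix p assume "p \<in> {p. p permutes X}"
    then have "p = id \<or> p = transpose a b" using permutes_doubleton_iff[of p a b] X by simp
    then have "p ^^ (2 ^ 1) = id" by (auto simp: numeral_2_eq_2)
    then show "\<exists>m. p ^^ (2 ^ m) = id" by blast
  qed (auto simp: permutes_id permutes_compose)
  then have "{p. p permutes X} \<subseteq> Sub X x"
    using sub_gens_Sub[OF sub_gens_member[of X "{p. p permutes X}" x]] x X by auto
  then show ?thesis using Sub_permutes by blast
qed

text \<open>Induction along a fixed-point-free involution \<open>u\<close> commuting with \<open>x\<close>: the action of \<open>x\<close> on
  the orbits of \<open>u\<close> is again not exceptional, so \<open>Sub X x\<close> contains the full symmetric group on these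
  orbits, and a transposition of \<open>Sub X x\<close> that does not respect them does the rest.\<close>

lemma Sub_eq_Sym:
  assumes "finite X" "card X = 2 ^ Suc j" "x permutes X" "x ^^ (2 ^ n) = id"
    and "j \<ge> 1 \<Longrightarrow> \<forall>a\<in>X. card (orbit x a) \<noteq> 2 ^ Suc j"
    and "j \<ge> 1 \<Longrightarrow> \<forall>a\<in>X. \<forall>c\<in>X. card (orbit x a) = 2 ^ j \<longrightarrow> x c \<noteq> c"
  shows "Sub X x = {p. p permutes X}"
  using assms
proof (induction j arbitrary: X x)
  case 0
  then show ?case by (simp add: Sub_two_points)
next
  case (Suc j)
  interpret two_element_perm X x n by unfold_locales (use Suc.prems in auto)
  have card_X: "card X = 2 ^ Suc (Suc j)" by fact
  have j1: "1 \<le> Suc j" by simp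
  have nofull: "sz a \<noteq> 2 ^ Suc (Suc j)" if "a \<in> X" for a using Suc.prems(5)[OF j1] that by blast
  have notbad: "x c \<noteq> c" if "a \<in> X" "c \<in> X" "sz a = 2 ^ Suc j" for a c using Suc.prems(6)[OF j1] that by blast
  have sz_bound: "\<exists>i \<le> Suc j. sz a = 2 ^ i" if a: "a \<in> X" for a
  proof -
    obtain i where i: "sz a = 2 ^ i" using sz_pow2 by blast
    have "sz a \<le> 2 ^ Suc (Suc j)" using card_mono[OF fin orbit_X[OF a]] card_X by simp
    then have "i \<le> Suc (Suc j)" unfolding i by (simp del: power_Suc)
    moreover have "i \<noteq> Suc (Suc j)" using nofull[OF a] i by auto
    ultimately show ?thesis using i by (intro exI[of _ i]) simp
  qed
  \<comment> \<open>The two pairings guard against different exceptions: with fixed points present,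
    cycles must get short; without them, none may arise.\<close>
  define F where "F \<longleftrightarrow> (\<exists>c\<in>X. x c = c)"
  have "\<exists>u. u permutes X \<and> u \<circ> u = id \<and> u \<circ> x = x \<circ> u \<and> (\<forall>c\<in>X. u c \<noteq> c) \<and>
    (F \<longrightarrow> (\<forall>c\<in>X. x c \<noteq> c \<longrightarrow> u c = half c)) \<and>
    (\<not> F \<longrightarrow> (\<forall>c\<in>X. u c \<noteq> x c) \<and> (\<forall>c\<in>X. sz c \<noteq> 2 \<longrightarrow> u c = half c))"
  proof (cases F)
    case True
    have "even (card X)" using card_X by simp
    then show ?thesis using pairing_with_fixed_points True by simp
  next
    case False
    have "4 dvd card X" unfolding card_X by simp
    then show ?thesis using pairing_without_fixed_points False by (simp add: F_def)
  qed
  then obtain u where u: "u permutes X" "u \<circ> u = id" "u \<circ> x = x \<circ> u" "\<forall>c\<in>X. u c \<noteq> c"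
    and uF: "F \<Longrightarrow> \<forall>c\<in>X. x c \<noteq> c \<longrightarrow> u c = half c"
    and uN: "\<not> F \<Longrightarrow> \<forall>c\<in>X. u c \<noteq> x c" "\<not> F \<Longrightarrow> \<forall>c\<in>X. sz c \<noteq> 2 \<longrightarrow> u c = half c" by blast
  obtain Y where Y: "Y \<subseteq> X" "block_swap X Y u" "2 * card Y = card X"
    using exists_transversal[OF fin u(1,2)] u(4) by blast
  have card_Y: "card Y = 2 ^ Suc j" using Y(3) card_X by simp
  have "Y \<noteq> {}" using card_Y by auto
  have H: "halving X Y u" by unfold_locales (use fin Y \<open>Y \<noteq> {}\<close> in auto)
  interpret H: halving X Y u by (rule H)
  obtain y where rel: "H.rel x y" using H.exists_rel[OF xX] u(3) by auto
  have yY: "y permutes Y" using H.relD(3)[OF rel] .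
  have finY: "finite Y" using Y(1) fin finite_subset by blast
  have permy: "permutation y" using yY finY by (auto simp: permutation_permutes)
  have ypow_eq: "(y ^^ i) c = c" if "c \<in> Y" "(x ^^ i) c = c \<or> (x ^^ i) c = u c" for c i
    using H.rel_eq[OF H.rel_pow[OF rel], of c i c] that by blast
  have ypow: "y ^^ (2 ^ n) = id"
  proof
    fix c
    show "(y ^^ (2 ^ n)) c = id c"
      using ypow_eq[of c "2 ^ n"] xpow permutes_not_in[OF permutes_funpow[OF yY]] by (cases "c \<in> Y") auto
  qed
  have yN: "y c \<noteq> c" if "\<not> F" "c \<in> Y" for c
  proof -
    have "c \<in> X" using that(2) Y(1) by blast
    then have "x c \<noteq> c" "x c \<noteq> u c" using that(1) uN(1) by (auto simp: F_def)
    then show ?thesis using H.relD(4)[OF rel that(2)] by metis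
  qed
  \<comment> \<open>A cycle of half length is excluded next to a fixed point, so cycles of
    \<open>x\<close> have length at most \<open>2 ^ j\<close>, and those of length
    \<open>2 ^ j\<close> are halved by \<open>u\<close>.\<close>
  have yF: "card (orbit y c) < 2 ^ j" if F "c \<in> Y" "j \<ge> 1" for c
  proof -
    have cX: "c \<in> X" using that(2) Y(1) by blast
    obtain i where i: "i \<le> Suc j" "sz c = 2 ^ i" using sz_bound[OF cX] by blast
    have "i \<noteq> Suc j" using notbad[OF cX] that(1) i by (auto simp: F_def)
    then have ij: "i \<le> j" using i by simp
    have "(x ^^ (2 ^ (j - 1))) c = c \<or> (x ^^ (2 ^ (j - 1))) c = u c"
    proof (cases "i = j")
      case True
      then have "sz c \<noteq> 1" using i that(3) by simp
      then have "u c = half c" using uF[OF that(1)] cX sz_1_iff by blast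
      moreover have "sz c div 2 = 2 ^ (j - 1)" using True i that(3) by (cases j) simp_all
      ultimately show ?thesis by (simp add: half_def)
    next
      case False
      then have "sz c dvd 2 ^ (j - 1)" unfolding i using ij by (intro le_imp_power_dvd) simp
      then have "(x ^^ (2 ^ (j - 1))) c = c" by (simp only: card_orbit_dvd_iff[OF perm])
      then show ?thesis ..
    qed
    then have "(y ^^ (2 ^ (j - 1))) c = c" using ypow_eq that(2) by blast
    then have "card (orbit y c) dvd 2 ^ (j - 1)" by (simp only: card_orbit_dvd_iff[OF permy])
    then have "card (orbit y c) \<le> 2 ^ (j - 1)" by (rule dvd_imp_le) simp
    also have "\<dots> < 2 ^ j" using that(3) by simp
    finally show ?thesis .
  qed
  have "Sub Y y = {p. p permutes Y}"
  proof (rule Suc.IH[OF finY card_Y yY ypow])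
    assume j: "j \<ge> 1"
    show "\<forall>a\<in>Y. card (orbit y a) \<noteq> 2 ^ Suc j"
    proof (intro ballI notI)
      fix c assume c: "c \<in> Y" "card (orbit y c) = 2 ^ Suc j"
      then have cX: "c \<in> X" using Y(1) by blast
      \<comment> \<open>Without fixed points a full cycle of \<open>y\<close> would come from a
        cycle of \<open>x\<close> of the same length \<open>2 ^ Suc j > 2\<close>, but
        \<open>u\<close> halves such a cycle.\<close>
      have "\<not> F" using yF[OF _ c(1) j] c(2) by auto
      obtain i where i: "i \<le> Suc j" "sz c = 2 ^ i" using sz_bound[OF cX] by blast
      have "(x ^^ sz c) c = c" using card_orbit_dvd_iff[OF perm, of c "sz c"] by simp
      then have "(y ^^ sz c) c = c" using ypow_eq c(1) by blast
      then have "card (orbit y c) dvd sz c" by (simp only: card_orbit_dvd_iff[OF permy])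
      then have "2 ^ Suc j \<le> (2 ^ i :: nat)" unfolding c(2) i(2) by (rule dvd_imp_le) simp
      then have s: "sz c = 2 ^ Suc j" using i by (simp del: power_Suc)
      have "sz c \<noteq> 2" using s j by simp
      then have "u c = half c" using uN(2)[OF \<open>\<not> F\<close>] cX by blast
      then have "(x ^^ (2 ^ j)) c = u c" using s by (simp add: half_def)
      then have "(y ^^ (2 ^ j)) c = c" using ypow_eq c(1) by blast
      then have "card (orbit y c) dvd 2 ^ j" by (simp only: card_orbit_dvd_iff[OF permy])
      then have "2 ^ Suc j \<le> (2 ^ j :: nat)" unfolding c(2) by (rule dvd_imp_le) simp
      then show False by simp
    qed
    show "\<forall>a\<in>Y. \<forall>c\<in>Y. card (orbit y a) = 2 ^ j \<longrightarrow> y c \<noteq> c"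
      using yF[OF _ _ j] yN by (metis less_irrefl)
  qed
  then have lifts: "H.lift p \<in> Sub X x" if "p permutes Y" for p
    using H.lift_Sub[OF rel] that by blast
  have "\<exists>a\<in>X. \<exists>b\<in>X. \<exists>b'\<in>X. b \<noteq> b' \<and> b \<notin> orbit x a \<and> b' \<notin> orbit x a \<and> sz b = sz a \<and> sz b' = sz a"
    by (rule exists_equal_orbits[OF card_X]) (rule nofull notbad, assumption+)+
  then obtain a b b' where ab: "a \<in> X" "b \<in> X" "b' \<in> X" "b \<noteq> b'" "b \<notin> orbit x a" "b' \<notin> orbit x a"
    "sz b = sz a" "sz b' = sz a"
    by blast
  \<comment> \<open>At most one of \<open>b\<close> and \<open>b'\<close> equals
    \<open>u a\<close>.\<close>
  define d where "d = (if b = u a then b' else b)"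
  have d: "d \<in> X" "d \<noteq> u a" "d \<notin> orbit x a" "sz d = sz a" using ab by (auto simp: d_def)
  have "d \<noteq> a" using d(3) self by blast
  \<comment> \<open>\<open>w\<close> is an involution commuting with \<open>x\<close>, so
    \<open>transpose_sub_gens\<close> yields \<open>transpose a d\<close>, which links two different
    pairs of \<open>u\<close>.\<close>
  obtain w where w: "w permutes orbit x a \<union> orbit x d" "w \<circ> w = id" "w \<circ> x = x \<circ> w" "w a = d"
    using exists_orbit_swap[OF perm d(4)[symmetric] d(3)] by blast
  have "w permutes X" using permutes_subset[OF w(1)] orbit_X ab(1) d(1) by blast
  then have "transpose a d \<in> Sub X x"
    using sub_gens_Sub[OF transpose_sub_gens[OF fin xX xpow _ w(2,3) ab(1)]] w(4) by simp
  then have t: "transpose a c \<in> Sub X x" if "c \<in> X" for c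
    using transposes_in_Sub[OF u(1-3) H lifts ab(1) d(1) \<open>d \<noteq> a\<close> d(2)] that by blast
  have "transpose c e \<in> Sub X x" if "c \<in> X" "e \<in> X" for c e
    using Sub_transpose_trans[where d = c and e = a and f = e] t[OF that(1)] t[OF that(2)] by (simp only: transpose_commute[of c a])
  then have "{p. p permutes X} \<subseteq> Sub X x"
    using transposes_generate[OF fin Sub_id Sub_comp] by blast
  then show ?case using Sub_permutes by blast
qed

section \<open>The exceptional cases in terms of cycle lengths\<close>

lemma Sub_psubset_of_half_orbit:
  assumes fin: "finite X" and card_X: "card X = 2 ^ Suc j" and j: "j \<ge> 1" and x: "x permutes X"
    and b: "b \<in> X" "card (orbit x b) = 2 ^ j" and c: "c \<in> X" "c \<notin> orbit x b" "x c = c"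
  shows "Sub X x \<subset> {p. p permutes X}"
proof -
  let ?B = "orbit x b"
  let ?T = "{g. g permutes X \<and> (g ` ?B = ?B \<or> g ` ?B = X - ?B)}"
  have perm: "permutation x" using x fin by (auto simp: permutation_permutes)
  have BX: "?B \<subseteq> X" using permutes_orbit_subset[OF x b(1)] .
  have T: "Sub X x \<subseteq> ?T"
  proof (rule Sub_subset[OF fin])
    show "sub_gens X x \<subseteq> ?T"
      using sub_gens_preserve_halves[OF fin card_X x b c] sub_gens_permutes by blast
    fix g h assume g: "g \<in> ?T" and h: "h \<in> ?T"
    have "g ` (X - ?B) = X - g ` ?B"
      using image_set_diff[OF permutes_inj, of g X X ?B] permutes_image[of g X] g by simp
    moreover have "X - (X - ?B) = ?B" using BX by (simp add: double_diff)
    ultimately have gc: "g ` ?B = ?B \<Longrightarrow> g ` (X - ?B) = X - ?B" "g ` ?B = X - ?B \<Longrightarrow> g ` (X - ?B) = ?B"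
      by simp_all
    have "g ` h ` ?B = ?B \<or> g ` h ` ?B = X - ?B"
    proof (cases "h ` ?B = ?B")
      case True
      then show ?thesis using g by simp
    next
      case False
      then have "h ` ?B = X - ?B" using h by blast
      then show ?thesis using g gc by (metis (mono_tags, lifting) mem_Collect_eq)
    qed
    then have "(g \<circ> h) ` ?B = ?B \<or> (g \<circ> h) ` ?B = X - ?B" unfolding image_o .
    moreover have "g \<circ> h permutes X" using g h permutes_compose[of h X g] by simp
    ultimately show "g \<circ> h \<in> ?T" by (intro CollectI conjI)
  qed (simp add: permutes_id)
  have "?B \<noteq> {b}"
  proof
    assume "?B = {b}"
    then have "2 ^ j = (1::nat)" using b(2) by simp
    then show False using j by simp
  qed
  then obtain e where e: "e \<in> ?B" "e \<noteq> b" using permutation_self_in_orbit[OF perm] by blast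
  have "\<exists>g. g permutes X \<and> g \<notin> ?T"
    by (rule halving_not_invariant[OF permutation_self_in_orbit[OF perm] e(1) e(2)[symmetric] c(1,2) BX]) simp
  then show ?thesis using T Sub_permutes by blast
qed

lemma is_m_cycle_iff:
  assumes fin: "finite X" and card_X: "card X = m" and m: "m \<ge> 2" and x: "x permutes X"
  shows "is_m_cycle m x \<longleftrightarrow> (\<exists>a\<in>X. card (orbit x a) = m)"
proof
  have perm: "permutation x" using x fin by (auto simp: permutation_permutes)
  {
    assume "is_m_cycle m x"
    then obtain cs where cs: "distinct cs" "length cs = m" "x = cycle_of_list cs" by (auto simp: is_m_cycle_def)
    let ?a = "cs ! 0"
    have "set cs \<subseteq> orbit x ?a"
    proof
      fix c assume "c \<in> set cs"
      then obtain i where i: "i < length cs" "c = cs ! i" by (auto simp: in_set_conv_nth)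
      have "map (x ^^ i) cs ! 0 = rotate i cs ! 0" using cyclic_rotation[OF cs(1)] cs(3) by simp
      then have "(x ^^ i) ?a = c" using i cs(2) m nth_rotate[of 0 cs i] by (cases cs) auto
      then show "c \<in> orbit x ?a" unfolding orbit_eq_range[OF perm] by blast
    qed
    then have le: "m \<le> card (orbit x ?a)"
      using card_mono[OF finite_orbit_permutation[OF perm]] distinct_card[OF cs(1)] cs(2) by metis
    \<comment> \<open>The list is not assumed to lie in \<open>X\<close>; its first point is moved
      by \<open>x\<close>, so it does.\<close>
    have a: "?a \<in> X"
    proof (rule ccontr)
      assume "?a \<notin> X"
      then have "orbit x ?a = {?a}" using permutes_not_in[OF x] by (simp add: orbit_eq_singleton_iff)
      then show False using le m by simp
    qed
    then have "card (orbit x ?a) = m" using le card_mono[OF fin permutes_orbit_subset[OF x a]] card_X by simp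
    then show "\<exists>a\<in>X. card (orbit x a) = m" using a by blast
  }
  {
    assume "\<exists>a\<in>X. card (orbit x a) = m"
    then obtain a where a: "a \<in> X" "card (orbit x a) = m" by blast
    have oX: "orbit x a = X" using card_subset_eq[OF fin permutes_orbit_subset[OF x a(1)]] a(2) card_X by simp
    let ?cs = "support x a"
    have set: "set ?cs = X" using support_set[OF perm] orbit_eq_range[OF perm] oX by metis
    have "x = cycle_of_list ?cs"
    proof
      fix b
      show "x b = cycle_of_list ?cs b"
        using cycle_restrict[OF perm, of b a] id_outside_supp[of b ?cs] permutes_not_in[OF x, of b] set
        by (cases "b \<in> X") metis+
    qed
    moreover have "length ?cs = m" using card_orbit_eq_least_power[OF perm, of a] a(2) by simp
    ultimately show "is_m_cycle m x"
      unfolding is_m_cycle_def using cycle_of_permutation[OF perm, of a] by blast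
  }
qed

context two_element_perm
begin

text \<open>The order is the least common multiple of the cycle lengths, here their maximum. A cycle
  of length \<open>2 ^ j\<close> leaves only \<open>2 ^ j\<close> further points, so no cycle is
  longer.\<close>

lemma ord_eq_half_iff:
  assumes card_X: "card X = 2 ^ Suc j" and c: "c \<in> X" "x c = c"
  shows "group.ord (sym_group_on X) x = 2 ^ j \<longleftrightarrow> (\<exists>b\<in>X. sz b = 2 ^ j)"
proof -
  interpret G: group "sym_group_on X" by (rule group_sym_group_on)
  have dvd_iff: "G.ord x dvd i \<longleftrightarrow> x ^^ i = id" for i
    using G.pow_eq_id[of x i] xX by (simp add: pow_sym_group_on)
  have all: "x ^^ i = id \<longleftrightarrow> (\<forall>b\<in>X. sz b dvd i)" for i
  proof
    assume "x ^^ i = id"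
    then show "\<forall>b\<in>X. sz b dvd i" using card_orbit_dvd_iff[OF perm] by simp
  next
    assume *: "\<forall>b\<in>X. sz b dvd i"
    show "x ^^ i = id"
    proof
      fix b
      show "(x ^^ i) b = id b"
        using * card_orbit_dvd_iff[OF perm, of b i] permutes_not_in[OF permutes_funpow[OF xX, of i], of b]
        by (cases "b \<in> X") auto
    qed
  qed
  show ?thesis
  proof
    assume o: "G.ord x = 2 ^ j"
    show "\<exists>b\<in>X. sz b = 2 ^ j"
    proof (rule ccontr)
      assume n: "\<not> ?thesis"
      have pw: "\<exists>i<j. sz b = 2 ^ i" if b: "b \<in> X" for b
      proof -
        have "sz b dvd 2 ^ j" using all[of "2 ^ j"] dvd_iff[of "2 ^ j"] o b by simp
        then obtain i where i: "i \<le> j" "sz b = 2 ^ i" using divides_primepow_nat[OF two_is_prime_nat] by blast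
        moreover have "i \<noteq> j" using n b i by auto
        ultimately show ?thesis by (intro exI[of _ i]) simp
      qed
      then have "j > 0" using c(1) by fastforce
      have "sz b dvd 2 ^ (j - 1)" if b: "b \<in> X" for b
      proof -
        obtain i where "i < j" "sz b = 2 ^ i" using pw[OF b] by blast
        then show ?thesis by (simp add: le_imp_power_dvd)
      qed
      then have "2 ^ j dvd (2 ^ (j - 1) :: nat)" using dvd_iff all o by metis
      then have "2 ^ j \<le> (2 ^ (j - 1) :: nat)" by (rule dvd_imp_le) simp
      then show False using \<open>j > 0\<close> by simp
    qed
  next
    assume "\<exists>b\<in>X. sz b = 2 ^ j"
    then obtain b where b: "b \<in> X" "sz b = 2 ^ j" by blast
    have "sz a dvd 2 ^ j" if a: "a \<in> X" for a
    proof -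
      obtain i where i: "sz a = 2 ^ i" using sz_pow2 by blast
      have "sz a \<le> 2 ^ j"
      proof (cases "a \<in> orbit x b")
        case True
        then show ?thesis using sz_mem b by simp
      next
        case False
        then have "orbit x a \<inter> orbit x b = {}" using orbit_eq_of_mem[OF perm] self by blast
        then have "orbit x a \<subseteq> X - orbit x b" using orbit_X[OF a] by blast
        then have "sz a \<le> card (X - orbit x b)" using fin by (intro card_mono) auto
        also have "\<dots> = 2 ^ j"
          using orbit_X[OF b(1)] fin card_X b(2) by (simp add: card_Diff_subset finite_subset)
        finally show ?thesis .
      qed
      then show ?thesis unfolding i by (simp add: le_imp_power_dvd)
    qed
    then have "G.ord x dvd 2 ^ j" using all dvd_iff by blast
    moreover have "x ^^ G.ord x = id" using dvd_iff[of "G.ord x"] by simp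
    then have "2 ^ j dvd G.ord x" using all[of "G.ord x"] b by auto
    ultimately show "G.ord x = 2 ^ j" using dvd_antisym by blast
  qed
qed

text \<open>The complement of the long cycle has \<open>2 ^ j\<close> points, one of which is fixed,
  so no other cycle can fill it.\<close>

lemma short_cycle_points_eq:
  assumes j: "j \<ge> 1" and card_X: "card X = 2 ^ Suc j" and c: "c \<in> X" "x c = c"
    and b: "b \<in> X" "sz b = 2 ^ j"
  shows "c \<notin> orbit x b" "{i \<in> X. sz i < 2 ^ j} = X - orbit x b"
proof -
  have szc: "sz c = 1" using sz_1_iff c by blast
  have pj: "(2::nat) ^ j \<noteq> 1" using j by simp
  show cb: "c \<notin> orbit x b" using sz_mem[of c b] szc b(2) pj by auto
  have "sz i < 2 ^ j" if i: "i \<in> X" "i \<notin> orbit x b" for i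
  proof -
    have "orbit x i \<inter> orbit x b = {}" using i(2) orbit_eq_of_mem[OF perm] self by blast
    then have sub: "orbit x i \<subseteq> X - orbit x b" using orbit_X[OF i(1)] by blast
    have cX: "card (X - orbit x b) = 2 ^ j"
      using orbit_X[OF b(1)] fin card_X b(2) by (simp add: card_Diff_subset finite_subset)
    have "orbit x i \<noteq> X - orbit x b"
    proof
      assume "orbit x i = X - orbit x b"
      then have "c \<in> orbit x i" "sz i = 2 ^ j" using c cb cX by auto
      then show False using sz_mem[of c i] szc pj by simp
    qed
    then have "orbit x i \<subset> X - orbit x b" using sub by blast
    then have "sz i < card (X - orbit x b)" using fin by (intro psubset_card_mono) auto
    then show ?thesis using cX by simp
  qed
  moreover have "\<not> sz i < 2 ^ j" if "i \<in> orbit x b" for i using sz_mem[OF that] b(2) by simp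
  ultimately show "{i \<in> X. sz i < 2 ^ j} = X - orbit x b" by blast
qed

end

theorem theorem3p6:
  fixes k :: nat and x :: "nat \<Rightarrow> nat"
  assumes "k \<ge> 3"
    and "two_element (sym_group (2 ^ k)) x"
  shows "(subnormalizer (sym_group (2 ^ k)) x \<subset> carrier (sym_group (2 ^ k)) \<longleftrightarrow>
      is_m_cycle (2 ^ k) x \<or>
      (group.ord (sym_group (2 ^ k)) x = 2 ^ (k - 1) \<and> fix_count (2 ^ k) x > 0)) \<and>
    (group.ord (sym_group (2 ^ k)) x = 2 ^ (k - 1) \<and> fix_count (2 ^ k) x > 0 \<longrightarrow>
      (\<exists>t. block_swap {1..2 ^ k} (short_cycle_points (2 ^ k) (2 ^ (k - 1)) x) t \<and>
        subnormalizer (sym_group (2 ^ k)) x =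
          wreath_S2
            (subnormalizer (sym_group_on (short_cycle_points (2 ^ k) (2 ^ (k - 1)) x))
              (short_cycle_part (2 ^ k) (2 ^ (k - 1)) x)) t))"
proof -
  define X where "X = {1..2 ^ k :: nat}"
  have G: "sym_group (2 ^ k) = sym_group_on X"
    unfolding X_def by (rule sym_group_on_atLeastAtMost[symmetric])
  interpret G: group "sym_group_on X" by (rule group_sym_group_on)
  obtain j where j: "k = Suc j" "j \<ge> 1" using assms(1) by (cases k) auto
  have fin: "finite X" and card_X: "card X = 2 ^ Suc j" by (simp_all add: X_def j(1))
  have xX: "x permutes X" using assms(2) unfolding two_element_def G by simp
  obtain n where n: "G.ord x = 2 ^ n" using assms(2) unfolding two_element_def G by blast
  have xpow: "x ^^ (2 ^ n) = id"
    using G.pow_ord_eq_1[of x] xX unfolding n by (simp add: pow_sym_group_on)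
  interpret two_element_perm X x n by unfold_locales (rule fin xX xpow)+
  have fix_iff: "fix_count (2 ^ k) x > 0 \<longleftrightarrow> (\<exists>c\<in>X. x c = c)"
    by (auto simp: fix_count_def X_def card_gt_0_iff)
  have Sub: "subnormalizer (sym_group_on X) x = Sub X x"
    by (rule subnormalizer_sym_group_on[OF fin xX xpow])
  have cyc_iff: "is_m_cycle (2 ^ k) x \<longleftrightarrow> (\<exists>a\<in>X. sz a = 2 ^ k)"
    by (rule is_m_cycle_iff[OF fin _ _ xX]) (simp_all add: card_X j)
  \<comment> \<open>Given a fixed point, order \<open>2 ^ (k - 1)\<close> amounts to the presence of
    a cycle of that length.\<close>
  have bad_iff: "G.ord x = 2 ^ (k - 1) \<and> fix_count (2 ^ k) x > 0 \<longleftrightarrow>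
      (\<exists>b\<in>X. sz b = 2 ^ j) \<and> (\<exists>c\<in>X. x c = c)"
    unfolding fix_iff using ord_eq_half_iff[OF card_X] j(1) by auto
  have "Sub X x \<subset> {p. p permutes X}" if full: "\<exists>a\<in>X. sz a = 2 ^ k"
  proof -
    obtain a where a: "a \<in> X" "sz a = 2 ^ k" using full by blast
    have "orbit x a = X" using card_subset_eq[OF fin orbit_X[OF a(1)]] a(2) card_X j(1) by simp
    then have "orbit x c = X" if "c \<in> X" for c using that orbit_eq_of_mem[OF perm] by blast
    then interpret full_cycle X x k by unfold_locales (use fin card_X j xX in auto)
    show ?thesis using Sub_psubset assms(1) by simp
  qed
  moreover have "Sub X x \<subset> {p. p permutes X}" if bad: "(\<exists>b\<in>X. sz b = 2 ^ j) \<and> (\<exists>c\<in>X. x c = c)"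
  proof -
    obtain b c where bc: "b \<in> X" "sz b = 2 ^ j" "c \<in> X" "x c = c" using bad by blast
    show ?thesis
      by (rule Sub_psubset_of_half_orbit[OF fin card_X j(2) xX bc(1,2,3)
            short_cycle_points_eq(1)[OF j(2) card_X bc(3,4,1,2)] bc(4)])
  qed
  \<comment> \<open>The hypotheses of \<open>Sub_eq_Sym\<close> are the negations of the two cases,
    which settles the remaining direction of the equivalence.\<close>
  moreover have "Sub X x = {p. p permutes X}"
    if "\<not> (\<exists>a\<in>X. sz a = 2 ^ k)" "\<not> ((\<exists>b\<in>X. sz b = 2 ^ j) \<and> (\<exists>c\<in>X. x c = c))"
    by (rule Sub_eq_Sym[OF fin card_X xX xpow]) (use that j(1) in auto)
  ultimately have 1: "Sub X x \<subset> {p. p permutes X} \<longleftrightarrow>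
      (\<exists>a\<in>X. sz a = 2 ^ k) \<or> (\<exists>b\<in>X. sz b = 2 ^ j) \<and> (\<exists>c\<in>X. x c = c)" by blast
  have 2: "\<exists>t. block_swap X (short_cycle_points (2 ^ k) (2 ^ (k - 1)) x) t \<and>
      Sub X x = wreath_S2 (subnormalizer (sym_group_on (short_cycle_points (2 ^ k) (2 ^ (k - 1)) x))
        (short_cycle_part (2 ^ k) (2 ^ (k - 1)) x)) t"
    if bad: "(\<exists>b\<in>X. sz b = 2 ^ j) \<and> (\<exists>c\<in>X. x c = c)"
  proof -
    obtain b c where bc: "b \<in> X" "sz b = 2 ^ j" "c \<in> X" "x c = c" using bad by blast
    note s = short_cycle_points_eq[OF j(2) card_X bc(3,4,1,2)]
    define A where "A = X - orbit x b"
    \<comment> \<open>The points on short cycles, fixed points included, form the complement of the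
      long cycle, which is the block \<open>A\<close> of the wreath product.\<close>
    have A: "short_cycle_points (2 ^ k) (2 ^ (k - 1)) x = A"
      using s(2) j(1) unfolding A_def short_cycle_points_def X_def[symmetric] by simp
    define y where "y = perm_restrict x A"
    have y: "short_cycle_part (2 ^ k) (2 ^ (k - 1)) x = y"
      unfolding short_cycle_part_def A y_def ..
    have xA: "x ` A = A"
      unfolding A_def using image_set_diff[OF permutes_inj[OF xX]] permutes_image[OF xX] image_orbit[OF perm] by metis
    have yA: "y permutes A" unfolding y_def by (rule perm_restrict_permutes[OF permutes_inj[OF xX] xA])
    have "y ^^ (2 ^ n) = id"
      using perm_restrict_funpow[of x A "2 ^ n"] xA xpow by (simp add: y_def perm_restrict_id_eq)
    then have "subnormalizer (sym_group_on A) y = Sub A y"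
      using subnormalizer_sym_group_on[OF _ yA] fin by (simp add: A_def)
    then show ?thesis
      unfolding A y
      using Sub_eq_wreath[OF fin card_X xX xpow bc(1,2,3) s(1) bc(4) A_def y_def] by simp
  qed
  show ?thesis
    unfolding G cyc_iff bad_iff Sub X_def[symmetric] sym_group_on_simps using 1 2 by blast
qed

end
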